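(* Let $f:S_d\to[0,+\infty]$ be convex, positively $1$-homogeneous and lower semicontinuous, with $\operatorname{dom}(f)\subset S_d^+$, $\operatorname{dom}(f)\neq\emptyset$, and $\operatorname{dom}(f)\cap S_d^{++}$ dense in $\operatorname{dom}(f)$. For each $\mu,\nu\in\mathcal P_2(\mathbb R^d)$, the dynamic cost $F(\mu,\nu)$ satisfies $$F(\mu,\nu)=\inf\left\{\int_{\mathbb R^d} f\left(\frac{d\lambda}{d|\lambda|}\right)d|\lambda| \;:\; \operatorname{tr}\left(\tfrac12\nabla^2\lambda\right)=\nu-\mu\right\}.$$
   Context: $S_d$ is the space of real symmetric $d\times d$ matrices with inner product $A:B=\operatorname{tr}(A^{T}B)$ and norm $\|A\|=\sqrt{A:A}$; $S_d^+$ (resp. $S_d^{++}$) is the set of nonnegative (resp. positive) definite ones. $\operatorname{dom}(f)=\{M\in S_d: f(M)<+\infty\}$. Positively $1$-homogeneous means $f(tA)=tf(A)$ for all $A\in S_d$, $t\ge 0$. $\mathcal P_2(\mathbb R^d)$ is the set of Borel probability measures on $\mathbb R^d$ with finite second moment; $\mathcal P_2((0,1)\times\mathbb R^d)$ is the set of Borel probability measures $\varrho$ on $(0,1)\times\mathbb R^d$ with $\int |x|^2\,d\varrho(t,x)<\infty$. For $X=\mathbb R^d$ or $X=(0,1)\times\mathbb R^d$, $\mathcal M(X,S_d^+)$ is the set of $S_d$-valued Borel measures $\lambda$ on $X$ with $\lambda(E)\in S_d^+$ for every Borel $E$; $|\lambda|$ is the total variation measure. $C_b^2(\mathbb R^d)$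 is the space of twice continuously differentiable functions on $\mathbb R^d$ with uniformly bounded Hessian (the function itself need not be bounded). $C_b^{1,2}((0,1)\times\mathbb R^d)$ is the space of functions $\varphi$ that are once continuously differentiable in $t$ and twice in $x$ with $\partial_t\varphi$ and $\nabla_x^2\varphi$ uniformly bounded. Fokker-Planck equation. A pair $(\varrho,\lambda)\in\mathcal P_2((0,1)\times\mathbb R^d)\times\mathcal M((0,1)\times\mathbb R^d,S_d^+)$ which can be disintegrated as $\varrho=\varrho_t\otimes\mathcal L^1|_{(0,1)}$, $\lambda=\lambda_t\otimes\mathcal L^1|_{(0,1)}$ solves $\partial_t\varrho=\operatorname{tr}(\frac12\nabla^2\lambda)$ if $\int_0^1|\lambda_t|(\mathbb R^d)\,dt<\infty$ and $$\int_0^1\int_{\mathbb R^d}\partial_t\varphi\,d\varrho_t\,dt=-\int_0^1\int_{\mathbb R^d}\tfrac12\nabla_x^2\varphi:d\lambda_t\,dt$$ for all $\varphi\in C_b^{1,2}((0,1)\times\mathbb R^d)$ whose closed support is contained in $(0,1)\times\mathbb R^d$. For such a solution $t\mapsto\varrho_t$ has a narrowly continuous representative on $[0,1]$ with values in $\mathcal P_2(\mathbb R^d)$, which is always used; $\varrho_0,\varrho_1$ denote its endpoint values. Dynamic cost: $$F(\mu,\nu)=\inf\left\{\int_0^1\int_{\mathbb R^d}f\left(\frac{d\lambda_t}{d|\lambda_t|}\right)d|\lambda_t|\,dt \;:\; \partial_t\varrho=\operatorname{tr}\left(\tfrac12\nabla^2\lambda\right),\ \varrho_0=\mu,\ \varrho_1=\nu\right\},$$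 with $\inf\emptyset=+\infty$. Static equation: $\operatorname{tr}(\frac12\nabla^2\lambda)=\nu-\mu$ means $\lambda\in\mathcal M(\mathbb R^d,S_d^+)$, $|\lambda|(\mathbb R^d)<\infty$ and $\int\frac12\nabla^2\varphi:d\lambda=\int\varphi\,d\nu-\int\varphi\,d\mu$ for all $\varphi\in C_b^2(\mathbb R^d)$. *)

theory Defs
  imports "HOL-Probability.Probability"
begin

section \<open>Symmetric matrices\<close>

definition sym_mats :: "(real^'d^'d) set" where
  "sym_mats = {A. transpose A = A}"

definition nonneg_mats :: "(real^'d^'d) set" where
  "nonneg_mats = {A \<in> sym_mats. \<forall>x. 0 \<le> x \<bullet> (A *v x)}"

definition pos_mats :: "(real^'d^'d) set" where
  "pos_mats = {A \<in> sym_mats. \<forall>x. x \<noteq> 0 \<longrightarrow> 0 < x \<bullet> (A *v x)}"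

text \<open>The library's inner product and norm on \<^typ>\<open>real^'d^'d\<close> are the Frobenius ones.\<close>

lemma inner_eq_trace: "A \<bullet> B = trace (transpose A ** B)" for A B :: "real^'d^'d"
proof -
  have "A \<bullet> B = (\<Sum>i\<in>UNIV. \<Sum>j\<in>UNIV. A $ i $ j * B $ i $ j)"
    by (simp add: inner_vec_def)
  also have "\<dots> = (\<Sum>j\<in>UNIV. \<Sum>i\<in>UNIV. A $ i $ j * B $ i $ j)"
    by (rule sum.swap)
  finally show ?thesis
    by (simp add: trace_def transpose_def matrix_matrix_mult_def)
qed

text \<open>A function \<open>f : S_d \<rightarrow> [0,\<infinity>]\<close> is represented by a function on all matrices of
  which only the values on \<^const>\<open>sym_mats\<close> are ever used.\<close>

definition edom :: "(real^'d^'d \<Rightarrow> ennreal) \<Rightarrow> (real^'d^'d) set" where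
  "edom f = {A \<in> sym_mats. f A < \<infinity>}"

definition convex_on_sym :: "(real^'d^'d \<Rightarrow> ennreal) \<Rightarrow> bool" where
  "convex_on_sym f \<longleftrightarrow> (\<forall>A\<in>sym_mats. \<forall>B\<in>sym_mats. \<forall>u\<in>{0..1}.
     f ((1 - u) *\<^sub>R A + u *\<^sub>R B) \<le> ennreal (1 - u) * f A + ennreal u * f B)"

text \<open>For \<open>t = 0\<close> this uses \<open>0 * \<infinity> = 0\<close> and says \<open>f 0 = 0\<close>.\<close>

definition pos_homogeneous :: "(real^'d^'d \<Rightarrow> ennreal) \<Rightarrow> bool" where
  "pos_homogeneous f \<longleftrightarrow> (\<forall>A\<in>sym_mats. \<forall>t\<ge>0. f (t *\<^sub>R A) = ennreal t * f A)"

definition lsc_on_sym :: "(real^'d^'d \<Rightarrow> ennreal) \<Rightarrow> bool" where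
  "lsc_on_sym f \<longleftrightarrow> (\<forall>A\<in>sym_mats. f A \<le> Liminf (at A within sym_mats) f)"


section \<open>Matrix-valued measures\<close>

text \<open>A measure with values in \<^const>\<open>nonneg_mats\<close> on the measurable space \<open>N\<close> (of which only
  \<open>space N\<close> and \<open>sets N\<close> matter) is a set function; its values off \<open>sets N\<close> are irrelevant.
  Countable additivity includes \<open>\<lambda> {} = 0\<close>, since a constant series converges only if it vanishes.\<close>

definition mat_measure :: "'x measure \<Rightarrow> ('x set \<Rightarrow> real^'d^'d) \<Rightarrow> bool" where
  "mat_measure N \<Lambda> \<longleftrightarrow>
     (\<forall>E\<in>sets N. \<Lambda> E \<in> nonneg_mats) \<and>
     (\<forall>A :: nat \<Rightarrow> 'x set. range A \<subseteq> sets N \<longrightarrow> disjoint_family A \<longrightarrow>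
        (\<lambda>n. \<Lambda> (A n)) sums \<Lambda> (\<Union>n. A n))"

definition variation :: "'x measure \<Rightarrow> ('x set \<Rightarrow> real^'d^'d) \<Rightarrow> 'x measure" where
  "variation N \<Lambda> = measure_of (space N) (sets N)
     (\<lambda>E. SUP A \<in> {A :: nat \<Rightarrow> 'x set. range A \<subseteq> sets N \<and> disjoint_family A \<and> (\<Union>n. A n) = E}.
        (\<Sum>n. ennreal (norm (\<Lambda> (A n)))))"

text \<open>The density \<open>d\<lambda>/d|\<lambda>|\<close>, unique up to \<open>|\<lambda>|\<close>-null sets, chosen with values in \<open>S_d\<close>.\<close>

definition polar_density :: "'x measure \<Rightarrow> ('x set \<Rightarrow> real^'d^'d) \<Rightarrow> 'x \<Rightarrow> real^'d^'d" where
  "polar_density N \<Lambda> = (SOME g.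
     g \<in> borel_measurable (variation N \<Lambda>) \<and>
     (\<forall>x. g x \<in> sym_mats) \<and>
     (\<forall>E\<in>sets N. set_integrable (variation N \<Lambda>) E g \<and>
        \<Lambda> E = (LINT x:E|variation N \<Lambda>. g x)))"

text \<open>\<open>\<integral> \<Phi> : d\<lambda>\<close> and \<open>\<integral> f(d\<lambda>/d|\<lambda>|) d|\<lambda>|\<close> for measures on \<open>\<real>\<^sup>d\<close>.\<close>

definition mat_integral ::
  "(real^'d \<Rightarrow> real^'d^'d) \<Rightarrow> ((real^'d) set \<Rightarrow> real^'d^'d) \<Rightarrow> real" where
  "mat_integral \<Phi> \<Lambda> = (\<integral>x. \<Phi> x \<bullet> polar_density borel \<Lambda> x \<partial>variation borel \<Lambda>)"

definition mat_cost ::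
  "(real^'d^'d \<Rightarrow> ennreal) \<Rightarrow> ((real^'d) set \<Rightarrow> real^'d^'d) \<Rightarrow> ennreal" where
  "mat_cost f \<Lambda> = (\<integral>\<^sup>+x. f (polar_density borel \<Lambda> x) \<partial>variation borel \<Lambda>)"


section \<open>Probability measures with finite second moment\<close>

definition P2 :: "(real^'d) measure set" where
  "P2 = {M. sets M = sets borel \<and> prob_space M \<and> integrable M (\<lambda>x. (norm x)\<^sup>2)}"

definition strip :: "(real \<times> (real^'d)) set" where
  "strip = {0<..<1} \<times> UNIV"

definition P2_strip :: "(real \<times> (real^'d)) measure set" where
  "P2_strip = {M. sets M = sets (restrict_space borel strip) \<and> prob_space M \<and>
     integrable M (\<lambda>(t, x). (norm x)\<^sup>2)}"


section \<open>Test functions\<close>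

text \<open>\<open>C2b \<phi> G H\<close>: \<open>\<phi>\<close> is in \<open>C_b\<^sup>2(\<real>\<^sup>d)\<close> with gradient \<open>G\<close> and Hessian \<open>H\<close>.\<close>

definition C2b ::
  "(real^'d \<Rightarrow> real) \<Rightarrow> (real^'d \<Rightarrow> real^'d) \<Rightarrow> (real^'d \<Rightarrow> real^'d^'d) \<Rightarrow> bool" where
  "C2b \<phi> G H \<longleftrightarrow>
     (\<forall>x. (\<phi> has_derivative (\<lambda>h. G x \<bullet> h)) (at x)) \<and>
     (\<forall>x. (G has_derivative (\<lambda>h. H x *v h)) (at x)) \<and>
     continuous_on UNIV H \<and> bounded (range H)"

text \<open>\<open>C12b_supp \<phi> D G H\<close>: \<open>\<phi>\<close> is in \<open>C_b\<^bsup>1,2\<^esup>\<close> of the strip, with \<open>D = \<partial>\<^sub>t\<phi>\<close>, spatial gradient \<open>G\<close>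
  and spatial Hessian \<open>H\<close>, and its support, closed in \<open>\<real> \<times> \<real>\<^sup>d\<close>, lies in the open strip.
  The support need not stay away from \<open>t = 0\<close> and \<open>t = 1\<close> uniformly in \<open>x\<close>.\<close>

definition C12b_supp ::
  "(real \<Rightarrow> real^'d \<Rightarrow> real) \<Rightarrow> (real \<Rightarrow> real^'d \<Rightarrow> real) \<Rightarrow>
   (real \<Rightarrow> real^'d \<Rightarrow> real^'d) \<Rightarrow> (real \<Rightarrow> real^'d \<Rightarrow> real^'d^'d) \<Rightarrow> bool" where
  "C12b_supp \<phi> D G H \<longleftrightarrow>
     (\<forall>t\<in>{0<..<1}. \<forall>x. ((\<lambda>s. \<phi> s x) has_real_derivative D t x) (at t)) \<and>
     (\<forall>t\<in>{0<..<1}. \<forall>x. (\<phi> t has_derivative (\<lambda>h. G t x \<bullet> h)) (at x)) \<and>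
     (\<forall>t\<in>{0<..<1}. \<forall>x. (G t has_derivative (\<lambda>h. H t x *v h)) (at x)) \<and>
     continuous_on strip (\<lambda>(t, x). D t x) \<and>
     continuous_on strip (\<lambda>(t, x). G t x) \<and>
     continuous_on strip (\<lambda>(t, x). H t x) \<and>
     bounded ((\<lambda>(t, x). D t x) ` strip) \<and>
     bounded ((\<lambda>(t, x). H t x) ` strip) \<and>
     closure {(t, x). (t, x) \<in> strip \<and> \<phi> t x \<noteq> 0} \<subseteq> strip"


section \<open>The Fokker--Planck equation and the two costs\<close>

text \<open>\<open>\<rho> = \<rho>\<^sub>t \<otimes> L\<^sup>1\<close> on \<open>(0,1)\<close>. That almost every \<open>\<rho>\<^sub>t\<close> has mass one for a solution of the equation
  is a consequence of testing with functions of \<open>t\<close> alone.\<close>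

definition time_disintegration ::
  "(real \<times> (real^'d)) measure \<Rightarrow> (real \<Rightarrow> (real^'d) measure) \<Rightarrow> bool" where
  "time_disintegration \<rho> \<rho>t \<longleftrightarrow>
     (\<forall>t\<in>{0<..<1}. sets (\<rho>t t) = sets borel \<and> finite_measure (\<rho>t t)) \<and>
     (\<forall>E\<in>sets borel. (\<lambda>t. emeasure (\<rho>t t) E) \<in> borel_measurable (restrict_space borel {0<..<1})) \<and>
     (\<forall>E\<in>sets (restrict_space borel strip).
        emeasure \<rho> E = (\<integral>\<^sup>+t\<in>{0<..<1}. emeasure (\<rho>t t) (Pair t -` E) \<partial>lborel))"

text \<open>\<open>\<lambda> = \<lambda>\<^sub>t \<otimes> L\<^sup>1\<close> on \<open>(0,1)\<close>; measurability of \<open>t \<mapsto> \<lambda>\<^sub>t\<close> is part of integrability.\<close>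

definition mat_time_disintegration ::
  "((real \<times> (real^'d)) set \<Rightarrow> real^'d^'d) \<Rightarrow> (real \<Rightarrow> (real^'d) set \<Rightarrow> real^'d^'d) \<Rightarrow> bool" where
  "mat_time_disintegration \<Lambda> \<Lambda>t \<longleftrightarrow>
     (\<forall>t\<in>{0<..<1}. mat_measure borel (\<Lambda>t t)) \<and>
     (\<forall>E\<in>sets (restrict_space borel strip).
        set_integrable lborel {0<..<1} (\<lambda>t. \<Lambda>t t (Pair t -` E)) \<and>
        \<Lambda> E = (LBINT t:{0<..<1}. \<Lambda>t t (Pair t -` E)))"

definition fokker_planck ::
  "(real \<times> (real^'d)) measure \<Rightarrow> ((real \<times> (real^'d)) set \<Rightarrow> real^'d^'d) \<Rightarrow>
   (real \<Rightarrow> (real^'d) measure) \<Rightarrow> (real \<Rightarrow> (real^'d) set \<Rightarrow> real^'d^'d) \<Rightarrow> bool" where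
  "fokker_planck \<rho> \<Lambda> \<rho>t \<Lambda>t \<longleftrightarrow>
     \<rho> \<in> P2_strip \<and> mat_measure (restrict_space borel strip) \<Lambda> \<and>
     time_disintegration \<rho> \<rho>t \<and> mat_time_disintegration \<Lambda> \<Lambda>t \<and>
     (\<integral>\<^sup>+t\<in>{0<..<1}. emeasure (variation borel (\<Lambda>t t)) UNIV \<partial>lborel) < \<infinity> \<and>
     (\<forall>\<phi> D G H. C12b_supp \<phi> D G H \<longrightarrow>
        (LBINT t:{0<..<1}. (\<integral>x. D t x \<partial>\<rho>t t)) =
        - (LBINT t:{0<..<1}. mat_integral (\<lambda>x. (1/2) *\<^sub>R H t x) (\<Lambda>t t)))"

text \<open>\<open>r\<close> is the narrowly continuous representative on \<open>[0,1]\<close> of the family \<open>\<rho>t\<close>.\<close>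

definition narrow_representative ::
  "(real \<Rightarrow> (real^'d) measure) \<Rightarrow> (real \<Rightarrow> (real^'d) measure) \<Rightarrow> bool" where
  "narrow_representative \<rho>t r \<longleftrightarrow>
     (\<forall>t\<in>{0..1}. r t \<in> P2) \<and>
     (\<forall>g :: real^'d \<Rightarrow> real. continuous_on UNIV g \<longrightarrow> bounded (range g) \<longrightarrow>
        continuous_on {0..1} (\<lambda>t. \<integral>x. g x \<partial>r t)) \<and>
     (AE t in lborel. t \<in> {0<..<1} \<longrightarrow> \<rho>t t = r t)"

definition dynamic_cost ::
  "(real^'d^'d \<Rightarrow> ennreal) \<Rightarrow> (real^'d) measure \<Rightarrow> (real^'d) measure \<Rightarrow> ennreal" where
  "dynamic_cost f \<mu> \<nu> = Inf {(\<integral>\<^sup>+t\<in>{0<..<1}. mat_cost f (\<Lambda>t t) \<partial>lborel) | \<rho> \<Lambda> \<rho>t \<Lambda>t r.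
     fokker_planck \<rho> \<Lambda> \<rho>t \<Lambda>t \<and> narrow_representative \<rho>t r \<and> r 0 = \<mu> \<and> r 1 = \<nu>}"

text \<open>\<open>tr(1/2 \<nabla>\<^sup>2\<lambda>) = \<nu> - \<mu>\<close>\<close>

definition static_equation ::
  "((real^'d) set \<Rightarrow> real^'d^'d) \<Rightarrow> (real^'d) measure \<Rightarrow> (real^'d) measure \<Rightarrow> bool" where
  "static_equation \<Lambda> \<mu> \<nu> \<longleftrightarrow>
     mat_measure borel \<Lambda> \<and> emeasure (variation borel \<Lambda>) UNIV < \<infinity> \<and>
     (\<forall>\<phi> G H. C2b \<phi> G H \<longrightarrow>
        mat_integral (\<lambda>x. (1/2) *\<^sub>R H x) \<Lambda> = (\<integral>x. \<phi> x \<partial>\<nu>) - (\<integral>x. \<phi> x \<partial>\<mu>))"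

end

theory Submission
  imports Defs
begin

text \<open>Averaging in time and standing still in time are the two directions of the equality.

  Let \<open>(\<rho>\<^sub>t, \<lambda>\<^sub>t)\<close> be a dynamic solution and \<open>\<lambda> = \<integral> \<lambda>\<^sub>t dt\<close>. Testing the Fokker--Planck equation with
  \<open>\<eta>(t) \<phi>(x)\<close>, where the time cutoff \<open>\<eta>\<close> tends to \<open>1\<close> and \<open>\<eta>'\<close> tends to the difference of the Dirac
  measures at \<open>0\<close> and \<open>1\<close>, shows that \<open>\<lambda>\<close> solves the static equation. This is admissible only for
  bounded \<open>\<phi>\<close>, because \<open>\<partial>\<^sub>t\<close> of the product must be bounded; a test function with quadratic growth is
  first made nonnegative by a multiple of \<open>1 + |x|\<^sup>2\<close> and then reached by the truncations
  \<open>\<phi> / (1 + \<epsilon> \<phi>)\<close>, whose Hessians are bounded uniformly in \<open>\<epsilon>\<close>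
  (\<open>time_average_static_equation\<close>). The cost does not increase under averaging: by convexity, lower
  semicontinuity and homogeneity \<open>f\<close> is the supremum of countably many linear functionals
  (\<open>sup_of_countably_many_functionals\<close>), and integrals of linear functionals commute with averaging
  (\<open>mat_cost_time_average_le\<close>, a Jensen inequality).

  Conversely, let \<open>\<lambda>\<close> solve the static equation. Then \<open>\<lambda>\<^sub>t = \<lambda>\<close> together with the linear interpolation
  \<open>\<rho>\<^sub>t = (1 - t) \<mu> + t \<nu>\<close> solves the Fokker--Planck equation at the same cost, since
  \<open>\<partial>\<^sub>t \<rho>\<^sub>t = \<nu> - \<mu>\<close> (\<open>constant_solution_fokker_planck\<close>).

  Both directions rest on the polar decomposition of a matrix measure
  (\<open>polar_decomposition\<close>): the entries have Radon--Nikodym densities with respect to the trace, and the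
  total variation is the norm of that matrix density times the trace. After that every statement
  about matrix measures becomes one about ordinary integrals. Where an integrable bound in \<open>t\<close> is
  needed, the trace \<open>t \<mapsto> trace (\<lambda>\<^sub>t \<real>\<^sup>d)\<close> is used, whose measurability is immediate.\<close>

section \<open>Entries of nonnegative definite matrices\<close>

text \<open>Testing with \<open>e\<^sub>i \<plusminus> e\<^sub>j\<close> bounds an off-diagonal entry by the mean of two diagonal ones.\<close>

lemma nonneg_mats_entry_le_trace:
  assumes "A \<in> nonneg_mats"
  shows "\<bar>A $ i $ j\<bar> \<le> trace A"
proof -
  have quad: "0 \<le> x \<bullet> (A *v x)" for x
    using assms by (simp add: nonneg_mats_def)
  have entry: "axis k 1 \<bullet> (A *v axis l 1) = A $ k $ l" for k l
    by (simp add: matrix_vector_mul_component inner_axis inner_axis' )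
  have diag: "0 \<le> A $ k $ k" for k
    using quad[of "axis k 1"] entry[of k k] by simp
  have diag_le: "A $ k $ k \<le> trace A" for k
    unfolding trace_def using diag by (intro member_le_sum) auto
  have sym: "A $ j $ i = A $ i $ j"
    using assms by (simp add: nonneg_mats_def sym_mats_def transpose_def vec_eq_iff)
  have "0 \<le> A $ i $ i + A $ j $ j + 2 * A $ i $ j"
    using quad[of "axis i 1 + axis j 1"] sym
    by (simp add: matrix_vector_right_distrib inner_add entry)
  moreover have "0 \<le> A $ i $ i + A $ j $ j - 2 * A $ i $ j"
    using quad[of "axis i 1 - axis j 1"] sym
    by (simp add: matrix_vector_mult_diff_distrib inner_diff entry)
  ultimately show ?thesis
    using diag_le[of i] diag_le[of j] by linarith
qed

lemma trace_nonneg: "A \<in> nonneg_mats \<Longrightarrow> 0 \<le> trace A"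
  by (meson abs_ge_zero nonneg_mats_entry_le_trace order_trans)

text \<open>The trace is additive over disjoint sets and the norm is not; this bound lets the trace replace the
  norm as a dominating measure.\<close>

lemma norm_nonneg_mats_le_trace:
  fixes A :: "real^'d^'d"
  assumes "A \<in> nonneg_mats"
  shows "norm A \<le> (real CARD('d))\<^sup>2 * trace A"
proof -
  have "norm A \<le> (\<Sum>i\<in>UNIV. norm (A $ i))"
    unfolding norm_vec_def by (rule L2_set_le_sum) simp
  also have "\<dots> \<le> (\<Sum>i::'d\<in>UNIV. \<Sum>j::'d\<in>UNIV. \<bar>A $ i $ j\<bar>)"
    by (intro sum_mono norm_le_l1_cart)
  also have "\<dots> \<le> (\<Sum>i::'d\<in>UNIV. \<Sum>j::'d\<in>UNIV. trace A)"
    by (intro sum_mono nonneg_mats_entry_le_trace assms)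
  finally show ?thesis
    by (simp add: power2_eq_square)
qed

lemma bounded_linear_trace: "bounded_linear (trace :: real^'d^'d \<Rightarrow> real)"
  by (intro linear_linear[THEN iffD2] linearI) (simp_all add: trace_def sum.distrib sum_distrib_left)

lemma subspace_sym_mats: "subspace (sym_mats :: (real^'d^'d) set)"
  by (auto simp: subspace_def sym_mats_def transpose_def vec_eq_iff)

lemma closed_sym_mats: "closed (sym_mats :: (real^'d^'d) set)"
  by (rule closed_subspace[OF subspace_sym_mats])


section \<open>Densities and variation of matrix measures\<close>

lemma finite_signed_density:
  fixes s :: "'x set \<Rightarrow> real"
  assumes "finite_measure M"
    and bound: "\<And>E. E \<in> sets M \<Longrightarrow> \<bar>s E\<bar> \<le> measure M E"
    and additive: "\<And>A. range A \<subseteq> sets M \<Longrightarrow> disjoint_family A \<Longrightarrow> (\<lambda>n. s (A n)) sums s (\<Union>n. A n)"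
  obtains h where "h \<in> borel_measurable M" "integrable M h"
    "\<And>E. E \<in> sets M \<Longrightarrow> s E = (LINT x:E|M. h x)"
proof -
  interpret finite_measure M by fact
  \<comment> \<open>Adding \<open>M\<close> turns \<open>s\<close> into a nonnegative measure to which Radon--Nikodym applies.\<close>
  define p where "p E = s E + measure M E" for E
  define N where "N = measure_of (space M) (sets M) (\<lambda>E. ennreal (p E))"
  have p_nonneg: "0 \<le> p E" if "E \<in> sets M" for E
    using bound[OF that] by (simp add: p_def)
  have N: "emeasure N E = ennreal (p E)" if "E \<in> sets M" for E
    unfolding N_def
  proof (rule emeasure_measure_of_sigma[OF _ _ _ that])
    show "sigma_algebra (space M) (sets M)" ..
    show "positive (sets M) (\<lambda>E. ennreal (p E))"
      using bound[of "{}"] by (auto simp: positive_def p_def)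
    show "countably_additive (sets M) (\<lambda>E. ennreal (p E))"
    proof (rule countably_additiveI)
      fix A :: "nat \<Rightarrow> 'x set"
      assume A: "range A \<subseteq> sets M" "disjoint_family A"
      have "(\<lambda>n. p (A n)) sums p (\<Union>n. A n)"
        unfolding p_def by (intro sums_add additive finite_measure_UNION A)
      moreover have "0 \<le> p (A n)" for n
        using A by (intro p_nonneg) auto
      ultimately show "(\<Sum>n. ennreal (p (A n))) = ennreal (p (\<Union>n. A n))"
        by (simp add: suminf_ennreal2 sums_iff)
    qed
  qed
  have sets_N [simp]: "sets N = sets M"
    by (simp add: N_def)
  then have space_N [simp]: "space N = space M"
    by (rule sets_eq_imp_space_eq)
  interpret N: finite_measure N
    by standard (simp add: N)
  have "absolutely_continuous M N"
  proof (unfold absolutely_continuous_def, rule subsetI)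
    fix E assume "E \<in> null_sets M"
    then show "E \<in> null_sets N"
      using bound[of E] by (auto simp: null_sets_def N p_def measure_def)
  qed
  then obtain D where D: "D \<in> borel_measurable M" "AE x in M. RN_deriv M N x = ennreal (D x)"
      "\<And>x. 0 \<le> D x"
    using real_RN_deriv[of N] sets_N N.finite_measure_axioms by metis
  have ND: "emeasure N E = (\<integral>\<^sup>+x\<in>E. ennreal (D x) \<partial>M)" if "E \<in> sets M" for E
  proof -
    have "emeasure N E = emeasure (density M (RN_deriv M N)) E"
      by (simp add: density_RN_deriv \<open>absolutely_continuous M N\<close>)
    also have "\<dots> = (\<integral>\<^sup>+x\<in>E. RN_deriv M N x \<partial>M)"
      using that by (simp add: emeasure_density)
    also have "\<dots> = (\<integral>\<^sup>+x\<in>E. ennreal (D x) \<partial>M)"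
      using D(2) by (intro nn_integral_cong_AE) auto
    finally show ?thesis .
  qed
  have "(\<integral>\<^sup>+x. ennreal (D x) \<partial>M) = emeasure N (space M)"
    using ND[of "space M"] by (simp cong: nn_integral_cong)
  then have int_D: "integrable M D"
    using D N.emeasure_finite[of "space N"] by (intro integrableI_nonneg) (auto simp: less_top[symmetric])
  show ?thesis
  proof
    show "(\<lambda>x. D x - 1) \<in> borel_measurable M" "integrable M (\<lambda>x. D x - 1)"
      using D int_D by auto
    fix E assume E: "E \<in> sets M"
    have int: "set_integrable M E D" "set_integrable M E (\<lambda>x. 1::real)"
      using integrable_mult_indicator[OF E int_D] E
      by (auto simp: set_integrable_def less_top[symmetric] intro!: integrable_real_indicator)
    have "ennreal (LINT x:E|M. D x) = (\<integral>\<^sup>+x\<in>E. ennreal (D x) \<partial>M)"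
      using int(1) D(3)
      by (subst nn_integral_eq_integral[symmetric, where M=M and f="\<lambda>x. indicator E x *\<^sub>R D x",
            folded set_lebesgue_integral_def])
        (auto simp: set_integrable_def indicator_def set_lebesgue_integral_def intro!: nn_integral_cong)
    also have "\<dots> = ennreal (p E)"
      using ND[OF E] N[OF E] by simp
    finally have "(LINT x:E|M. D x) = p E"
      using p_nonneg[OF E] D(3)
      by (subst (asm) ennreal_inj) (auto simp: set_lebesgue_integral_def intro!: integral_nonneg_AE)
    then show "s E = (LINT x:E|M. D x - 1)"
      using int E by (simp add: p_def set_lebesgue_integral_def[of M E "\<lambda>x. 1"])
  qed
qed


lemma bounded_linear_entry: "bounded_linear (\<lambda>A :: real^'d^'d. A $ i $ j)"
  by (intro linear_linear[THEN iffD2] linearI) auto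

text \<open>The entries are dominated by the trace measure. Symmetrizing their densities leaves the integrals
  unchanged, as each \<open>\<Lambda> E\<close> is symmetric, and makes the density symmetric at every point instead of
  almost every point.\<close>

lemma mat_measure_density:
  fixes \<Lambda> :: "'x set \<Rightarrow> real^'d^'d"
  assumes "mat_measure N \<Lambda>"
  obtains M g where "sets M = sets N" "finite_measure M" "integrable M g" "\<And>x. g x \<in> sym_mats"
    "\<And>E. E \<in> sets N \<Longrightarrow> \<Lambda> E = (LINT x:E|M. g x)"
proof -
  have nonneg: "\<Lambda> E \<in> nonneg_mats" if "E \<in> sets N" for E
    using assms that by (simp add: mat_measure_def)
  have additive: "(\<lambda>n. \<Lambda> (A n)) sums \<Lambda> (\<Union>n. A n)"
    if "range A \<subseteq> sets N" "disjoint_family A" for A :: "nat \<Rightarrow> 'x set"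
    using assms that by (simp add: mat_measure_def)
  define M where "M = measure_of (space N) (sets N) (\<lambda>E. ennreal (trace (\<Lambda> E)))"
  have M: "emeasure M E = ennreal (trace (\<Lambda> E))" if "E \<in> sets N" for E
    unfolding M_def
  proof (rule emeasure_measure_of_sigma[OF _ _ _ that])
    show "sigma_algebra (space N) (sets N)" ..
    have "(\<lambda>n::nat. \<Lambda> {}) sums \<Lambda> {}"
      using additive[of "\<lambda>_. {}"] by (simp add: disjoint_family_on_def)
    then have "\<Lambda> {} = 0"
      by (simp add: sums_iff summable_const_iff)
    then show "positive (sets N) (\<lambda>E. ennreal (trace (\<Lambda> E)))"
      by (simp add: positive_def trace_def)
    show "countably_additive (sets N) (\<lambda>E. ennreal (trace (\<Lambda> E)))"
    proof (rule countably_additiveI)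
      fix A :: "nat \<Rightarrow> 'x set"
      assume A: "range A \<subseteq> sets N" "disjoint_family A"
      then have "0 \<le> trace (\<Lambda> (A n))" for n
        by (intro trace_nonneg nonneg) auto
      moreover have "(\<lambda>n. trace (\<Lambda> (A n))) sums trace (\<Lambda> (\<Union>n. A n))"
        by (rule bounded_linear.sums[OF bounded_linear_trace additive[OF A]])
      ultimately show "(\<Sum>n. ennreal (trace (\<Lambda> (A n)))) = ennreal (trace (\<Lambda> (\<Union>n. A n)))"
        by (simp add: suminf_ennreal2 sums_iff)
    qed
  qed
  have sets_M [simp]: "sets M = sets N"
    by (simp add: M_def)
  then have space_M [simp]: "space M = space N"
    by (rule sets_eq_imp_space_eq)
  have fin: "finite_measure M"
    by standard (simp add: M)
  have "\<exists>h. integrable M h \<and> (\<forall>E\<in>sets M. \<Lambda> E $ i $ j = (LINT x:E|M. h x))" for i j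
  proof (rule finite_signed_density[OF fin])
    fix E assume "E \<in> sets M"
    then show "\<bar>\<Lambda> E $ i $ j\<bar> \<le> measure M E"
      using nonneg_mats_entry_le_trace[OF nonneg] trace_nonneg[OF nonneg] by (simp add: measure_def M)
  next
    fix A :: "nat \<Rightarrow> 'x set"
    assume "range A \<subseteq> sets M" "disjoint_family A"
    then show "(\<lambda>n. \<Lambda> (A n) $ i $ j) sums \<Lambda> (\<Union>n. A n) $ i $ j"
      by (intro bounded_linear.sums[OF bounded_linear_entry additive]) auto
  qed metis
  then obtain h where h: "\<And>i j. integrable M (h i j)"
      "\<And>i j E. E \<in> sets M \<Longrightarrow> \<Lambda> E $ i $ j = (LINT x:E|M. h i j x)"
    by metis
  define g where "g x = (\<Sum>i\<in>UNIV. \<Sum>j\<in>UNIV. ((h i j x + h j i x) / 2) *\<^sub>R axis i (axis j (1::real)))" for x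
  have g_entry: "g x $ k $ l = (h k l x + h l k x) / 2" for x k l
  proof -
    have "(\<Sum>j\<in>UNIV. if k = i then F j else 0) = (if k = i then \<Sum>j\<in>UNIV. F j else 0)"
      for i and F :: "'d \<Rightarrow> real"
      by simp
    then show ?thesis
      by (simp add: g_def axis_def if_distrib[of "\<lambda>z. _ * z"] if_distrib[of "\<lambda>z. z $ _"] cong: if_cong)
  qed
  have int_g: "integrable M g"
    unfolding g_def using h(1) by (intro Bochner_Integration.integrable_sum integrable_scaleR_left) auto
  show ?thesis
  proof
    show "sets M = sets N" "finite_measure M" "integrable M g" by fact+
    show "g x \<in> sym_mats" for x
      by (simp add: sym_mats_def transpose_def vec_eq_iff g_entry add.commute)
    fix E assume E: "E \<in> sets N"
    have int: "integrable M (\<lambda>x. indicator E x *\<^sub>R h i j x)" for i j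
      using h(1) E by (intro integrable_mult_indicator) auto
    have "(LINT x:E|M. g x) $ i $ j = \<Lambda> E $ i $ j" for i j
    proof -
      have "(LINT x:E|M. g x) $ i $ j = (LINT x|M. (indicator E x *\<^sub>R g x) $ i $ j)"
        unfolding set_lebesgue_integral_def using int_g E
        by (intro integral_bounded_linear[OF bounded_linear_entry, symmetric] integrable_mult_indicator) auto
      also have "\<dots> = (LINT x|M. (indicator E x *\<^sub>R h i j x + indicator E x *\<^sub>R h j i x) / 2)"
        by (intro Bochner_Integration.integral_cong) (auto simp: g_entry field_simps)
      also have "\<dots> = ((LINT x:E|M. h i j x) + (LINT x:E|M. h j i x)) / 2"
        using int by (simp add: set_lebesgue_integral_def)
      also have "\<dots> = (\<Lambda> E $ i $ j + \<Lambda> E $ j $ i) / 2"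
        using h(2) E by simp
      also have "\<Lambda> E $ j $ i = \<Lambda> E $ i $ j"
        using nonneg[OF E] by (simp add: nonneg_mats_def sym_mats_def transpose_def vec_eq_iff)
      finally show ?thesis by simp
    qed
    then show "\<Lambda> E = (LINT x:E|M. g x)"
      by (simp add: vec_eq_iff)
  qed
qed

lemma SUP_partition_norm_integral:
  fixes g :: "'x \<Rightarrow> real^'d^'d"
  assumes "finite_measure M" and int: "integrable M g" and E: "E \<in> sets M"
    and \<Lambda>: "\<And>E. E \<in> sets M \<Longrightarrow> \<Lambda> E = (LINT x:E|M. g x)"
  shows "(SUP A \<in> {A :: nat \<Rightarrow> 'x set. range A \<subseteq> sets M \<and> disjoint_family A \<and> (\<Union>n. A n) = E}.
      (\<Sum>n. ennreal (norm (\<Lambda> (A n))))) = (\<integral>\<^sup>+x\<in>E. ennreal (norm (g x)) \<partial>M)"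
    (is "(SUP A \<in> ?P. ?S A) = _")
proof (rule antisym)
  interpret finite_measure M by fact
  have g [measurable]: "g \<in> borel_measurable M"
    using int by simp
  define V where "V = density M (\<lambda>x. ennreal (norm (g x)))"
  have V: "emeasure V A = (\<integral>\<^sup>+x\<in>A. ennreal (norm (g x)) \<partial>M)" if "A \<in> sets M" for A
    using that by (simp add: V_def emeasure_density)
  have sets_V [simp]: "sets V = sets M"
    by (simp add: V_def)
  have set_int: "set_integrable M A g" if "A \<in> sets M" for A
    using int that by (simp add: set_integrable_def integrable_mult_indicator)
  show "(SUP A \<in> ?P. ?S A) \<le> (\<integral>\<^sup>+x\<in>E. ennreal (norm (g x)) \<partial>M)"
  proof (rule SUP_least)
    fix A assume A: "A \<in> ?P"
    have "ennreal (norm (\<Lambda> (A n))) \<le> emeasure V (A n)" for n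
    proof -
      have An: "A n \<in> sets M" using A by auto
      have "norm (\<Lambda> (A n)) \<le> (LINT x|M. norm (indicator (A n) x *\<^sub>R g x))"
        unfolding \<Lambda>[OF An] set_lebesgue_integral_def by (rule integral_norm_bound)
      then have "ennreal (norm (\<Lambda> (A n))) \<le> ennreal (LINT x|M. norm (indicator (A n) x *\<^sub>R g x))"
        by (rule ennreal_leI)
      also have "\<dots> = (\<integral>\<^sup>+x. ennreal (norm (indicator (A n) x *\<^sub>R g x)) \<partial>M)"
        using integrable_norm[OF set_int[OF An, unfolded set_integrable_def]]
        by (intro nn_integral_eq_integral[symmetric]) auto
      also have "\<dots> = emeasure V (A n)"
        unfolding V[OF An] by (intro nn_integral_cong) (auto simp: indicator_def)
      finally show ?thesis .
    qed
    then have "?S A \<le> (\<Sum>n. emeasure V (A n))"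
      by (intro suminf_le) auto
    also have "\<dots> = emeasure V E"
      using A by (subst suminf_emeasure) auto
    finally show "?S A \<le> (\<integral>\<^sup>+x\<in>E. ennreal (norm (g x)) \<partial>M)"
      using V[OF E] by simp
  qed
  show "(\<integral>\<^sup>+x\<in>E. ennreal (norm (g x)) \<partial>M) \<le> (SUP A \<in> ?P. ?S A)"
  proof (rule ennreal_le_epsilon)
    fix e :: real assume e: "0 < e"
    \<comment> \<open>The constant \<open>c k\<close> replaces \<open>g\<close> twice, at the price of \<open>\<delta>\<close> per unit of mass each time.\<close>
    define \<delta> where "\<delta> = e / (2 * (measure M E + 1))"
    have \<delta>: "0 < \<delta>" and \<delta>_le: "2 * \<delta> * measure M E \<le> e"
    proof -
      have pos: "0 < 2 * (measure M E + 1)"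
        by (intro mult_pos_pos add_nonneg_pos) auto
      then show "0 < \<delta>"
        using e by (simp add: \<delta>_def)
      have "2 * \<delta> * measure M E = e * (measure M E / (measure M E + 1))"
        using pos by (simp add: \<delta>_def field_simps)
      also have "\<dots> \<le> e * 1"
        using e pos by (intro mult_left_mono) (auto simp: field_simps)
      finally show "2 * \<delta> * measure M E \<le> e" by simp
    qed
    obtain D :: "(real^'d^'d) set" where D: "countable D" "\<And>X. open X \<Longrightarrow> X \<noteq> {} \<Longrightarrow> \<exists>d\<in>D. d \<in> X"
      using countable_dense_setE by blast
    have "D \<noteq> {}" using D(2)[of UNIV] by auto
    define c where "c = from_nat_into D"
    \<comment> \<open>On the pieces of this partition \<open>g\<close> is within \<open>\<delta>\<close> of the constant \<open>c k\<close>, so that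
      almost nothing cancels in the integral of \<open>g\<close>.\<close>
    define B where "B k = {x \<in> space M. dist (c k) (g x) < \<delta>} \<inter> E" for k
    have B_sets: "B k \<in> sets M" for k
      unfolding B_def using E by measurable
    define A where "A = disjointed B"
    have A_sets: "A k \<in> sets M" for k
      using sets.range_disjointed_sets[of B M] B_sets by (auto simp: A_def)
    have "x \<in> (\<Union>k. B k)" if "x \<in> E" for x
    proof -
      obtain d where "d \<in> D" "d \<in> ball (g x) \<delta>"
        using D(2)[of "ball (g x) \<delta>"] \<delta> by auto
      moreover obtain k where "c k = d"
        using \<open>d \<in> D\<close> D(1) by (metis c_def from_nat_into_surj)
      ultimately show ?thesis
        using that sets.sets_into_space[OF E] by (auto simp: B_def dist_commute)
    qed
    then have "(\<Union>k. B k) = E"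
      by (auto simp: B_def)
    then have A: "A \<in> ?P"
      using A_sets by (auto simp: A_def UN_disjointed_eq disjoint_family_disjointed)
    have close: "norm (g x - c k) \<le> \<delta>" if "x \<in> A k" for x k
      using that disjointed_subset[of B k] by (auto simp: A_def B_def dist_norm norm_minus_commute)
    have piece: "emeasure V (A k) \<le> ennreal (norm (\<Lambda> (A k))) + ennreal (2 * \<delta>) * emeasure M (A k)" for k
    proof -
      have "integrable M (\<lambda>x. indicator (A k) x *\<^sub>R c k)"
        using A_sets by (intro integrable_mult_indicator) auto
      moreover have "(LINT x|M. indicat_real (A k) x *\<^sub>R c k) = measure M (A k) *\<^sub>R c k"
        using A_sets
        by (subst integral_scaleR_left) (auto simp: less_top[symmetric] intro!: integrable_real_indicator)
      ultimately have "\<Lambda> (A k) - measure M (A k) *\<^sub>R c k = (LINT x|M. indicator (A k) x *\<^sub>R (g x - c k))"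
        using set_int[OF A_sets] A_sets unfolding set_integrable_def
        by (simp add: \<Lambda> set_lebesgue_integral_def algebra_simps)
      also have "norm \<dots> \<le> (LINT x|M. norm (indicator (A k) x *\<^sub>R (g x - c k)))"
        by (rule integral_norm_bound)
      also have "\<dots> \<le> (LINT x|M. indicator (A k) x *\<^sub>R \<delta>)"
        using A_sets close int \<delta>
        by (intro integral_mono integrable_norm integrable_mult_indicator) (auto simp: indicator_def)
      finally have 1: "norm (measure M (A k) *\<^sub>R c k) \<le> norm (\<Lambda> (A k)) + measure M (A k) * \<delta>"
        using A_sets norm_triangle_ineq4[of "\<Lambda> (A k)" "\<Lambda> (A k) - measure M (A k) *\<^sub>R c k"] by simp
      have "emeasure V (A k) \<le> (\<integral>\<^sup>+x. ennreal (norm (c k) + \<delta>) * indicator (A k) x \<partial>M)"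
        unfolding V[OF A_sets]
      proof (intro nn_integral_mono)
        fix x
        show "ennreal (norm (g x)) * indicator (A k) x \<le> ennreal (norm (c k) + \<delta>) * indicator (A k) x"
          using close[of x k] norm_triangle_ineq[of "g x - c k" "c k"]
          by (auto simp: indicator_def intro!: ennreal_leI)
      qed
      also have "\<dots> = ennreal ((norm (c k) + \<delta>) * measure M (A k))"
        using A_sets \<delta> by (simp add: nn_integral_cmult_indicator emeasure_eq_measure ennreal_mult)
      also have "\<dots> \<le> ennreal (norm (\<Lambda> (A k)) + 2 * \<delta> * measure M (A k))"
        using 1 by (intro ennreal_leI) (simp add: algebra_simps)
      also have "\<dots> = ennreal (norm (\<Lambda> (A k))) + ennreal (2 * \<delta>) * emeasure M (A k)"
        using \<delta> by (simp add: emeasure_eq_measure ennreal_mult)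
      finally show ?thesis .
    qed
    have "emeasure V E = (\<Sum>k. emeasure V (A k))"
      using A by (subst suminf_emeasure) auto
    also have "\<dots> \<le> (\<Sum>k. ennreal (norm (\<Lambda> (A k))) + ennreal (2 * \<delta>) * emeasure M (A k))"
      using piece by (intro suminf_le) auto
    also have "\<dots> = ?S A + ennreal (2 * \<delta>) * (\<Sum>k. emeasure M (A k))"
      by (simp add: suminf_add[symmetric])
    finally have 2: "emeasure V E \<le> ?S A + ennreal (2 * \<delta>) * (\<Sum>k. emeasure M (A k))" .
    have "(\<Sum>k. emeasure M (A k)) = ennreal (measure M E)"
      using A by (subst suminf_emeasure) (auto simp: emeasure_eq_measure)
    then have "ennreal (2 * \<delta>) * (\<Sum>k. emeasure M (A k)) = ennreal (2 * \<delta> * measure M E)"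
      using \<delta> by (simp add: ennreal_mult)
    also have "\<dots> \<le> ennreal e"
      by (rule ennreal_leI[OF \<delta>_le])
    finally have 3: "ennreal (2 * \<delta>) * (\<Sum>k. emeasure M (A k)) \<le> ennreal e" .
    have "?S A \<le> (SUP A \<in> ?P. ?S A)"
      using A by (rule SUP_upper)
    then show "(\<integral>\<^sup>+x\<in>E. ennreal (norm (g x)) \<partial>M) \<le> (SUP A \<in> ?P. ?S A) + ennreal e"
      unfolding V[OF E, symmetric] by (rule order_trans[OF 2 add_mono[OF _ 3]])
  qed
qed

lemma variation_eq_density:
  fixes g :: "'x \<Rightarrow> real^'d^'d"
  assumes "finite_measure M" "sets M = sets N" "integrable M g"
    and \<Lambda>: "\<And>E. E \<in> sets N \<Longrightarrow> \<Lambda> E = (LINT x:E|M. g x)"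
  shows "variation N \<Lambda> = density M (\<lambda>x. ennreal (norm (g x)))" (is "_ = ?V")
proof -
  have space: "space N = space M"
    using assms(2) by (metis sets_eq_imp_space_eq)
  have "variation N \<Lambda> = measure_of (space M) (sets M) (emeasure ?V)"
    unfolding variation_def space assms(2)[symmetric]
  proof (intro measure_of_eq sets.space_closed)
    fix E assume "E \<in> sigma_sets (space M) (sets M)"
    then have E: "E \<in> sets M"
      by (simp add: sets.sigma_sets_eq)
    then show "(SUP A \<in> {A :: nat \<Rightarrow> 'x set. range A \<subseteq> sets M \<and> disjoint_family A \<and> (\<Union>n. A n) = E}.
        \<Sum>n. ennreal (norm (\<Lambda> (A n)))) = emeasure ?V E"
      using assms by (subst SUP_partition_norm_integral[where g=g]) (auto simp: emeasure_density)
  qed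
  also have "\<dots> = ?V"
    using measure_of_of_measure[of ?V] by simp
  finally show ?thesis .
qed

text \<open>If \<open>\<Lambda> = g M\<close>, then \<open>g / |g|\<close>, read as \<open>0\<close> where \<open>g\<close> vanishes, meets the conditions in the choice of
  \<open>polar_density\<close>; hence the chosen function meets them too.\<close>

proposition polar_decomposition:
  fixes \<Lambda> :: "'x set \<Rightarrow> real^'d^'d"
  assumes "mat_measure N \<Lambda>"
  shows sets_variation: "sets (variation N \<Lambda>) = sets N"
    and finite_variation: "finite_measure (variation N \<Lambda>)"
    and integrable_polar_density: "integrable (variation N \<Lambda>) (polar_density N \<Lambda>)"
    and polar_density_sym: "\<And>x. polar_density N \<Lambda> x \<in> sym_mats"
    and polar_density_eq: "\<And>E. E \<in> sets N \<Longrightarrow>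
      \<Lambda> E = (LINT x:E|variation N \<Lambda>. polar_density N \<Lambda> x)"
proof -
  obtain M g where M: "sets M = sets N" "finite_measure M" "integrable M g" "\<And>x. g x \<in> sym_mats"
    "\<And>E. E \<in> sets N \<Longrightarrow> \<Lambda> E = (LINT x:E|M. g x)"
    using mat_measure_density[OF assms] by blast
  define V where "V = density M (\<lambda>x. ennreal (norm (g x)))"
  have V: "variation N \<Lambda> = V"
    unfolding V_def by (rule variation_eq_density) fact+
  show sets_V: "sets (variation N \<Lambda>) = sets N"
    by (simp add: V V_def M)
  have g [measurable]: "g \<in> borel_measurable M"
    using M(3) by simp
  have "(\<integral>\<^sup>+x. ennreal (norm (g x)) \<partial>M) < \<infinity>"
    using M(3) by (simp add: integrable_iff_bounded)
  then show fin: "finite_measure (variation N \<Lambda>)"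
    unfolding V V_def by (intro finite_measureI) (simp add: emeasure_density less_top cong: nn_integral_cong)
  define u where "u x = (1 / norm (g x)) *\<^sub>R g x" for x
  have u [measurable]: "u \<in> borel_measurable M"
    unfolding u_def by measurable
  have u': "u \<in> borel_measurable V"
    by (simp add: V_def)
  have norm_u: "norm (g x) *\<^sub>R u x = g x" for x
    by (simp add: u_def)
  have sym_u: "u x \<in> sym_mats" for x
    unfolding u_def by (intro subspace_scale[OF subspace_sym_mats] M)
  have "set_integrable V E u \<and> \<Lambda> E = (LINT x:E|V. u x)" if E: "E \<in> sets N" for E
  proof -
    have "E \<in> sets M" using E M by simp
    have *: "norm (g x) *\<^sub>R (indicator E x *\<^sub>R u x) = indicator E x *\<^sub>R g x" for x
      by (metis norm_u scaleR_left_commute)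
    have int: "integrable M (\<lambda>x. norm (g x) *\<^sub>R (indicator E x *\<^sub>R u x))"
      unfolding * using M(3) \<open>E \<in> sets M\<close> by (intro integrable_mult_indicator) auto
    have "integrable V (\<lambda>x. indicator E x *\<^sub>R u x)"
      unfolding V_def using int \<open>E \<in> sets M\<close> by (subst integrable_density) auto
    moreover have "(LINT x|V. indicator E x *\<^sub>R u x) = (LINT x|M. indicator E x *\<^sub>R g x)"
      unfolding V_def using \<open>E \<in> sets M\<close> by (subst integral_density) (auto simp del: scaleR_scaleR simp: *)
    ultimately show ?thesis
      using M(5)[OF E] by (simp add: set_integrable_def set_lebesgue_integral_def)
  qed
  then have "\<exists>g. g \<in> borel_measurable (variation N \<Lambda>) \<and> (\<forall>x. g x \<in> sym_mats) \<and>
     (\<forall>E\<in>sets N. set_integrable (variation N \<Lambda>) E g \<and> \<Lambda> E = (LINT x:E|variation N \<Lambda>. g x))"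
    using u' sym_u V by auto
  from someI_ex[OF this, folded polar_density_def]
  have polar: "polar_density N \<Lambda> \<in> borel_measurable (variation N \<Lambda>)"
    "\<And>x. polar_density N \<Lambda> x \<in> sym_mats"
    "\<And>E. E \<in> sets N \<Longrightarrow> set_integrable (variation N \<Lambda>) E (polar_density N \<Lambda>)"
    "\<And>E. E \<in> sets N \<Longrightarrow> \<Lambda> E = (LINT x:E|variation N \<Lambda>. polar_density N \<Lambda> x)"
    by auto
  show "polar_density N \<Lambda> x \<in> sym_mats" for x by (rule polar)
  show "\<Lambda> E = (LINT x:E|variation N \<Lambda>. polar_density N \<Lambda> x)" if "E \<in> sets N" for E
    using that by (rule polar)
  have "set_integrable (variation N \<Lambda>) (space (variation N \<Lambda>)) (polar_density N \<Lambda>)"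
    using sets_V by (intro polar(3)) (metis sets.top sets_eq_imp_space_eq)
  then show "integrable (variation N \<Lambda>) (polar_density N \<Lambda>)"
    by (simp add: set_integrable_def cong: Bochner_Integration.integrable_cong)
qed

section \<open>Integrals against matrix measures\<close>

lemma integrable_inner_polar_density:
  fixes \<Phi> :: "real^'d \<Rightarrow> real^'d^'d"
  assumes "mat_measure borel \<Lambda>" "\<Phi> \<in> borel_measurable borel" "\<And>x. norm (\<Phi> x) \<le> C"
  shows "integrable (variation borel \<Lambda>) (\<lambda>x. \<Phi> x \<bullet> polar_density borel \<Lambda> x)"
proof (rule Bochner_Integration.integrable_bound)
  show "integrable (variation borel \<Lambda>) (\<lambda>x. C * norm (polar_density borel \<Lambda> x))"
    using integrable_polar_density[OF assms(1)] by auto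
  have "\<Phi> \<in> borel_measurable (variation borel \<Lambda>)"
    using assms(2) measurable_cong_sets[OF sets_variation[OF assms(1)] refl] by blast
  then show "(\<lambda>x. \<Phi> x \<bullet> polar_density borel \<Lambda> x) \<in> borel_measurable (variation borel \<Lambda>)"
    using integrable_polar_density[OF assms(1)] by (intro borel_measurable_inner) auto
  show "AE x in variation borel \<Lambda>. norm (\<Phi> x \<bullet> polar_density borel \<Lambda> x)
      \<le> norm (C * norm (polar_density borel \<Lambda> x))"
  proof (rule AE_I2)
    fix x
    have "norm (\<Phi> x \<bullet> polar_density borel \<Lambda> x) \<le> norm (\<Phi> x) * norm (polar_density borel \<Lambda> x)"
      using Cauchy_Schwarz_ineq2 by auto
    also have "\<dots> \<le> C * norm (polar_density borel \<Lambda> x)"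
      by (intro mult_right_mono assms) auto
    finally show "norm (\<Phi> x \<bullet> polar_density borel \<Lambda> x) \<le> norm (C * norm (polar_density borel \<Lambda> x))"
      by simp
  qed
qed

lemma set_integrable_polar_density:
  assumes "mat_measure N \<Lambda>" "E \<in> sets N"
  shows "integrable (variation N \<Lambda>) (\<lambda>x. indicator E x *\<^sub>R polar_density N \<Lambda> x)"
  using assms sets_variation[OF assms(1)]
  by (intro integrable_mult_indicator integrable_polar_density) auto

lemma mat_measure_simple_partition:
  fixes s :: "real^'d \<Rightarrow> 'b"
  assumes "mat_measure borel \<Lambda>" "simple_function borel s"
  shows "(\<Sum>y\<in>range s. \<Lambda> (s -` {y})) = \<Lambda> UNIV"
proof -
  have fin: "finite (range s)" and level: "s -` {y} \<in> sets borel" for y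
    using assms(2) simple_functionD[OF assms(2)] by auto
  have "(\<Sum>y\<in>range s. \<Lambda> (s -` {y}))
      = (\<Sum>y\<in>range s. LINT x|variation borel \<Lambda>. indicator (s -` {y}) x *\<^sub>R polar_density borel \<Lambda> x)"
    by (intro sum.cong refl) (simp add: polar_density_eq[OF assms(1) level] set_lebesgue_integral_def)
  also have "\<dots> = (LINT x|variation borel \<Lambda>.
      (\<Sum>y\<in>range s. indicator (s -` {y}) x *\<^sub>R polar_density borel \<Lambda> x))"
    by (intro Bochner_Integration.integral_sum[symmetric] set_integrable_polar_density assms level)
  also have "\<dots> = (LINT x|variation borel \<Lambda>. indicator UNIV x *\<^sub>R polar_density borel \<Lambda> x)"
    using fin by (intro Bochner_Integration.integral_cong refl)
      (simp add: scaleR_sum_left[symmetric] indicator_def)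
  also have "\<dots> = \<Lambda> UNIV"
    by (simp add: polar_density_eq[OF assms(1)] set_lebesgue_integral_def)
  finally show ?thesis .
qed

lemma mat_integral_simple:
  fixes s :: "real^'d \<Rightarrow> real^'d^'d"
  assumes "mat_measure borel \<Lambda>" "simple_function borel s"
  shows "mat_integral s \<Lambda> = (\<Sum>y\<in>range s. y \<bullet> \<Lambda> (s -` {y}))"
proof -
  let ?V = "variation borel \<Lambda>" and ?g = "polar_density borel \<Lambda>"
  have fin: "finite (range s)" and level: "s -` {y} \<in> sets borel" for y
    using assms(2) simple_functionD[OF assms(2)] by auto
  have "s x \<bullet> ?g x = (\<Sum>y\<in>range s. y \<bullet> (indicator (s -` {y}) x *\<^sub>R ?g x))" for x
  proof -
    have "(\<Sum>y\<in>range s. y \<bullet> (indicator (s -` {y}) x *\<^sub>R ?g x)) = (\<Sum>y\<in>range s. if y = s x then s x \<bullet> ?g x else 0)"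
      by (intro sum.cong) (auto simp: indicator_def)
    then show ?thesis using fin by simp
  qed
  then have "mat_integral s \<Lambda> = (LINT x|?V. (\<Sum>y\<in>range s. y \<bullet> (indicator (s -` {y}) x *\<^sub>R ?g x)))"
    by (simp add: mat_integral_def)
  also have "\<dots> = (\<Sum>y\<in>range s. LINT x|?V. y \<bullet> (indicator (s -` {y}) x *\<^sub>R ?g x))"
    by (intro Bochner_Integration.integral_sum integrable_inner_right set_integrable_polar_density assms level)
  also have "\<dots> = (\<Sum>y\<in>range s. y \<bullet> \<Lambda> (s -` {y}))"
    using set_integrable_polar_density[OF assms(1) level]
    by (intro sum.cong refl)
      (simp del: inner_scaleR_right add: polar_density_eq[OF assms(1) level] set_lebesgue_integral_def)
  finally show ?thesis .
qed

lemma mat_integral_dominated_convergence: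
  fixes \<Phi> :: "real^'d \<Rightarrow> real^'d^'d"
  assumes "mat_measure borel \<Lambda>" "\<And>i. s i \<in> borel_measurable borel" "\<Phi> \<in> borel_measurable borel"
    and "\<And>x. (\<lambda>i. s i x) \<longlonglongrightarrow> \<Phi> x" and "\<And>i x. norm (s i x) \<le> C"
  shows "(\<lambda>i. mat_integral (s i) \<Lambda>) \<longlonglongrightarrow> mat_integral \<Phi> \<Lambda>"
  unfolding mat_integral_def
proof (rule integral_dominated_convergence)
  let ?V = "variation borel \<Lambda>" and ?g = "polar_density borel \<Lambda>"
  note cong = measurable_cong_sets[OF sets_variation[OF assms(1)] refl]
  have g: "?g \<in> borel_measurable ?V"
    using integrable_polar_density[OF assms(1)] by auto
  have \<Phi>: "\<Phi> \<in> borel_measurable ?V" and s: "s i \<in> borel_measurable ?V" for i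
    using assms(2,3) cong by blast+
  show "(\<lambda>x. \<Phi> x \<bullet> ?g x) \<in> borel_measurable ?V" "(\<lambda>x. s i x \<bullet> ?g x) \<in> borel_measurable ?V" for i
    using g \<Phi> s by (auto intro!: borel_measurable_inner)
  show "integrable ?V (\<lambda>x. C * norm (?g x))"
    using integrable_polar_density[OF assms(1)] by auto
  show "AE x in ?V. (\<lambda>i. s i x \<bullet> ?g x) \<longlonglongrightarrow> \<Phi> x \<bullet> ?g x"
    using assms(4) by (auto intro!: tendsto_intros)
  show "AE x in ?V. norm (s i x \<bullet> ?g x) \<le> C * norm (?g x)" for i
  proof (rule AE_I2)
    fix x
    have "norm (s i x \<bullet> ?g x) \<le> norm (s i x) * norm (?g x)"
      using Cauchy_Schwarz_ineq2 by auto
    also have "\<dots> \<le> C * norm (?g x)"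
      by (intro mult_right_mono assms) auto
    finally show "norm (s i x \<bullet> ?g x) \<le> C * norm (?g x)" .
  qed
qed



lemma bounded_simple_approximation:
  fixes \<Phi> :: "'a::topological_space \<Rightarrow> 'b :: {real_normed_vector, second_countable_topology}"
  assumes "\<Phi> \<in> borel_measurable borel" "\<And>x. norm (\<Phi> x) \<le> C"
  obtains s where "\<And>i. simple_function borel (s i)" "\<And>x. (\<lambda>i. s i x) \<longlonglongrightarrow> \<Phi> x"
    "\<And>i x. norm (s i x) \<le> 2 * C"
proof -
  obtain s where s: "\<And>i. simple_function borel (s i)" "\<And>x. (\<lambda>i. s i x) \<longlonglongrightarrow> \<Phi> x"
    "\<And>i x. dist (s i x) 0 \<le> 2 * dist (\<Phi> x) 0"
    using borel_measurable_implies_sequence_metric[OF assms(1), of 0] by auto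
  have "norm (s i x) \<le> 2 * C" for i x
    using s(3)[of i x] assms(2)[of x] by simp
  with s show ?thesis using that by blast
qed

text \<open>Each level set of \<open>s\<close> contributes one value of \<open>\<Lambda>\<close>, which its trace controls, and the traces add up to that
  of the whole space.\<close>

lemma abs_mat_integral_simple_le:
  fixes s :: "real^'d \<Rightarrow> real^'d^'d"
  assumes \<Lambda>: "mat_measure borel \<Lambda>" and s: "simple_function borel s" "\<And>x. norm (s x) \<le> C"
  shows "\<bar>mat_integral s \<Lambda>\<bar> \<le> C * (real CARD('d))\<^sup>2 * trace (\<Lambda> UNIV)"
proof -
  have "0 \<le> C"
    using s(2) norm_ge_zero order_trans by blast
  have nonneg: "\<Lambda> (s -` {y}) \<in> nonneg_mats" for y
    using \<Lambda> simple_functionD(2)[OF s(1)] by (auto simp: mat_measure_def)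
  have "\<bar>mat_integral s \<Lambda>\<bar> \<le> (\<Sum>y\<in>range s. \<bar>y \<bullet> \<Lambda> (s -` {y})\<bar>)"
    unfolding mat_integral_simple[OF \<Lambda> s(1)] by (rule sum_abs)
  also have "\<dots> \<le> (\<Sum>y\<in>range s. C * ((real CARD('d))\<^sup>2 * trace (\<Lambda> (s -` {y}))))"
  proof (intro sum_mono)
    fix y assume "y \<in> range s"
    then have "norm y \<le> C" using s(2) by auto
    have "\<bar>y \<bullet> \<Lambda> (s -` {y})\<bar> \<le> norm y * norm (\<Lambda> (s -` {y}))"
      by (rule Cauchy_Schwarz_ineq2)
    also have "\<dots> \<le> C * ((real CARD('d))\<^sup>2 * trace (\<Lambda> (s -` {y})))"
      using \<open>norm y \<le> C\<close> \<open>0 \<le> C\<close> norm_nonneg_mats_le_trace[OF nonneg] by (intro mult_mono) auto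
    finally show "\<bar>y \<bullet> \<Lambda> (s -` {y})\<bar> \<le> C * ((real CARD('d))\<^sup>2 * trace (\<Lambda> (s -` {y})))" .
  qed
  also have "\<dots> = C * (real CARD('d))\<^sup>2 * trace (\<Sum>y\<in>range s. \<Lambda> (s -` {y}))"
    by (simp add: linear_sum[OF bounded_linear.linear[OF bounded_linear_trace]] sum_distrib_left mult.assoc)
  finally show ?thesis
    by (simp add: mat_measure_simple_partition[OF \<Lambda> s(1)])
qed

lemma borel_measurable_simple: "simple_function borel s \<Longrightarrow> s \<in> borel_measurable borel"
  by (rule borel_measurable_simple_function)

text \<open>Interchanging the integrals reduces to \<open>\<integral> \<Lambda>t t E dt = \<Lambda> E\<close> for simple \<open>\<Phi>\<close>. In the passage to the
  limit the masses \<open>trace (\<Lambda>t t UNIV)\<close> dominate; they are integrable in \<open>t\<close>, whereas the variations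
  \<open>|\<Lambda>t t|\<close> would first have to be shown to depend measurably on \<open>t\<close>.\<close>

proposition mat_integral_time_average:
  fixes \<Phi> :: "real^'d \<Rightarrow> real^'d^'d" and \<Lambda>t :: "'t \<Rightarrow> (real^'d) set \<Rightarrow> real^'d^'d"
  assumes \<Phi>: "\<Phi> \<in> borel_measurable borel" "\<And>x. norm (\<Phi> x) \<le> C"
    and \<Lambda>t: "\<And>t. t \<in> space T \<Longrightarrow> mat_measure borel (\<Lambda>t t)" and \<Lambda>: "mat_measure borel \<Lambda>"
    and int: "\<And>E. E \<in> sets borel \<Longrightarrow> integrable T (\<lambda>t. \<Lambda>t t E)"
    and avg: "\<And>E. E \<in> sets borel \<Longrightarrow> \<Lambda> E = (LINT t|T. \<Lambda>t t E)"
  shows "integrable T (\<lambda>t. mat_integral \<Phi> (\<Lambda>t t))"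
    and "(LINT t|T. mat_integral \<Phi> (\<Lambda>t t)) = mat_integral \<Phi> \<Lambda>"
proof -
  obtain s where s: "\<And>i. simple_function borel (s i)" "\<And>x. (\<lambda>i. s i x) \<longlonglongrightarrow> \<Phi> x"
    "\<And>i x. norm (s i x) \<le> 2 * C"
    using bounded_simple_approximation[OF \<Phi>] by metis
  note meas_s = borel_measurable_simple[OF s(1)]
  have level: "s i -` {y} \<in> sets borel" for i y
    using simple_functionD(2)[OF s(1)] by simp
  have simple_t: "mat_integral (s i) (\<Lambda>t t) = (\<Sum>y\<in>range (s i). y \<bullet> \<Lambda>t t (s i -` {y}))"
    if "t \<in> space T" for i t
    by (rule mat_integral_simple[OF \<Lambda>t[OF that] s(1)])
  have int_simple: "integrable T (\<lambda>t. mat_integral (s i) (\<Lambda>t t))" for i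
  proof -
    have "integrable T (\<lambda>t. \<Sum>y\<in>range (s i). y \<bullet> \<Lambda>t t (s i -` {y}))"
      by (intro Bochner_Integration.integrable_sum integrable_inner_right int level)
    then show ?thesis
      using Bochner_Integration.integrable_cong[OF refl simple_t] by fast
  qed
  have avg_simple: "(LINT t|T. mat_integral (s i) (\<Lambda>t t)) = mat_integral (s i) \<Lambda>" for i
  proof -
    have "(LINT t|T. mat_integral (s i) (\<Lambda>t t)) = (LINT t|T. (\<Sum>y\<in>range (s i). y \<bullet> \<Lambda>t t (s i -` {y})))"
      by (intro Bochner_Integration.integral_cong refl simple_t)
    also have "\<dots> = (\<Sum>y\<in>range (s i). y \<bullet> (LINT t|T. \<Lambda>t t (s i -` {y})))"
    proof -
      have "(LINT t|T. (\<Sum>y\<in>range (s i). y \<bullet> \<Lambda>t t (s i -` {y})))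
          = (\<Sum>y\<in>range (s i). LINT t|T. y \<bullet> \<Lambda>t t (s i -` {y}))"
        by (rule Bochner_Integration.integral_sum) (intro integrable_inner_right int level)
      also have "\<dots> = (\<Sum>y\<in>range (s i). y \<bullet> (LINT t|T. \<Lambda>t t (s i -` {y})))"
        by (intro sum.cong refl Bochner_Integration.integral_inner_right int level)
      finally show ?thesis .
    qed
    finally show ?thesis
      unfolding mat_integral_simple[OF \<Lambda> s(1)] avg[OF level] .
  qed
  have lim_t: "(\<lambda>i. mat_integral (s i) (\<Lambda>t t)) \<longlonglongrightarrow> mat_integral \<Phi> (\<Lambda>t t)" if "t \<in> space T" for t
    by (rule mat_integral_dominated_convergence[OF \<Lambda>t[OF that] meas_s \<Phi>(1) s(2,3)])
  have lim: "(\<lambda>i. mat_integral (s i) \<Lambda>) \<longlonglongrightarrow> mat_integral \<Phi> \<Lambda>"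
    by (rule mat_integral_dominated_convergence[OF \<Lambda> meas_s \<Phi>(1) s(2,3)])
  have meas: "(\<lambda>t. mat_integral \<Phi> (\<Lambda>t t)) \<in> borel_measurable T"
    by (rule borel_measurable_LIMSEQ_real[of T "\<lambda>i t. mat_integral (s i) (\<Lambda>t t)"])
      (rule lim_t, assumption, rule borel_measurable_integrable, rule int_simple)
  have bound: "integrable T (\<lambda>t. 2 * C * (real CARD('d))\<^sup>2 * trace (\<Lambda>t t UNIV))"
    by (intro integrable_mult_right integrable_bounded_linear[OF bounded_linear_trace] int) auto
  have le: "AE t in T. norm (mat_integral (s i) (\<Lambda>t t)) \<le> 2 * C * (real CARD('d))\<^sup>2 * trace (\<Lambda>t t UNIV)" for i
    using abs_mat_integral_simple_le[OF \<Lambda>t s(1,3)] by (intro AE_I2) simp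
  have lim_AE: "AE t in T. (\<lambda>i. mat_integral (s i) (\<Lambda>t t)) \<longlonglongrightarrow> mat_integral \<Phi> (\<Lambda>t t)"
    using lim_t by (rule AE_I2)
  note dct = meas borel_measurable_integrable[OF int_simple] bound lim_AE le
  show "integrable T (\<lambda>t. mat_integral \<Phi> (\<Lambda>t t))"
    by (rule integrable_dominated_convergence[OF dct])
  have "(\<lambda>i. LINT t|T. mat_integral (s i) (\<Lambda>t t)) \<longlonglongrightarrow> (LINT t|T. mat_integral \<Phi> (\<Lambda>t t))"
    by (rule integral_dominated_convergence[OF dct])
  then show "(LINT t|T. mat_integral \<Phi> (\<Lambda>t t)) = mat_integral \<Phi> \<Lambda>"
    using lim unfolding avg_simple by (rule LIMSEQ_unique)
qed

text \<open>A disintegration agrees with its continuous representative only for almost every \<open>t\<close>, and such an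
  equality passes to Bochner integrals only between measurable integrands.\<close>

lemma integral_kernel_measurable:
  fixes \<phi> :: "'a::topological_space \<Rightarrow> real"
  assumes \<phi>: "\<phi> \<in> borel_measurable borel" "\<And>x. \<bar>\<phi> x\<bar> \<le> C"
    and K: "\<And>t. t \<in> space T \<Longrightarrow> sets (K t) = sets borel" "\<And>t. t \<in> space T \<Longrightarrow> finite_measure (K t)"
    and meas: "\<And>E. E \<in> sets borel \<Longrightarrow> (\<lambda>t. emeasure (K t) E) \<in> borel_measurable T"
  shows "(\<lambda>t. LINT x|K t. \<phi> x) \<in> borel_measurable T"
proof -
  obtain s where s: "\<And>i. simple_function borel (s i)" "\<And>x. (\<lambda>i. s i x) \<longlonglongrightarrow> \<phi> x"
    "\<And>i x. norm (s i x) \<le> 2 * C"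
    using bounded_simple_approximation[OF \<phi>(1), of C] \<phi>(2) by auto
  have level: "s i -` {y} \<in> sets borel" for i y
    using simple_functionD(2)[OF s(1)] by simp
  have simple: "(LINT x|K t. s i x) = (\<Sum>y\<in>range (s i). y * measure (K t) (s i -` {y}))"
    if "t \<in> space T" for i t
  proof -
    interpret finite_measure "K t" using K that by auto
    have "s i x = (\<Sum>y\<in>range (s i). y * indicator (s i -` {y}) x)" for x
    proof -
      have "(\<Sum>y\<in>range (s i). y * indicator (s i -` {y}) x) = (\<Sum>y\<in>range (s i). if y = s i x then y else 0)"
        by (intro sum.cong) (auto simp: indicator_def)
      then show ?thesis using simple_functionD(1)[OF s(1), of i] by simp
    qed
    then have "(LINT x|K t. s i x) = (LINT x|K t. (\<Sum>y\<in>range (s i). y * indicator (s i -` {y}) x))"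
      by (intro Bochner_Integration.integral_cong refl)
    also have "\<dots> = (\<Sum>y\<in>range (s i). LINT x|K t. y * indicator (s i -` {y}) x)"
      using level K(1)[OF that]
      by (intro Bochner_Integration.integral_sum integrable_mult_right integrable_real_indicator)
        (auto simp: less_top[symmetric])
    also have "\<dots> = (\<Sum>y\<in>range (s i). y * measure (K t) (s i -` {y}))"
      using level K(1)[OF that] sets_eq_imp_space_eq[OF K(1)[OF that]] by (intro sum.cong) auto
    finally show ?thesis .
  qed
  show ?thesis
  proof (rule borel_measurable_LIMSEQ_real)
    fix t assume t: "t \<in> space T"
    interpret finite_measure "K t" using K t by auto
    note cong = measurable_cong_sets[OF K(1)[OF t] refl]
    show "(\<lambda>i. LINT x|K t. s i x) \<longlonglongrightarrow> (LINT x|K t. \<phi> x)"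
    proof (rule integral_dominated_convergence)
      show "\<phi> \<in> borel_measurable (K t)" "s i \<in> borel_measurable (K t)" for i
        using \<phi>(1) borel_measurable_simple[OF s(1)] cong by blast+
      show "integrable (K t) (\<lambda>_. 2 * C)" by simp
    qed (use s in auto)
  next
    fix i
    have "(\<lambda>t. \<Sum>y\<in>range (s i). y * measure (K t) (s i -` {y})) \<in> borel_measurable T"
      unfolding measure_def using meas[OF level] by (intro borel_measurable_sum borel_measurable_times) auto
    then show "(\<lambda>t. LINT x|K t. s i x) \<in> borel_measurable T"
      using simple by (simp cong: measurable_cong)
  qed
qed

lemma mat_integral_add:
  fixes \<Phi> \<Psi> :: "real^'d \<Rightarrow> real^'d^'d"
  assumes "mat_measure borel \<Lambda>"
    and "\<Phi> \<in> borel_measurable borel" "\<And>x. norm (\<Phi> x) \<le> C"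
    and "\<Psi> \<in> borel_measurable borel" "\<And>x. norm (\<Psi> x) \<le> D"
  shows "mat_integral (\<lambda>x. \<Phi> x + \<Psi> x) \<Lambda> = mat_integral \<Phi> \<Lambda> + mat_integral \<Psi> \<Lambda>"
  unfolding mat_integral_def inner_add_left
  using integrable_inner_polar_density[OF assms(1-3)] integrable_inner_polar_density[OF assms(1,4,5)]
  by (rule Bochner_Integration.integral_add)

lemma mat_integral_scaleR: "mat_integral (\<lambda>x. c *\<^sub>R \<Phi> x) \<Lambda> = c * mat_integral \<Phi> \<Lambda>"
  by (simp add: mat_integral_def)

section \<open>Convex costs as suprema of linear functionals\<close>

lemma pos_homogeneous_zero: "pos_homogeneous f \<Longrightarrow> f 0 = 0"
  using subspace_0[OF subspace_sym_mats] by (force simp: pos_homogeneous_def)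

lemma lsc_on_sym_sequentially:
  assumes lsc: "lsc_on_sym f" and X: "\<And>n::nat. X n \<in> sym_mats" "X \<longlonglongrightarrow> A"
    and s: "\<And>n. f (X n) \<le> ennreal (s n)" "s \<longlonglongrightarrow> a"
  shows "f A \<le> ennreal a"
proof (rule ccontr)
  assume "\<not> f A \<le> ennreal a"
  then obtain c where c: "ennreal a < c" "c < f A"
    using dense[of "ennreal a" "f A"] by (auto simp: not_le)
  have "A \<in> sym_mats"
    using closed_sequentially[OF closed_sym_mats] X by blast
  with lsc c have "c < Liminf (at A within sym_mats) f"
    unfolding lsc_on_sym_def by (blast intro: less_le_trans)
  then have "eventually (\<lambda>B. c < f B) (at A within sym_mats)"
    by (rule less_LiminfD)
  then obtain S where S: "open S" "A \<in> S" "\<And>B. B \<in> S \<Longrightarrow> B \<in> sym_mats \<Longrightarrow> c < f B"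
    using c(2) unfolding eventually_at_topological by metis
  have "eventually (\<lambda>n. X n \<in> S) sequentially"
    using X(2) S(1,2) by (rule topological_tendstoD)
  moreover have "eventually (\<lambda>n. ennreal (s n) < c) sequentially"
    using tendsto_ennrealI[OF s(2)] c(1) by (rule order_tendstoD)
  ultimately have "eventually (\<lambda>n. False) sequentially"
  proof eventually_elim
    case (elim n)
    then show False
      using S(3)[OF elim(1) X(1)] s(1)[of n] by auto
  qed
  then show False by simp
qed

text \<open>The point \<open>(A, c)\<close> below the graph is separated from the epigraph, which is a closed convex cone. A
  separating hyperplane that is not vertical is the graph of a functional below \<open>f\<close>; a vertical
  one separates \<open>A\<close> from the domain of \<open>f\<close>, and a large multiple of its normal vector works.\<close>

lemma supporting_functional:
  fixes f :: "real^'d^'d \<Rightarrow> ennreal"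
  assumes conv: "convex_on_sym f" and hom: "pos_homogeneous f" and lsc: "lsc_on_sym f"
    and A: "A \<in> sym_mats" and c: "0 \<le> c" "ennreal c < f A"
  obtains L where "\<And>B. B \<in> sym_mats \<Longrightarrow> ennreal (L \<bullet> B) \<le> f B" "c < L \<bullet> A"
proof -
  define S where "S = {(B, s). B \<in> sym_mats \<and> 0 \<le> s \<and> f B \<le> ennreal s}"
  have "convex S"
    unfolding convex_alt
  proof safe
    fix B s B' s' and u :: real
    assume Bs: "(B, s) \<in> S" "(B', s') \<in> S" and u: "0 \<le> u" "u \<le> 1"
    have "f ((1 - u) *\<^sub>R B + u *\<^sub>R B') \<le> ennreal (1 - u) * f B + ennreal u * f B'"
      using conv Bs u by (auto simp: convex_on_sym_def S_def)
    also have "\<dots> \<le> ennreal (1 - u) * ennreal s + ennreal u * ennreal s'"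
      using Bs by (intro add_mono mult_left_mono) (auto simp: S_def)
    also have "\<dots> = ennreal ((1 - u) * s + u * s')"
      using Bs u by (simp add: S_def ennreal_mult)
    finally show "(1 - u) *\<^sub>R (B, s) + u *\<^sub>R (B', s') \<in> S"
      using Bs u subspace_sym_mats
      by (auto simp: S_def intro!: subspace_add subspace_scale)
  qed
  moreover have "closed S"
    unfolding closed_sequential_limits
  proof (intro allI impI, elim conjE)
    fix Z :: "nat \<Rightarrow> (real^'d^'d) \<times> real" and z
    assume Z: "\<forall>n. Z n \<in> S" "Z \<longlonglongrightarrow> z"
    have lim: "(\<lambda>n. fst (Z n)) \<longlonglongrightarrow> fst z" "(\<lambda>n. snd (Z n)) \<longlonglongrightarrow> snd z"
      using Z(2) by (auto intro: tendsto_fst tendsto_snd)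
    have mem: "fst (Z n) \<in> sym_mats" "0 \<le> snd (Z n)" "f (fst (Z n)) \<le> ennreal (snd (Z n))" for n
      using Z(1)[rule_format, of n] by (auto simp: S_def split: prod.splits)
    have "f (fst z) \<le> ennreal (snd z)"
      by (rule lsc_on_sym_sequentially[OF lsc mem(1) lim(1) mem(3) lim(2)])
    moreover have "fst z \<in> sym_mats"
      using closed_sequentially[OF closed_sym_mats, of "\<lambda>n. fst (Z n)"] mem(1) lim(1) by blast
    moreover have "0 \<le> snd z"
      using lim(2) mem(2) by (intro LIMSEQ_le_const) auto
    ultimately show "z \<in> S"
      by (cases z) (simp add: S_def)
  qed
  moreover have "(A, c) \<notin> S"
    using c by (auto simp: S_def)
  ultimately obtain a b where ab: "a \<bullet> (A, c) < b" "\<And>z. z \<in> S \<Longrightarrow> b < a \<bullet> z"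
    using separating_hyperplane_closed_point by metis
  obtain P \<tau> where a: "a = (P, \<tau>)" by (cases a)
  have sep: "P \<bullet> A + \<tau> * c < b" "\<And>B s. (B, s) \<in> S \<Longrightarrow> b < P \<bullet> B + \<tau> * s"
    using ab by (auto simp: a)
  have zero: "(0, s) \<in> S" if "0 \<le> s" for s
    using that pos_homogeneous_zero[OF hom] subspace_0[OF subspace_sym_mats] by (auto simp: S_def)
  have "b < 0"
    using sep(2)[OF zero[of 0]] by simp
  have cone: "(r *\<^sub>R B, r * s) \<in> S" if "(B, s) \<in> S" "0 \<le> r" for r B s
    using that hom subspace_scale[OF subspace_sym_mats]
    by (auto simp: S_def pos_homogeneous_def ennreal_mult mult_left_mono)
  have nonneg: "0 \<le> P \<bullet> B + \<tau> * s" if "(B, s) \<in> S" for B s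
  proof (rule ccontr)
    assume neg: "\<not> 0 \<le> P \<bullet> B + \<tau> * s"
    \<comment> \<open>Scaling a point of the cone by \<open>r\<close> would reach the value \<open>b\<close>, which points of \<open>S\<close> exceed.\<close>
    define r where "r = b / (P \<bullet> B + \<tau> * s)"
    have "0 \<le> r"
      using neg \<open>b < 0\<close> by (simp add: r_def divide_nonpos_neg)
    then have "b < P \<bullet> (r *\<^sub>R B) + \<tau> * (r * s)"
      by (intro sep(2) cone that)
    also have "\<dots> = r * (P \<bullet> B + \<tau> * s)"
      by (simp add: algebra_simps)
    also have "\<dots> = b"
      using neg by (simp add: r_def)
    finally show False by simp
  qed
  have "0 \<le> \<tau>"
    using nonneg[OF zero[of 1]] by simp
  have fin: "(B, enn2real (f B)) \<in> S" if "B \<in> sym_mats" "f B < \<infinity>" for B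
    using that by (simp add: S_def ennreal_enn2real)
  show ?thesis
  proof (cases "\<tau> = 0")
    case False
    with \<open>0 \<le> \<tau>\<close> have \<tau>: "0 < \<tau>" by simp
    define L where "L = (- 1 / \<tau>) *\<^sub>R P"
    show ?thesis
    proof
      fix B :: "real^'d^'d" assume B: "B \<in> sym_mats"
      show "ennreal (L \<bullet> B) \<le> f B"
      proof (cases "f B < \<infinity>")
        case True
        have "L \<bullet> B \<le> enn2real (f B)"
          using nonneg[OF fin[OF B True]] \<tau> by (simp add: L_def field_simps)
        then have "ennreal (L \<bullet> B) \<le> ennreal (enn2real (f B))"
          by (rule ennreal_leI)
        then show ?thesis
          using True by (metis ennreal_enn2real infinity_ennreal_def)
      qed (simp add: less_top[symmetric])
    next
      show "c < L \<bullet> A"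
        using sep(1) \<open>b < 0\<close> \<tau> by (simp add: L_def field_simps)
    qed
  next
    case True
    have PA: "P \<bullet> A < 0"
      using sep(1) True \<open>b < 0\<close> by simp
    define k where "k = (c + 1) / - (P \<bullet> A)"
    have k: "0 \<le> k" "- k * (P \<bullet> A) = c + 1"
      using PA c(1) by (auto simp: k_def divide_simps)
    show ?thesis
    proof
      fix B :: "real^'d^'d" assume B: "B \<in> sym_mats"
      show "ennreal (((- k) *\<^sub>R P) \<bullet> B) \<le> f B"
      proof (cases "f B < \<infinity>")
        case fB: True
        have "0 \<le> P \<bullet> B"
          using nonneg[OF fin[OF B fB]] True by simp
        then show ?thesis
          using k(1) by (simp add: ennreal_neg)
      qed (simp add: less_top[symmetric])
    next
      show "c < ((- k) *\<^sub>R P) \<bullet> A"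
        using k(2) by simp
    qed
  qed
qed

text \<open>Countably many functionals suffice because \<open>c < L \<bullet> A\<close> is an open condition on \<open>L\<close>, so that it is met
  inside a dense subset of the functionals below \<open>f\<close>.\<close>

proposition sup_of_countably_many_functionals:
  fixes f :: "real^'d^'d \<Rightarrow> ennreal"
  assumes "convex_on_sym f" "pos_homogeneous f" "lsc_on_sym f"
  obtains L :: "nat \<Rightarrow> real^'d^'d" where "\<And>A. A \<in> sym_mats \<Longrightarrow> f A = (SUP n. ennreal (L n \<bullet> A))"
proof -
  define S where "S = {L. \<forall>B\<in>sym_mats. ennreal (L \<bullet> B) \<le> f B}"
  obtain D where D: "countable D" "D \<subseteq> S" "S \<subseteq> closure D"
    using separable[of S] by metis
  have "0 \<in> S" by (simp add: S_def)
  then have "D \<noteq> {}" using D(3) by auto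
  have range: "range (from_nat_into D) = D"
    by (rule range_from_nat_into[OF \<open>D \<noteq> {}\<close> D(1)])
  show ?thesis
  proof
    fix A :: "real^'d^'d" assume A: "A \<in> sym_mats"
    show "f A = (SUP n. ennreal (from_nat_into D n \<bullet> A))"
    proof (rule antisym)
      show "f A \<le> (SUP n. ennreal (from_nat_into D n \<bullet> A))"
      proof (rule dense_le)
        fix c assume c: "c < f A"
        then obtain c' where c': "c = ennreal c'" "0 \<le> c'"
          by (cases c) auto
        obtain L where L: "\<And>B. B \<in> sym_mats \<Longrightarrow> ennreal (L \<bullet> B) \<le> f B" "c' < L \<bullet> A"
          using supporting_functional[OF assms A c'(2)] c c'(1) by metis
        have "open {L. c' < L \<bullet> A}"
          by (intro open_Collect_less continuous_intros)
        moreover have "L \<in> closure D"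
          using L D(3) by (auto simp: S_def)
        ultimately obtain L' where L': "L' \<in> D" "c' < L' \<bullet> A"
          using L(2) open_Int_closure_eq_empty[of "{L. c' < L \<bullet> A}" D] by blast
        obtain n where "L' = from_nat_into D n"
          using L'(1) range by auto
        then have "c \<le> ennreal (from_nat_into D n \<bullet> A)"
          using L'(2) c' by (simp add: ennreal_leI)
        then show "c \<le> (SUP n. ennreal (from_nat_into D n \<bullet> A))"
          by (rule SUP_upper2[OF UNIV_I])
      qed
      show "(SUP n. ennreal (from_nat_into D n \<bullet> A)) \<le> f A"
        using D(2) range A by (intro SUP_least) (auto simp: S_def)
    qed
  qed
qed


section \<open>Jensen's inequality for averages of matrix measures\<close>

lemma ennreal_integral_le_nn_integral:
  fixes h :: "'a \<Rightarrow> real"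
  assumes "integrable M h"
  shows "ennreal (LINT x|M. h x) \<le> (\<integral>\<^sup>+x. ennreal (h x) \<partial>M)"
proof -
  have int: "integrable M (\<lambda>x. max 0 (h x))"
    using assms by (intro integrable_max) auto
  have "(LINT x|M. h x) \<le> (LINT x|M. max 0 (h x))"
    using assms int by (intro integral_mono) auto
  then have "ennreal (LINT x|M. h x) \<le> ennreal (LINT x|M. max 0 (h x))"
    by (rule ennreal_leI)
  also have "\<dots> = (\<integral>\<^sup>+x. ennreal (max 0 (h x)) \<partial>M)"
    using int by (intro nn_integral_eq_integral[symmetric]) auto
  also have "\<dots> = (\<integral>\<^sup>+x. ennreal (h x) \<partial>M)"
    by (intro nn_integral_cong) (auto simp: max_def ennreal_neg)
  finally show ?thesis .
qed

text \<open>On each of the disjoint sets \<open>E n\<close> the cost density dominates the \<open>n\<close>-th functional.\<close>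

lemma inner_mat_measure_le_mat_cost:
  fixes L :: "nat \<Rightarrow> real^'d^'d"
  assumes f: "\<And>A. A \<in> sym_mats \<Longrightarrow> f A = (SUP n. ennreal (L n \<bullet> A))"
    and \<Lambda>: "mat_measure borel \<Lambda>"
    and E: "\<And>n. E n \<in> sets borel" "disjoint_family E"
  shows "(\<Sum>n\<le>N. ennreal (L n \<bullet> \<Lambda> (E n))) \<le> mat_cost f \<Lambda>"
proof -
  let ?V = "variation borel \<Lambda>" and ?g = "polar_density borel \<Lambda>"
  have [measurable]: "?g \<in> borel_measurable ?V"
    using integrable_polar_density[OF \<Lambda>] by auto
  have EV [measurable]: "E n \<in> sets ?V" for n
    using E(1) sets_variation[OF \<Lambda>] by simp
  have fg: "f (?g x) = (SUP n. ennreal (L n \<bullet> ?g x))" for x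
    by (intro f polar_density_sym[OF \<Lambda>])
  have [measurable]: "(\<lambda>x. f (?g x)) \<in> borel_measurable ?V"
    unfolding fg by measurable
  have "ennreal (L n \<bullet> \<Lambda> (E n)) \<le> (\<integral>\<^sup>+x\<in>E n. f (?g x) \<partial>?V)" for n
  proof -
    have int: "integrable ?V (\<lambda>x. indicator (E n) x *\<^sub>R ?g x)"
      using EV by (intro integrable_mult_indicator integrable_polar_density[OF \<Lambda>])
    have "L n \<bullet> \<Lambda> (E n) = (LINT x|?V. L n \<bullet> (indicator (E n) x *\<^sub>R ?g x))"
      unfolding polar_density_eq[OF \<Lambda> E(1)] set_lebesgue_integral_def
      using int by (intro Bochner_Integration.integral_inner_right[symmetric])
    then have "ennreal (L n \<bullet> \<Lambda> (E n)) \<le> (\<integral>\<^sup>+x. ennreal (L n \<bullet> (indicator (E n) x *\<^sub>R ?g x)) \<partial>?V)"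
      using ennreal_integral_le_nn_integral[OF integrable_inner_right[of "L n"], OF int] by metis
    also have "\<dots> \<le> (\<integral>\<^sup>+x\<in>E n. f (?g x) \<partial>?V)"
      unfolding fg by (intro nn_integral_mono) (auto simp: indicator_def intro!: SUP_upper)
    finally show ?thesis .
  qed
  then have "(\<Sum>n\<le>N. ennreal (L n \<bullet> \<Lambda> (E n))) \<le> (\<Sum>n\<le>N. \<integral>\<^sup>+x\<in>E n. f (?g x) \<partial>?V)"
    by (intro sum_mono)
  also have "\<dots> = (\<integral>\<^sup>+x. (\<Sum>n\<le>N. f (?g x) * indicator (E n) x) \<partial>?V)"
    by (intro nn_integral_sum[symmetric]) measurable
  also have "\<dots> \<le> (\<integral>\<^sup>+x. f (?g x) \<partial>?V)"
  proof (intro nn_integral_mono)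
    fix x
    show "(\<Sum>n\<le>N. f (?g x) * indicator (E n) x) \<le> f (?g x)"
    proof (cases "\<exists>m\<le>N. x \<in> E m")
      case True
      then obtain m where m: "m \<le> N" "x \<in> E m" by blast
      then have "(\<Sum>n\<le>N. f (?g x) * indicator (E n) x) = (\<Sum>n\<le>N. if n = m then f (?g x) else 0)"
        using disjoint_family_onD[OF E(2)] by (intro sum.cong) (auto simp: indicator_def)
      then show ?thesis using m by simp
    next
      case False
      then show ?thesis by (simp add: indicator_def)
    qed
  qed
  finally show ?thesis
    by (simp add: mat_cost_def)
qed

text \<open>Truncating the supremum after \<open>N\<close> functionals, the space splits into the pieces \<open>E n\<close> on which
  the \<open>n\<close>-th one is maximal at the density of the average \<open>\<Lambda>\<close>. The truncated cost is then the sum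
  of the numbers \<open>L n \<bullet> \<Lambda> (E n)\<close>, which are averages in \<open>t\<close> of lower bounds for the cost of \<open>\<Lambda>t t\<close>.
  These bounds depend measurably on \<open>t\<close>, so that comparing them with \<open>mat_cost f (\<Lambda>t t)\<close> for each
  single \<open>t\<close> is enough.\<close>

theorem mat_cost_time_average_le:
  fixes f :: "real^'d^'d \<Rightarrow> ennreal" and \<Lambda>t :: "'t \<Rightarrow> (real^'d) set \<Rightarrow> real^'d^'d"
  assumes "convex_on_sym f" "pos_homogeneous f" "lsc_on_sym f"
    and \<Lambda>t: "\<And>t. t \<in> space T \<Longrightarrow> mat_measure borel (\<Lambda>t t)" and \<Lambda>: "mat_measure borel \<Lambda>"
    and int: "\<And>E. E \<in> sets borel \<Longrightarrow> integrable T (\<lambda>t. \<Lambda>t t E)"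
    and avg: "\<And>E. E \<in> sets borel \<Longrightarrow> \<Lambda> E = (LINT t|T. \<Lambda>t t E)"
  shows "mat_cost f \<Lambda> \<le> (\<integral>\<^sup>+t. mat_cost f (\<Lambda>t t) \<partial>T)"
proof -
  obtain L :: "nat \<Rightarrow> real^'d^'d" where f: "\<And>A. A \<in> sym_mats \<Longrightarrow> f A = (SUP n. ennreal (L n \<bullet> A))"
    using sup_of_countably_many_functionals assms(1-3) by blast
  let ?V = "variation borel \<Lambda>" and ?g = "polar_density borel \<Lambda>"
  have gV [measurable]: "?g \<in> borel_measurable ?V"
    using integrable_polar_density[OF \<Lambda>] by auto
  have g [measurable]: "?g \<in> borel_measurable borel"
    using gV measurable_cong_sets[OF sets_variation[OF \<Lambda>] refl] by blast
  have fg: "f (?g x) = (SUP N. SUP n\<in>{..N}. ennreal (L n \<bullet> ?g x))" for x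
  proof -
    have "f (?g x) = (SUP n. ennreal (L n \<bullet> ?g x))"
      by (intro f polar_density_sym[OF \<Lambda>])
    also have "\<dots> = (SUP N. SUP n\<in>{..N}. ennreal (L n \<bullet> ?g x))"
      by (intro antisym SUP_least) (auto intro: SUP_upper2 SUP_upper)
    finally show ?thesis .
  qed
  have "mat_cost f \<Lambda> = (SUP N. \<integral>\<^sup>+x. (SUP n\<in>{..N}. ennreal (L n \<bullet> ?g x)) \<partial>?V)"
    unfolding mat_cost_def fg
  proof (rule nn_integral_monotone_convergence_SUP)
    show "incseq (\<lambda>N x. SUP n\<in>{..N}. ennreal (L n \<bullet> ?g x))"
      by (auto simp: incseq_def le_fun_def intro!: SUP_subset_mono)
  qed measurable
  also have "\<dots> \<le> (\<integral>\<^sup>+t. mat_cost f (\<Lambda>t t) \<partial>T)"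
  proof (rule SUP_least)
    fix N :: nat
    define E where "E n = {x. 0 < L n \<bullet> ?g x \<and> (\<forall>k<n. L k \<bullet> ?g x < L n \<bullet> ?g x) \<and>
        n \<le> N \<and> (\<forall>k\<le>N. L k \<bullet> ?g x \<le> L n \<bullet> ?g x)}" for n
    have E: "E n \<in> sets borel" for n
      unfolding E_def by measurable
    have disj: "disjoint_family E"
      unfolding disjoint_family_on_def E_def by (auto, metis linorder_neqE_nat not_less order_le_less)
    have EV [measurable]: "E n \<in> sets ?V" for n
      using E sets_variation[OF \<Lambda>] by simp
    have "(\<integral>\<^sup>+x. (SUP n\<in>{..N}. ennreal (L n \<bullet> ?g x)) \<partial>?V)
        \<le> (\<integral>\<^sup>+x. (\<Sum>n\<le>N. ennreal (L n \<bullet> (indicator (E n) x *\<^sub>R ?g x))) \<partial>?V)"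
    proof (intro nn_integral_mono SUP_least)
      fix x n assume n: "n \<in> {..N}"
      define M where "M = Max ((\<lambda>k. L k \<bullet> ?g x) ` {..N})"
      have le: "L k \<bullet> ?g x \<le> M" if "k \<le> N" for k
        unfolding M_def using that by (intro Max_ge) auto
      have "M \<in> (\<lambda>k. L k \<bullet> ?g x) ` {..N}"
        unfolding M_def by (intro Max_in) auto
      then have ex: "\<exists>m. m \<le> N \<and> L m \<bullet> ?g x = M" by auto
      \<comment> \<open>Ties go to the smallest index, which keeps the sets \<open>E n\<close> disjoint.\<close>
      define m where "m = (LEAST m. m \<le> N \<and> L m \<bullet> ?g x = M)"
      have m: "m \<le> N" "L m \<bullet> ?g x = M"
        using LeastI_ex[OF ex] by (auto simp: m_def)
      have first: "L k \<bullet> ?g x < M" if "k < m" for k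
        using le[of k] not_less_Least[OF that[unfolded m_def]] that m(1) by force
      show "ennreal (L n \<bullet> ?g x) \<le> (\<Sum>n\<le>N. ennreal (L n \<bullet> (indicator (E n) x *\<^sub>R ?g x)))"
      proof (cases "M \<le> 0")
        case True
        then have "L n \<bullet> ?g x \<le> 0"
          using le[of n] n by simp
        then show ?thesis by (simp add: ennreal_neg)
      next
        case False
        then have "x \<in> E m"
          using m first le by (auto simp: E_def)
        then have "ennreal (L n \<bullet> ?g x) \<le> ennreal (L m \<bullet> (indicator (E m) x *\<^sub>R ?g x))"
          using le[of n] n m(2) by (auto intro: ennreal_leI)
        also have "\<dots> \<le> (\<Sum>n\<le>N. ennreal (L n \<bullet> (indicator (E n) x *\<^sub>R ?g x)))"
          using m(1) by (intro member_le_sum) auto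
        finally show ?thesis .
      qed
    qed
    also have "\<dots> = (\<Sum>n\<le>N. \<integral>\<^sup>+x. ennreal (L n \<bullet> (indicator (E n) x *\<^sub>R ?g x)) \<partial>?V)"
      by (intro nn_integral_sum) measurable
    also have "\<dots> = (\<Sum>n\<le>N. ennreal (L n \<bullet> \<Lambda> (E n)))"
    proof (intro sum.cong refl)
      fix n
      have int: "integrable ?V (\<lambda>x. indicator (E n) x *\<^sub>R ?g x)"
        using EV by (intro integrable_mult_indicator integrable_polar_density[OF \<Lambda>])
      have "(\<integral>\<^sup>+x. ennreal (L n \<bullet> (indicator (E n) x *\<^sub>R ?g x)) \<partial>?V)
          = ennreal (LINT x|?V. L n \<bullet> (indicator (E n) x *\<^sub>R ?g x))"
        using integrable_inner_right[of "L n", OF int]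
        by (intro nn_integral_eq_integral AE_I2) (auto simp: indicator_def E_def)
      also have "(LINT x|?V. L n \<bullet> (indicator (E n) x *\<^sub>R ?g x)) = L n \<bullet> \<Lambda> (E n)"
        unfolding polar_density_eq[OF \<Lambda> E] set_lebesgue_integral_def
        using int by (intro Bochner_Integration.integral_inner_right)
      finally show "(\<integral>\<^sup>+x. ennreal (L n \<bullet> (indicator (E n) x *\<^sub>R ?g x)) \<partial>?V) = ennreal (L n \<bullet> \<Lambda> (E n))" .
    qed
    also have "\<dots> \<le> (\<Sum>n\<le>N. \<integral>\<^sup>+t. ennreal (L n \<bullet> \<Lambda>t t (E n)) \<partial>T)"
    proof (intro sum_mono)
      fix n
      have "L n \<bullet> \<Lambda> (E n) = (LINT t|T. L n \<bullet> \<Lambda>t t (E n))"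
        unfolding avg[OF E] using int[OF E] by (intro Bochner_Integration.integral_inner_right[symmetric])
      then show "ennreal (L n \<bullet> \<Lambda> (E n)) \<le> (\<integral>\<^sup>+t. ennreal (L n \<bullet> \<Lambda>t t (E n)) \<partial>T)"
        using ennreal_integral_le_nn_integral[OF integrable_inner_right[of "L n"], OF int[OF E]] by metis
    qed
    also have "\<dots> = (\<integral>\<^sup>+t. (\<Sum>n\<le>N. ennreal (L n \<bullet> \<Lambda>t t (E n))) \<partial>T)"
      using borel_measurable_integrable[OF integrable_inner_right, OF int[OF E]]
      by (intro nn_integral_sum[symmetric] measurable_compose[OF _ measurable_ennreal]) blast
    also have "\<dots> \<le> (\<integral>\<^sup>+t. mat_cost f (\<Lambda>t t) \<partial>T)"
      by (intro nn_integral_mono inner_mat_measure_le_mat_cost[OF f \<Lambda>t E disj])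
    finally show "(\<integral>\<^sup>+x. (SUP n\<in>{..N}. ennreal (L n \<bullet> ?g x)) \<partial>?V) \<le> (\<integral>\<^sup>+t. mat_cost f (\<Lambda>t t) \<partial>T)" .
  qed
  finally show ?thesis .
qed

section \<open>A cutoff in time\<close>

text \<open>The hat function of mass one on \<open>[1, 3]\<close> and its primitive, a quadratic spline that rises from \<open>0\<close> to
  \<open>1\<close> and is continuously differentiable everywhere.\<close>

definition ramp_density :: "real \<Rightarrow> real" where
  "ramp_density u = max 0 (u - 1) - 2 * max 0 (u - 2) + max 0 (u - 3)"

definition ramp :: "real \<Rightarrow> real" where
  "ramp u = ((max 0 (u - 1))\<^sup>2 - 2 * (max 0 (u - 2))\<^sup>2 + (max 0 (u - 3))\<^sup>2) / 2"

lemma has_real_derivative_positive_part_squared: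
  "((\<lambda>u. (max 0 (u - a))\<^sup>2) has_real_derivative 2 * max 0 (u - a)) (at u)"
proof (cases "u = a")
  case True
  have "((\<lambda>h. (max 0 h)\<^sup>2 / h) \<longlongrightarrow> 0) (at (0::real))"
  proof (rule Lim_null_comparison)
    show "\<forall>\<^sub>F h in at 0. norm ((max 0 h)\<^sup>2 / h) \<le> \<bar>h\<bar>"
      by (rule always_eventually) (auto simp: max_def power2_eq_square abs_mult)
    show "((\<lambda>h. \<bar>h\<bar>) \<longlongrightarrow> 0) (at (0::real))"
      by (rule tendsto_rabs_zero[OF tendsto_ident_at])
  qed
  then show ?thesis
    using True by (simp add: DERIV_def)
next
  case False
  then consider "u < a" | "a < u" by linarith
  then show ?thesis
  proof cases
    case 1
    have "((\<lambda>u. 0) has_real_derivative 2 * max 0 (u - a)) (at u)"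
      using 1 by simp
    then show ?thesis
      by (rule has_field_derivative_transform_within_open[where S = "{..<a}"]) (use 1 in auto)
  next
    case 2
    have "((\<lambda>u. (u - a)\<^sup>2) has_real_derivative 2 * max 0 (u - a)) (at u)"
      using 2 by (auto intro!: derivative_eq_intros)
    then show ?thesis
      by (rule has_field_derivative_transform_within_open[where S = "{a<..}"]) (use 2 in auto)
  qed
qed

lemma has_real_derivative_ramp: "(ramp has_real_derivative ramp_density u) (at u)"
  unfolding ramp_def ramp_density_def
  by (rule derivative_eq_intros has_real_derivative_positive_part_squared refl | simp)+

lemma ramp_eq_0: "u \<le> 1 \<Longrightarrow> ramp u = 0"
  by (simp add: ramp_def)

lemma ramp_eq_1: "3 \<le> u \<Longrightarrow> ramp u = 1"
  by (simp add: ramp_def max_def power2_eq_square algebra_simps)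

lemma ramp_density_eq_0: "u \<le> 1 \<or> 3 \<le> u \<Longrightarrow> ramp_density u = 0"
  by (auto simp: ramp_density_def max_def)

lemma continuous_ramp_density: "continuous_on S ramp_density"
  unfolding ramp_density_def by (intro continuous_intros)

lemma abs_ramp_le: "\<bar>ramp u\<bar> \<le> 2"
proof -
  consider "u \<le> 1" | "3 \<le> u" | "1 \<le> u" "u \<le> 3" by linarith
  then show ?thesis
  proof cases
    case 3
    have "(max 0 (u - 1))\<^sup>2 \<le> 4" "(max 0 (u - 2))\<^sup>2 \<le> 1" "(max 0 (u - 3))\<^sup>2 = 0"
      using 3 power_mono[of "max 0 (u - 1)" 2 2] power_mono[of "max 0 (u - 2)" 1 2] by auto
    moreover have "0 \<le> (max 0 (u - 1))\<^sup>2" "0 \<le> (max 0 (u - 2))\<^sup>2" by auto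
    moreover have "\<bar>(a - 2 * b + c) / 2\<bar> \<le> 2" if "a \<le> 4" "b \<le> 1" "c = 0" "0 \<le> a" "0 \<le> b" for a b c :: real
      using that by (simp add: abs_le_iff)
    ultimately show ?thesis
      unfolding ramp_def by blast
  qed (auto simp: ramp_eq_0 ramp_eq_1)
qed

lemma ramp_density_integral: "has_bochner_integral lborel ramp_density 1"
proof -
  have "has_bochner_integral lborel (\<lambda>u. indicator {1..3} u *\<^sub>R ramp_density u) (ramp 3 - ramp 1)"
    by (rule has_bochner_integral_FTC_Icc)
      (auto simp: has_real_derivative_iff_has_vector_derivative[symmetric] continuous_ramp_density
        intro!: has_real_derivative_ramp[THEN has_field_derivative_at_within])
  moreover have "(\<lambda>u. indicator {1..3} u *\<^sub>R ramp_density u) = ramp_density"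
  proof
    show "indicator {1..3} u *\<^sub>R ramp_density u = ramp_density u" for u
      using ramp_density_eq_0[of u] by (cases "u \<in> {1..3}") auto
  qed
  ultimately show ?thesis
    by (simp add: ramp_eq_0 ramp_eq_1)
qed

text \<open>For large \<open>n\<close> the cutoff climbs to \<open>1\<close> between \<open>1/n\<close> and \<open>3/n\<close> and descends symmetrically before \<open>1\<close>. Written as a sum,
  its derivative is a difference of two rescaled hat functions.\<close>

definition time_cutoff :: "nat \<Rightarrow> real \<Rightarrow> real" where
  "time_cutoff n t = ramp (n * t) + ramp (n * (1 - t)) - 1"

definition time_cutoff_deriv :: "nat \<Rightarrow> real \<Rightarrow> real" where
  "time_cutoff_deriv n t = n * ramp_density (n * t) - n * ramp_density (n * (1 - t))"

lemma has_real_derivative_time_cutoff: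
  "(time_cutoff n has_real_derivative time_cutoff_deriv n t) (at t)"
  unfolding time_cutoff_def time_cutoff_deriv_def
  by (rule derivative_eq_intros DERIV_chain2[OF has_real_derivative_ramp] refl | simp)+

lemma continuous_time_cutoff_deriv: "continuous_on S (time_cutoff_deriv n)"
  unfolding time_cutoff_deriv_def
  by (intro continuous_intros continuous_on_compose2[OF continuous_ramp_density[of UNIV]]) auto

lemma continuous_time_cutoff: "continuous_on S (time_cutoff n)"
  by (meson DERIV_isCont continuous_at_imp_continuous_on has_real_derivative_time_cutoff)

lemma abs_time_cutoff_le: "\<bar>time_cutoff n t\<bar> \<le> 5"
  using abs_ramp_le[of "n * t"] abs_ramp_le[of "n * (1 - t)"] by (simp add: time_cutoff_def)

lemma time_cutoff_support:
  assumes "4 \<le> n" "time_cutoff n t \<noteq> 0" "0 < t" "t < 1"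
  shows "t \<in> {1 / n .. 1 - 1 / n}"
proof (rule ccontr)
  assume "t \<notin> {1 / n .. 1 - 1 / n}"
  then have "n * t < 1 \<or> n * (1 - t) < 1"
    using assms(1) by (auto simp: field_simps)
  moreover have "n * (1 - t) \<ge> 3" if "n * t < 1"
    using that assms(1) by (simp add: algebra_simps)
  moreover have "n * t \<ge> 3" if "n * (1 - t) < 1"
    using that assms(1) by (simp add: algebra_simps)
  ultimately have "time_cutoff n t = 0"
    by (auto simp: time_cutoff_def ramp_eq_0 ramp_eq_1)
  then show False using assms(2) by simp
qed

lemma tendsto_time_cutoff:
  assumes "0 < t" "t < 1"
  shows "(\<lambda>n. time_cutoff n t) \<longlonglongrightarrow> 1"
proof -
  have "\<forall>\<^sub>F n in sequentially. 3 / t \<le> real n" "\<forall>\<^sub>F n in sequentially. 3 / (1 - t) \<le> real n"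
    using filterlim_real_sequentially by (auto simp: filterlim_at_top)
  then have "\<forall>\<^sub>F n in sequentially. time_cutoff n t = 1"
    by eventually_elim (use assms in \<open>simp add: time_cutoff_def ramp_eq_1 field_simps\<close>)
  then show ?thesis
    by (rule tendsto_eventually)
qed

text \<open>The substitutions \<open>t = u/n\<close> and \<open>t = 1 - u/n\<close> turn the integral of each bump against \<open>p\<close> into the
  integral of the fixed hat function against \<open>p (u/n)\<close> or \<open>p (1 - u/n)\<close>.\<close>

lemma time_cutoff_deriv_concentrates:
  fixes p :: "real \<Rightarrow> real"
  assumes p: "continuous_on {0..1} p"
  shows "(\<lambda>n. LBINT t:{0<..<1}. time_cutoff_deriv n t * p t) \<longlonglongrightarrow> p 0 - p 1"
proof -
  \<comment> \<open>Constant extension of \<open>p\<close>, so that the substitutions may leave the unit interval.\<close>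
  define P where "P t = p (max 0 (min 1 t))" for t
  have P: "continuous_on UNIV P"
    unfolding P_def by (intro continuous_on_compose2[OF p] continuous_intros) auto
  then have P_isCont: "isCont P t" for t
    by (simp add: continuous_on_eq_continuous_at)
  have [measurable]: "P \<in> borel_measurable borel" "ramp_density \<in> borel_measurable borel"
    using P continuous_ramp_density by (auto intro: borel_measurable_continuous_onI)
  have "bounded (p ` {0..1})"
    using p by (intro compact_imp_bounded compact_continuous_image) auto
  then have "\<exists>B. \<forall>t\<in>{0..1}. \<bar>p t\<bar> \<le> B"
    by (auto simp: bounded_iff)
  then obtain B where B: "\<And>t. t \<in> {0..1} \<Longrightarrow> \<bar>p t\<bar> \<le> B"
    by blast
  have PB: "\<bar>P t\<bar> \<le> B" for t
    unfolding P_def by (intro B) auto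
  have bound: "norm (a * P t) \<le> norm (B * \<bar>a\<bar>)" for a t
    using mult_left_mono[of "\<bar>P t\<bar>" "\<bar>B\<bar>" "\<bar>a\<bar>"] PB[of t] by (simp add: abs_mult mult.commute)
  have w: "integrable lborel ramp_density" "(LBINT u. ramp_density u) = 1"
    using ramp_density_integral by (auto simp: has_bochner_integral_iff)
  have lim: "(\<lambda>n. LBINT u. ramp_density u * P (a + c n * u)) \<longlonglongrightarrow> P a"
    if c: "c \<longlonglongrightarrow> 0" for a and c :: "nat \<Rightarrow> real"
  proof -
    have "(\<lambda>n. LBINT u. ramp_density u * P (a + c n * u)) \<longlonglongrightarrow> (LBINT u. ramp_density u * P a)"
    proof (rule integral_dominated_convergence)
      show "integrable lborel (\<lambda>u. B * \<bar>ramp_density u\<bar>)"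
        using w by auto
      show "AE u in lborel. (\<lambda>n. ramp_density u * P (a + c n * u)) \<longlonglongrightarrow> ramp_density u * P a"
      proof (rule AE_I2)
        fix u
        have "(\<lambda>n. a + c n * u) \<longlonglongrightarrow> a + 0 * u"
          by (intro tendsto_intros c)
        then have "(\<lambda>n. P (a + c n * u)) \<longlonglongrightarrow> P a"
          using isCont_tendsto_compose[OF P_isCont] by fastforce
        then show "(\<lambda>n. ramp_density u * P (a + c n * u)) \<longlonglongrightarrow> ramp_density u * P a"
          by (intro tendsto_intros)
      qed
      show "AE u in lborel. norm (ramp_density u * P (a + c n * u)) \<le> B * \<bar>ramp_density u\<bar>" for n
        using bound[of "ramp_density u" for u] PB[of 0] by (simp add: abs_mult)
    qed measurable
    then show ?thesis
      using w by simp
  qed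
  have scale: "(LBINT t. n * ramp_density (n * t) * P t) = (LBINT u. ramp_density u * P (0 + (1 / n) * u))"
    "(LBINT t. n * ramp_density (n * (1 - t)) * P t) = (LBINT u. ramp_density u * P (1 + (- 1 / n) * u))"
    if "0 < n" for n :: nat
  proof -
    show "(LBINT t. n * ramp_density (n * t) * P t) = (LBINT u. ramp_density u * P (0 + (1 / n) * u))"
      using that by (subst lborel_integral_real_affine[of "1 / n" _ 0]) (auto simp: field_simps)
    show "(LBINT t. n * ramp_density (n * (1 - t)) * P t) = (LBINT u. ramp_density u * P (1 + (- 1 / n) * u))"
      using that by (subst lborel_integral_real_affine[of "- 1 / n" _ 1]) (auto simp: field_simps)
  qed
  have int: "integrable lborel (\<lambda>t. n * ramp_density (n * t) * P t)"
    "integrable lborel (\<lambda>t. n * ramp_density (n * (1 - t)) * P t)" if "0 < n" for n :: nat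
  proof -
    have "integrable lborel (\<lambda>t. n * ramp_density (0 + n * t))"
      using lborel_integrable_real_affine[OF w(1), of n 0] that by auto
    then have "integrable lborel (\<lambda>t. B * \<bar>n * ramp_density (n * t)\<bar>)"
      by auto
    then show "integrable lborel (\<lambda>t. n * ramp_density (n * t) * P t)"
      by (rule Bochner_Integration.integrable_bound)
        (measurable, intro AE_I2 bound)
    have "integrable lborel (\<lambda>t. n * ramp_density (n + (- n) * t))"
      using lborel_integrable_real_affine[OF w(1), of "- n" n] that by auto
    then have "integrable lborel (\<lambda>t. B * \<bar>n * ramp_density (n * (1 - t))\<bar>)"
      by (auto simp: algebra_simps)
    then show "integrable lborel (\<lambda>t. n * ramp_density (n * (1 - t)) * P t)"
      by (rule Bochner_Integration.integrable_bound)
        (measurable, intro AE_I2 bound)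
  qed
  have eq: "(LBINT t:{0<..<1}. time_cutoff_deriv n t * p t)
      = (LBINT u. ramp_density u * P (0 + (1 / n) * u)) - (LBINT u. ramp_density u * P (1 + (- 1 / n) * u))"
    if n: "3 \<le> n" for n :: nat
  proof -
    have "indicator {0<..<1} t *\<^sub>R (time_cutoff_deriv n t * p t)
        = n * ramp_density (n * t) * P t - n * ramp_density (n * (1 - t)) * P t" for t :: real
    proof (cases "t \<in> {0<..<1}")
      case True
      then show ?thesis by (simp add: time_cutoff_deriv_def P_def max_def min_def algebra_simps)
    next
      case False
      then have "real n * t \<le> 1 \<and> 3 \<le> n * (1 - t) \<or> 3 \<le> n * t \<and> n * (1 - t) \<le> 1"
      proof (cases "t \<le> 0")
        case True
        then have "real n * t \<le> 0" by (simp add: mult_nonneg_nonpos)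
        moreover have "3 \<le> real n" using n by simp
        ultimately show ?thesis by (simp only: right_diff_distrib mult_1_right) linarith
      next
        case t: False
        then have "real n * 1 \<le> real n * t"
          using False by (intro mult_left_mono) auto
        moreover have "3 \<le> real n" using n by simp
        ultimately show ?thesis by (simp only: right_diff_distrib mult_1_right) linarith
      qed
      then show ?thesis using False by (auto simp: ramp_density_eq_0)
    qed
    then have "(LBINT t:{0<..<1}. time_cutoff_deriv n t * p t)
        = (LBINT t. n * ramp_density (n * t) * P t - n * ramp_density (n * (1 - t)) * P t)"
      unfolding set_lebesgue_integral_def by (intro Bochner_Integration.integral_cong refl)
    also have "\<dots> = (LBINT t. n * ramp_density (n * t) * P t) - (LBINT t. n * ramp_density (n * (1 - t)) * P t)"
      using n by (intro Bochner_Integration.integral_diff int) auto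
    finally show ?thesis
      using n by (simp only: scale)
  qed
  have "(\<lambda>n. 1 / real n) \<longlonglongrightarrow> 0" "(\<lambda>n. - 1 / real n) \<longlonglongrightarrow> 0"
    using lim_1_over_n tendsto_minus[OF lim_1_over_n] by auto
  then have "(\<lambda>n. (LBINT u. ramp_density u * P (0 + (1 / real n) * u))
      - (LBINT u. ramp_density u * P (1 + (- 1 / real n) * u))) \<longlonglongrightarrow> P 0 - P 1"
    by (intro tendsto_diff lim)
  moreover have "P 0 - P 1 = p 0 - p 1"
    by (simp add: P_def)
  moreover have "\<forall>\<^sub>F n in sequentially. (LBINT u. ramp_density u * P (0 + (1 / real n) * u))
      - (LBINT u. ramp_density u * P (1 + (- 1 / real n) * u))
      = (LBINT t:{0<..<1}. time_cutoff_deriv n t * p t)"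
    using eventually_ge_at_top[of 3] by eventually_elim (simp only: eq)
  ultimately show ?thesis
    using Lim_transform_eventually by simp
qed

section \<open>Test functions of quadratic growth\<close>

lemma norm_matrix_vector_le:
  fixes A :: "real^'n^'m"
  shows "norm (A *v x) \<le> norm A * norm x"
proof -
  have "norm (A *v x) = L2_set (\<lambda>i. \<bar>A $ i \<bullet> x\<bar>) UNIV"
    by (simp add: norm_vec_def matrix_vector_mul_component)
  also have "\<dots> \<le> L2_set (\<lambda>i. norm (A $ i) * norm x) UNIV"
    by (intro L2_set_mono Cauchy_Schwarz_ineq2) auto
  also have "\<dots> = norm A * norm x"
    by (simp add: L2_set_right_distrib[symmetric] norm_vec_def[of A] L2_set_left_distrib)
  finally show ?thesis .
qed

lemma C2b_D:
  assumes "C2b \<phi> G H"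
  shows "(\<phi> has_derivative (\<lambda>h. G x \<bullet> h)) (at x)" "(G has_derivative (\<lambda>h. H x *v h)) (at x)"
    "continuous_on UNIV \<phi>" "continuous_on UNIV G" "continuous_on UNIV H"
    "\<exists>B>0. \<forall>x. norm (H x) \<le> B"
proof -
  show d: "(\<phi> has_derivative (\<lambda>h. G x \<bullet> h)) (at x)" "(G has_derivative (\<lambda>h. H x *v h)) (at x)" for x
    using assms by (auto simp: C2b_def)
  show "continuous_on UNIV \<phi>" "continuous_on UNIV G"
    using d by (auto intro!: continuous_at_imp_continuous_on has_derivative_continuous)
  show "continuous_on UNIV H"
    using assms by (simp add: C2b_def)
  show "\<exists>B>0. \<forall>x. norm (H x) \<le> B"
    using assms by (auto simp: C2b_def bounded_pos)
qed

lemma C2b_growth: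
  fixes \<phi> :: "real^'d \<Rightarrow> real"
  assumes C: "C2b \<phi> G H" and B: "\<And>x. norm (H x) \<le> B"
  shows "norm (G x) \<le> norm (G 0) + B * norm x"
    and "\<bar>\<phi> x\<bar> \<le> \<bar>\<phi> 0\<bar> + (norm (G 0) + B * norm x) * norm x"
proof -
  have "0 \<le> B" using B norm_ge_zero order_trans by blast
  show G: "norm (G x) \<le> norm (G 0) + B * norm x" for x
  proof -
    have "norm (G x - G 0) \<le> B * norm (x - 0)"
    proof (rule differentiable_bound[of UNIV])
      show "(G has_derivative (\<lambda>h. H y *v h)) (at y within UNIV)" for y
        using C2b_D(2)[OF C] by simp
      show "onorm (\<lambda>h. H y *v h) \<le> B" for y
        by (intro onorm_le order_trans[OF norm_matrix_vector_le] mult_right_mono B) auto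
    qed auto
    then show ?thesis
      using norm_triangle_ineq[of "G x - G 0" "G 0"] by simp
  qed
  have "norm (\<phi> x - \<phi> 0) \<le> (norm (G 0) + B * norm x) * norm (x - 0)"
  proof (rule differentiable_bound[of "cball 0 (norm x)"])
    show "(\<phi> has_derivative (\<lambda>h. G y \<bullet> h)) (at y within cball 0 (norm x))" for y
      using C2b_D(1)[OF C] has_derivative_at_withinI by blast
    show "onorm (\<lambda>h. G y \<bullet> h) \<le> norm (G 0) + B * norm x" if "y \<in> cball 0 (norm x)" for y
    proof (rule onorm_le)
      fix h
      have "norm (G y \<bullet> h) \<le> norm (G y) * norm h"
        using Cauchy_Schwarz_ineq2 by simp
      also have "\<dots> \<le> (norm (G 0) + B * norm x) * norm h"
        using G[of y] that mult_left_mono[of "norm y" "norm x" B] \<open>0 \<le> B\<close>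
        by (intro mult_right_mono) auto
      finally show "norm (G y \<bullet> h) \<le> (norm (G 0) + B * norm x) * norm h" .
    qed
  qed auto
  then show "\<bar>\<phi> x\<bar> \<le> \<bar>\<phi> 0\<bar> + (norm (G 0) + B * norm x) * norm x"
    by simp
qed

text \<open>Integrating a bounded Hessian twice gives linear growth of the gradient and quadratic growth.\<close>

lemma C2b_quadratic_bound:
  fixes \<phi> :: "real^'d \<Rightarrow> real"
  assumes "C2b \<phi> G H"
  obtains K where "0 < K" "\<And>x. \<bar>\<phi> x\<bar> \<le> K * (1 + (norm x)\<^sup>2)" "\<And>x. norm (G x) \<le> K * (1 + norm x)"
proof -
  obtain B where B: "0 < B" "\<And>x. norm (H x) \<le> B"
    using C2b_D(6)[OF assms] by blast
  define K where "K = \<bar>\<phi> 0\<bar> + norm (G 0) + B"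
  have "0 < K" using B(1) by (simp add: K_def add_nonneg_pos)
  moreover have "\<bar>\<phi> x\<bar> \<le> K * (1 + (norm x)\<^sup>2)" for x
  proof -
    define r where "r = norm x"
    have "0 \<le> r" by (simp add: r_def)
    moreover have "2 * r \<le> 1 + r\<^sup>2" using sum_squares_bound[of 1 r] by simp
    ultimately have r: "0 \<le> r" "r \<le> 1 + r\<^sup>2" by linarith+
    have "\<bar>\<phi> x\<bar> \<le> \<bar>\<phi> 0\<bar> + (norm (G 0) + B * r) * r"
      unfolding r_def by (rule C2b_growth(2)[OF assms B(2)])
    also have "\<dots> = \<bar>\<phi> 0\<bar> * 1 + norm (G 0) * r + B * r\<^sup>2"
      by (simp add: algebra_simps power2_eq_square)
    also have "\<dots> \<le> \<bar>\<phi> 0\<bar> * (1 + r\<^sup>2) + norm (G 0) * (1 + r\<^sup>2) + B * (1 + r\<^sup>2)"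
      using r B(1) by (intro add_mono mult_left_mono) auto
    also have "\<dots> = K * (1 + r\<^sup>2)"
      by (simp add: K_def algebra_simps)
    finally show ?thesis by (simp add: r_def)
  qed
  moreover have "norm (G x) \<le> K * (1 + norm x)" for x
  proof -
    have "norm (G x) \<le> norm (G 0) + B * norm x"
      by (rule C2b_growth(1)[OF assms B(2)])
    also have "\<dots> \<le> K * 1 + K * norm x"
      using B(1) by (intro add_mono mult_right_mono) (auto simp: K_def)
    finally show ?thesis by (simp add: algebra_simps)
  qed
  ultimately show ?thesis using that by blast
qed

lemma P2_D:
  assumes "\<mu> \<in> P2"
  shows "prob_space \<mu>" "sets \<mu> = sets borel" "space \<mu> = UNIV" "integrable \<mu> (\<lambda>x. (norm x)\<^sup>2)"
    "\<And>\<phi>. \<phi> \<in> borel_measurable borel \<Longrightarrow> \<phi> \<in> borel_measurable \<mu>"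
proof -
  show "prob_space \<mu>" and sets: "sets \<mu> = sets borel" and "integrable \<mu> (\<lambda>x. (norm x)\<^sup>2)"
    using assms by (auto simp: P2_def)
  show "space \<mu> = UNIV"
    using sets_eq_imp_space_eq[OF sets] by simp
  show "\<phi> \<in> borel_measurable \<mu>" if "\<phi> \<in> borel_measurable borel" for \<phi>
    using that measurable_cong_sets[OF sets refl] by blast
qed

lemma C2b_integrable:
  fixes \<phi> :: "real^'d \<Rightarrow> real"
  assumes "C2b \<phi> G H" "\<mu> \<in> P2"
  shows "integrable \<mu> \<phi>"
proof -
  interpret prob_space \<mu> by (rule P2_D(1)[OF assms(2)])
  obtain K where K: "\<And>x. \<bar>\<phi> x\<bar> \<le> K * (1 + (norm x)\<^sup>2)"
    using C2b_quadratic_bound[OF assms(1)] by metis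
  show ?thesis
  proof (rule Bochner_Integration.integrable_bound)
    show "integrable \<mu> (\<lambda>x. K * (1 + (norm x)\<^sup>2))"
      using P2_D(4)[OF assms(2)] by auto
    show "\<phi> \<in> borel_measurable \<mu>"
      by (intro P2_D(5)[OF assms(2)] borel_measurable_continuous_onI C2b_D(3)[OF assms(1)])
    show "AE x in \<mu>. norm (\<phi> x) \<le> norm (K * (1 + (norm x)\<^sup>2))"
      by (intro AE_I2, simp only: real_norm_def, rule order_trans[OF K abs_ge_self])
  qed
qed

definition outer :: "real^'d \<Rightarrow> real^'d^'d" where
  "outer a = (\<chi> i j. a $ i * a $ j)"

lemma outer_mult: "outer a *v h = (a \<bullet> h) *\<^sub>R a"
  by (simp add: vec_eq_iff outer_def matrix_vector_mult_def inner_vec_def sum_distrib_left mult_ac)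

lemma norm_outer: "norm (outer a) = (norm a)\<^sup>2"
proof -
  have "(norm (outer a))\<^sup>2 = (\<Sum>i\<in>UNIV. \<Sum>j\<in>UNIV. (a $ i * a $ i) * (a $ j * a $ j))"
    by (simp add: power2_norm_eq_inner inner_vec_def outer_def mult_ac)
  also have "\<dots> = (a \<bullet> a) * (a \<bullet> a)"
    by (simp add: inner_vec_def sum_product)
  also have "\<dots> = ((norm a)\<^sup>2)\<^sup>2"
    unfolding power2_norm_eq_inner power2_eq_square[of "a \<bullet> a"] ..
  finally show ?thesis
    by (metis norm_ge_zero power2_eq_imp_eq zero_le_power2)
qed

lemma continuous_on_outer: "continuous_on S G \<Longrightarrow> continuous_on S (\<lambda>x. outer (G x))"
  unfolding outer_def by (intro continuous_intros)

lemma inverse_square_derivative: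
  assumes "u \<noteq> (0::real)"
  shows "((\<lambda>u. 1 / u\<^sup>2) has_real_derivative - (2 / u ^ 3)) (at u)"
  using assms by (auto intro!: derivative_eq_intros simp: field_simps power2_eq_square power3_eq_cube)

text \<open>The composition with the bounded function \<open>s \<mapsto> s / (1 + \<epsilon> s)\<close> makes a test function bounded. Its
  Hessian stays bounded uniformly in \<open>\<epsilon>\<close> because the squared gradient is controlled by the
  function itself.\<close>

lemma C2b_bounded_truncation:
  fixes \<phi> :: "real^'d \<Rightarrow> real"
  assumes C: "C2b \<phi> G H" and pos: "\<And>x. 0 \<le> \<phi> x" and grad: "\<And>x. (norm (G x))\<^sup>2 \<le> c * \<phi> x"
    and B: "\<And>x. norm (H x) \<le> B" and e: "0 < \<epsilon>" and c: "0 \<le> c"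
  defines "\<psi> \<equiv> \<lambda>x. \<phi> x / (1 + \<epsilon> * \<phi> x)"
    and "G' \<equiv> \<lambda>x. (1 / (1 + \<epsilon> * \<phi> x)\<^sup>2) *\<^sub>R G x"
    and "H' \<equiv> \<lambda>x. (1 / (1 + \<epsilon> * \<phi> x)\<^sup>2) *\<^sub>R H x - (2 * \<epsilon> / (1 + \<epsilon> * \<phi> x) ^ 3) *\<^sub>R outer (G x)"
  shows "C2b \<psi> G' H'" and "0 \<le> \<psi> x" and "\<psi> x \<le> 1 / \<epsilon>" and "\<psi> x \<le> \<phi> x"
    and "norm (H' x) \<le> B + 2 * c"
proof -
  have ge1: "1 \<le> 1 + \<epsilon> * \<phi> x" for x using pos e by simp
  then have gt0: "0 < 1 + \<epsilon> * \<phi> x" for x by (meson less_le_trans zero_less_one)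
  then have ne: "1 + \<epsilon> * \<phi> x \<noteq> 0" for x by (metis less_irrefl)
  show "0 \<le> \<psi> x" using pos ge1[of x] by (simp add: \<psi>_def)
  show "\<psi> x \<le> 1 / \<epsilon>" using gt0[of x] e by (simp add: \<psi>_def field_simps)
  show "\<psi> x \<le> \<phi> x"
    using divide_left_mono[OF ge1[of x] pos[of x]] gt0[of x] by (simp add: \<psi>_def)
  show H'_le: "norm (H' x) \<le> B + 2 * c" for x
  proof -
    define u where "u = 1 + \<epsilon> * \<phi> x"
    have u: "1 \<le> u" using ge1 by (simp add: u_def)
    have "\<epsilon> * (norm (G x))\<^sup>2 \<le> \<epsilon> * (c * \<phi> x)"
      using grad[of x] e by (intro mult_left_mono) auto
    also have "\<dots> = c * (\<epsilon> * \<phi> x)" by (simp add: algebra_simps)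
    also have "\<dots> \<le> c * u ^ 3"
      using u c self_le_power[of u 3] by (intro mult_left_mono) (auto simp: u_def)
    finally have "2 * \<epsilon> / u ^ 3 * (norm (G x))\<^sup>2 \<le> 2 * c"
      using u by (simp add: field_simps)
    moreover have "norm ((1 / u\<^sup>2) *\<^sub>R H x) \<le> 1 * B"
      using u B[of x] by (simp only: norm_scaleR) (intro mult_mono, auto simp: divide_le_eq)
    moreover have "norm ((2 * \<epsilon> / u ^ 3) *\<^sub>R outer (G x)) = 2 * \<epsilon> / u ^ 3 * (norm (G x))\<^sup>2"
      using u e by (simp add: norm_outer)
    ultimately show ?thesis
      using norm_triangle_ineq4[of "(1 / u\<^sup>2) *\<^sub>R H x" "(2 * \<epsilon> / u ^ 3) *\<^sub>R outer (G x)"]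
      unfolding H'_def u_def by linarith
  qed
  show "C2b \<psi> G' H'"
    unfolding C2b_def
  proof (intro conjI allI)
    fix x
    show "(\<psi> has_derivative (\<lambda>h. G' x \<bullet> h)) (at x)"
      unfolding \<psi>_def
      by (rule has_derivative_eq_rhs, rule derivative_eq_intros C2b_D(1)[OF C] ne refl | simp add: ne)+
        (use ne[of x] in \<open>auto simp: G'_def fun_eq_iff field_simps power2_eq_square\<close>)
    have "((\<lambda>x. 1 / (1 + \<epsilon> * \<phi> x)\<^sup>2) has_derivative (\<lambda>h. - (2 * \<epsilon> / (1 + \<epsilon> * \<phi> x) ^ 3) * (G x \<bullet> h))) (at x)"
    proof -
      have "DERIV (\<lambda>u. 1 / u\<^sup>2) (1 + \<epsilon> * \<phi> x) :> - (2 / (1 + \<epsilon> * \<phi> x) ^ 3)"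
        using inverse_square_derivative[OF ne] .
      moreover have "((\<lambda>x. 1 + \<epsilon> * \<phi> x) has_derivative (\<lambda>h. \<epsilon> * (G x \<bullet> h))) (at x)"
        by (auto intro!: derivative_eq_intros C2b_D(1)[OF C])
      ultimately have "((\<lambda>x. 1 / (1 + \<epsilon> * \<phi> x)\<^sup>2) has_derivative
          (\<lambda>h. \<epsilon> * (G x \<bullet> h) * - (2 / (1 + \<epsilon> * \<phi> x) ^ 3))) (at x)"
        by (rule DERIV_compose_FDERIV)
      then show ?thesis
        by (rule has_derivative_eq_rhs) (simp add: fun_eq_iff)
    qed
    from has_derivative_scaleR[OF this C2b_D(2)[OF C]]
    show "(G' has_derivative (\<lambda>h. H' x *v h)) (at x)"
      unfolding G'_def
      by (rule has_derivative_eq_rhs)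
        (auto simp: fun_eq_iff H'_def matrix_vector_mult_diff_rdistrib outer_mult
          scaleR_matrix_vector_assoc[symmetric])
  next
    show "continuous_on UNIV H'"
      unfolding H'_def using ne C2b_D(3-5)[OF C]
      by (intro continuous_intros continuous_on_outer) auto
    show "bounded (range H')"
      using H'_le by (auto simp: bounded_iff)
  qed
qed


text \<open>The Hessians of the truncations are dominated by a constant and the truncations by \<open>\<phi>\<close> itself, which is
  integrable because the measures have second moments; both sides converge.\<close>

lemma static_identity_from_truncations:
  fixes \<phi> :: "real^'d \<Rightarrow> real"
  assumes \<Lambda>: "mat_measure borel \<Lambda>" and "\<mu> \<in> P2" "\<nu> \<in> P2"
    and bounded_case: "\<And>\<psi> G H. C2b \<psi> G H \<Longrightarrow> bounded (range \<psi>) \<Longrightarrow>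
      mat_integral (\<lambda>x. (1/2) *\<^sub>R H x) \<Lambda> = (\<integral>x. \<psi> x \<partial>\<nu>) - (\<integral>x. \<psi> x \<partial>\<mu>)"
    and C: "C2b \<phi> G H" and pos: "\<And>x. 0 \<le> \<phi> x" and grad: "\<And>x. (norm (G x))\<^sup>2 \<le> c * \<phi> x" "0 \<le> c"
  shows "mat_integral (\<lambda>x. (1/2) *\<^sub>R H x) \<Lambda> = (\<integral>x. \<phi> x \<partial>\<nu>) - (\<integral>x. \<phi> x \<partial>\<mu>)"
proof -
  obtain B where B: "\<And>x. norm (H x) \<le> B"
    using C2b_D(6)[OF C] by blast
  define \<epsilon> where "\<epsilon> n = 1 / real (Suc n)" for n
  have e: "0 < \<epsilon> n" for n by (simp add: \<epsilon>_def)
  have e0: "\<epsilon> \<longlonglongrightarrow> 0"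
    unfolding \<epsilon>_def using lim_1_over_n LIMSEQ_Suc by fastforce
  define \<psi> where "\<psi> n x = \<phi> x / (1 + \<epsilon> n * \<phi> x)" for n x
  define G' where "G' n x = (1 / (1 + \<epsilon> n * \<phi> x)\<^sup>2) *\<^sub>R G x" for n x
  define H' where "H' n x = (1 / (1 + \<epsilon> n * \<phi> x)\<^sup>2) *\<^sub>R H x
      - (2 * \<epsilon> n / (1 + \<epsilon> n * \<phi> x) ^ 3) *\<^sub>R outer (G x)" for n x
  note trunc = C2b_bounded_truncation[OF C pos grad(1) B e grad(2), folded \<psi>_def G'_def H'_def]
  have \<psi>: "C2b (\<psi> n) (G' n) (H' n)" "0 \<le> \<psi> n x" "\<psi> n x \<le> 1 / \<epsilon> n" "\<psi> n x \<le> \<phi> x"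
    "norm (H' n x) \<le> B + 2 * c" for n x
    using trunc[of n] by (simp_all add: \<psi>_def[abs_def] G'_def[abs_def] H'_def[abs_def])
  have "bounded (range (\<psi> n))" for n
    using \<psi>(2,3)[of n] by (auto simp: bounded_iff intro!: exI[of _ "1 / \<epsilon> n"])
  then have identity: "mat_integral (\<lambda>x. (1/2) *\<^sub>R H' n x) \<Lambda> = (\<integral>x. \<psi> n x \<partial>\<nu>) - (\<integral>x. \<psi> n x \<partial>\<mu>)" for n
    by (rule bounded_case[OF \<psi>(1)])
  have denom: "(\<lambda>n. 1 + \<epsilon> n * \<phi> x) \<longlonglongrightarrow> 1 + 0 * \<phi> x" for x
    by (intro tendsto_intros e0)
  have lim_\<psi>: "(\<lambda>n. \<psi> n x) \<longlonglongrightarrow> \<phi> x" for x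
    using tendsto_divide[OF tendsto_const[of "\<phi> x"] denom[of x]] by (simp add: \<psi>_def)
  have lim_H: "(\<lambda>n. H' n x) \<longlonglongrightarrow> H x" for x
  proof -
    have "(\<lambda>n. H' n x) \<longlonglongrightarrow> (1 / (1 + 0 * \<phi> x)\<^sup>2) *\<^sub>R H x
      - (2 * 0 / (1 + 0 * \<phi> x) ^ 3) *\<^sub>R outer (G x)"
      unfolding H'_def by (intro tendsto_intros denom e0) auto
    then show ?thesis by simp
  qed
  have lim: "(\<lambda>n. \<integral>x. \<psi> n x \<partial>\<rho>) \<longlonglongrightarrow> (\<integral>x. \<phi> x \<partial>\<rho>)" if "\<rho> \<in> P2" for \<rho>
  proof (rule integral_dominated_convergence)
    show int: "integrable \<rho> \<phi>"
      by (rule C2b_integrable[OF C that])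
    then show "\<phi> \<in> borel_measurable \<rho>" by auto
    show "\<psi> n \<in> borel_measurable \<rho>" for n
      using C2b_integrable[OF \<psi>(1) that] by auto
    show "AE x in \<rho>. (\<lambda>n. \<psi> n x) \<longlonglongrightarrow> \<phi> x"
      using lim_\<psi> by simp
    show "AE x in \<rho>. norm (\<psi> n x) \<le> \<phi> x" for n
      using \<psi>(2,4) by simp
  qed
  have "(\<lambda>n. mat_integral (\<lambda>x. (1/2) *\<^sub>R H' n x) \<Lambda>) \<longlonglongrightarrow> mat_integral (\<lambda>x. (1/2) *\<^sub>R H x) \<Lambda>"
  proof (rule mat_integral_dominated_convergence[OF \<Lambda>])
    show "(\<lambda>x. (1/2) *\<^sub>R H' n x) \<in> borel_measurable borel" for n
      by (intro borel_measurable_continuous_onI continuous_intros C2b_D(5)[OF \<psi>(1)])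
    show "(\<lambda>x. (1/2) *\<^sub>R H x) \<in> borel_measurable borel"
      by (intro borel_measurable_continuous_onI continuous_intros C2b_D(5)[OF C])
    show "(\<lambda>n. (1/2) *\<^sub>R H' n x) \<longlonglongrightarrow> (1/2) *\<^sub>R H x" for x
      by (intro tendsto_intros lim_H)
    show "norm ((1/2) *\<^sub>R H' n x) \<le> B + 2 * c" for n x
      by (rule order_trans[OF _ \<psi>(5)[of n x]]) simp
  qed
  moreover have "(\<lambda>n. mat_integral (\<lambda>x. (1/2) *\<^sub>R H' n x) \<Lambda>) \<longlonglongrightarrow> (\<integral>x. \<phi> x \<partial>\<nu>) - (\<integral>x. \<phi> x \<partial>\<mu>)"
    unfolding identity by (intro tendsto_diff lim assms)
  ultimately show ?thesis
    by (rule LIMSEQ_unique)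
qed

text \<open>Adding a large multiple of \<open>1 + |x|\<^sup>2\<close> makes an arbitrary test function nonnegative with squared
  gradient controlled by its values, so the truncation applies to both summands of the difference.\<close>

lemma static_equation_from_bounded_tests:
  fixes \<Lambda> :: "(real^'d) set \<Rightarrow> real^'d^'d"
  assumes \<Lambda>: "mat_measure borel \<Lambda>" and \<mu>\<nu>: "\<mu> \<in> P2" "\<nu> \<in> P2"
    and bounded_case: "\<And>\<psi> G H. C2b \<psi> G H \<Longrightarrow> bounded (range \<psi>) \<Longrightarrow>
      mat_integral (\<lambda>x. (1/2) *\<^sub>R H x) \<Lambda> = (\<integral>x. \<psi> x \<partial>\<nu>) - (\<integral>x. \<psi> x \<partial>\<mu>)"
  shows "static_equation \<Lambda> \<mu> \<nu>"
  unfolding static_equation_def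
proof (intro conjI allI impI)
  show "mat_measure borel \<Lambda>" by fact
  interpret V: finite_measure "variation borel \<Lambda>" by (rule finite_variation[OF \<Lambda>])
  show "emeasure (variation borel \<Lambda>) UNIV < \<infinity>"
    by (simp add: less_top[symmetric])
  fix \<phi> :: "real^'d \<Rightarrow> real" and G H assume C: "C2b \<phi> G H"
  obtain K where K: "0 < K" "\<And>x. \<bar>\<phi> x\<bar> \<le> K * (1 + (norm x)\<^sup>2)" "\<And>x. norm (G x) \<le> K * (1 + norm x)"
    using C2b_quadratic_bound[OF C] by blast
  obtain B where B: "\<And>x. norm (H x) \<le> B"
    using C2b_D(6)[OF C] by blast
  \<comment> \<open>With this factor \<open>\<phi> + q\<close> lies above \<open>1 + |x|\<^sup>2\<close>.\<close>
  define k where "k = K + 1"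
  define q where "q x = k * (1 + (norm x)\<^sup>2)" for x :: "real^'d"
  have k: "1 \<le> k" using K(1) by (simp add: k_def)
  have q': "q = (\<lambda>x. k * (1 + x \<bullet> x))" by (simp add: q_def fun_eq_iff power2_norm_eq_inner)
  have Cq: "C2b q (\<lambda>x. (2 * k) *\<^sub>R x) (\<lambda>x. mat (2 * k))"
    unfolding C2b_def q'
  proof (intro conjI allI)
    fix x :: "real^'d"
    show "((\<lambda>x. k * (1 + x \<bullet> x)) has_derivative (\<lambda>h. ((2 * k) *\<^sub>R x) \<bullet> h)) (at x)"
      by (rule has_derivative_eq_rhs, (rule derivative_eq_intros refl)+)
        (auto simp: fun_eq_iff inner_commute algebra_simps)
    have "mat (2 * k) *v h = (2 * k) *\<^sub>R h" for h :: "real^'d"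
      by (simp add: vec_eq_iff matrix_vector_mult_def mat_def if_distrib[of "\<lambda>z. z * _"] cong: if_cong)
    then show "((\<lambda>x. (2 * k) *\<^sub>R x) has_derivative (\<lambda>h. mat (2 * k) *v h)) (at x)"
      by (auto intro!: derivative_eq_intros)
  qed auto
  have grad_q: "(norm ((2 * k) *\<^sub>R x))\<^sup>2 \<le> (4 * k) * q x" for x :: "real^'d"
  proof -
    have "(norm ((2 * k) *\<^sub>R x))\<^sup>2 = (4 * k * k) * (norm x)\<^sup>2"
      by (simp add: power_mult_distrib power2_eq_square)
    also have "\<dots> \<le> (4 * k * k) * (1 + (norm x)\<^sup>2)"
      using k by (intro mult_left_mono) auto
    finally show ?thesis by (simp add: q_def algebra_simps)
  qed
  have q_nonneg: "0 \<le> q x" for x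
    using k by (simp add: q_def)
  define \<phi>' where "\<phi>' x = \<phi> x + q x" for x
  have C': "C2b \<phi>' (\<lambda>x. G x + (2 * k) *\<^sub>R x) (\<lambda>x. H x + mat (2 * k))"
  proof -
    obtain b where b: "\<And>x. norm (H x) \<le> b" using B by blast
    have "norm (H x + mat (2 * k)) \<le> b + norm (mat (2 * k) :: real^'d^'d)" for x
      using b[of x] norm_triangle_ineq[of "H x" "mat (2 * k)"] by linarith
    then have "bounded (range (\<lambda>x. H x + mat (2 * k)))"
      by (auto simp: bounded_iff)
    then show ?thesis
      unfolding C2b_def \<phi>'_def inner_add_left matrix_vector_mult_add_rdistrib
      by (intro conjI allI has_derivative_add C2b_D(1,2)[OF C] C2b_D(1,2)[OF Cq]
        continuous_intros C2b_D(5)[OF C])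
  qed
  have lower: "1 + (norm x)\<^sup>2 \<le> \<phi>' x" for x
    using K(2)[of x] by (simp add: \<phi>'_def q_def k_def algebra_simps abs_le_iff)
  have pos': "0 \<le> \<phi>' x" for x
    using lower[of x] zero_le_power2[of "norm x"] by linarith
  have grad': "(norm (G x + (2 * k) *\<^sub>R x))\<^sup>2 \<le> (2 * (3 * k)\<^sup>2) * \<phi>' x" for x
  proof -
    have "norm (G x + (2 * k) *\<^sub>R x) \<le> norm (G x) + norm ((2 * k) *\<^sub>R x)"
      by (rule norm_triangle_ineq)
    also have "\<dots> \<le> k * (1 + norm x) + 2 * k * (1 + norm x)"
    proof (rule add_mono)
      show "norm (G x) \<le> k * (1 + norm x)"
        by (rule order_trans[OF K(3)], rule mult_right_mono) (auto simp: k_def)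
      show "norm ((2 * k) *\<^sub>R x) \<le> 2 * k * (1 + norm x)"
        using k by (simp add: algebra_simps)
    qed
    also have "\<dots> = 3 * k * (1 + norm x)" by (simp add: algebra_simps)
    finally have "(norm (G x + (2 * k) *\<^sub>R x))\<^sup>2 \<le> (3 * k * (1 + norm x))\<^sup>2"
      by (intro power_mono) auto
    also have "\<dots> = (3 * k)\<^sup>2 * (1 + norm x)\<^sup>2"
      by (rule power_mult_distrib)
    also have "\<dots> \<le> (3 * k)\<^sup>2 * (2 * (1 + (norm x)\<^sup>2))"
      using sum_squares_bound[of 1 "norm x"] by (intro mult_left_mono) (auto simp: power2_sum)
    also have "\<dots> \<le> (3 * k)\<^sup>2 * (2 * \<phi>' x)"
      using lower[of x] by (intro mult_left_mono) auto
    finally show ?thesis by (simp add: algebra_simps)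
  qed
  note trunc = static_identity_from_truncations[OF \<Lambda> \<mu>\<nu> bounded_case]
  have id_q: "mat_integral (\<lambda>x. (1/2) *\<^sub>R mat (2 * k)) \<Lambda> = (\<integral>x. q x \<partial>\<nu>) - (\<integral>x. q x \<partial>\<mu>)"
    using k by (intro trunc[OF _ _ Cq q_nonneg grad_q]) auto
  have id': "mat_integral (\<lambda>x. (1/2) *\<^sub>R (H x + mat (2 * k))) \<Lambda> = (\<integral>x. \<phi>' x \<partial>\<nu>) - (\<integral>x. \<phi>' x \<partial>\<mu>)"
    by (intro trunc[OF _ _ C' pos' grad']) auto
  have "mat_integral (\<lambda>x. (1/2) *\<^sub>R (H x + mat (2 * k))) \<Lambda>
      = mat_integral (\<lambda>x. (1/2) *\<^sub>R H x) \<Lambda> + mat_integral (\<lambda>x. (1/2) *\<^sub>R mat (2 * k)) \<Lambda>"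
    unfolding scaleR_add_right
  proof (rule mat_integral_add[OF \<Lambda>])
    show "(\<lambda>x. (1/2) *\<^sub>R H x) \<in> borel_measurable borel"
      by (intro borel_measurable_continuous_onI continuous_intros C2b_D(5)[OF C])
    show "norm ((1/2) *\<^sub>R H x) \<le> B" for x
      by (rule order_trans[OF _ B[of x]]) simp
    show "norm ((1/2) *\<^sub>R mat (2 * k) :: real^'d^'d) \<le> norm ((1/2) *\<^sub>R mat (2 * k) :: real^'d^'d)"
      by simp
  qed simp
  moreover have "(\<integral>x. \<phi>' x \<partial>\<rho>) = (\<integral>x. \<phi> x \<partial>\<rho>) + (\<integral>x. q x \<partial>\<rho>)" if "\<rho> \<in> P2" for \<rho>
    unfolding \<phi>'_def using C2b_integrable[OF C that] C2b_integrable[OF Cq that]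
    by (rule Bochner_Integration.integral_add)
  ultimately show "mat_integral (\<lambda>x. (1/2) *\<^sub>R H x) \<Lambda> = (\<integral>x. \<phi> x \<partial>\<nu>) - (\<integral>x. \<phi> x \<partial>\<mu>)"
    using id_q id' \<mu>\<nu> by simp
qed

section \<open>Averaging a dynamic solution in time\<close>

abbreviation unit_time :: "real measure" where
  "unit_time \<equiv> restrict_space lborel {0<..<1}"

lemma unit_time_integral:
  fixes h :: "real \<Rightarrow> 'b::{banach, second_countable_topology}"
  shows "(LBINT t:{0<..<1}. h t) = (LINT t|unit_time. h t)"
    and "set_integrable lborel {0<..<1} h \<longleftrightarrow> integrable unit_time h"
  by (simp_all add: set_lebesgue_integral_def set_integrable_def integral_restrict_space
      integrable_restrict_space)

lemma unit_time_nn_integral: "(\<integral>\<^sup>+t\<in>{0<..<1}. h t \<partial>lborel) = (\<integral>\<^sup>+t. h t \<partial>unit_time)"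
  by (simp add: nn_integral_restrict_space)

lemma space_unit_time: "space unit_time = {0<..<1}"
  by (simp add: space_restrict_space)

lemma prob_space_unit_time: "prob_space unit_time"
  by (rule prob_space_restrict_space) auto

lemma unit_time_borel_measurable:
  "h \<in> borel_measurable (restrict_space borel {0<..<1}) \<Longrightarrow> h \<in> borel_measurable unit_time"
  using measurable_cong_sets[OF sets_restrict_space_cong[OF sets_lborel] refl] by blast

lemma strip_open: "open (strip :: (real \<times> (real^'d)) set)"
  unfolding strip_def by (intro open_Times) auto

lemma sets_strip_iff:
  "E \<in> sets (restrict_space borel (strip :: (real \<times> (real^'d)) set)) \<longleftrightarrow> E \<subseteq> strip \<and> E \<in> sets borel"
  using borel_open[OF strip_open] by (subst sets_restrict_space_iff) auto

lemma slab_in_sets_strip: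
  assumes "E \<in> sets borel"
  shows "{0<..<1} \<times> E \<in> sets (restrict_space borel (strip :: (real \<times> (real^'d)) set))"
  unfolding sets_strip_iff using assms borel_Times[of "{0<..<1::real}" E] by (auto simp: strip_def)

lemma time_average:
  fixes \<Lambda> :: "(real \<times> (real^'d)) set \<Rightarrow> real^'d^'d"
  assumes fp: "fokker_planck \<rho> \<Lambda> \<rho>t \<Lambda>t"
  defines "\<Lambda>' \<equiv> \<lambda>E. \<Lambda> ({0<..<1} \<times> E)"
  shows "mat_measure borel \<Lambda>'"
    and "\<And>t. t \<in> space unit_time \<Longrightarrow> mat_measure borel (\<Lambda>t t)"
    and "\<And>E. E \<in> sets borel \<Longrightarrow> integrable unit_time (\<lambda>t. \<Lambda>t t E)"
    and "\<And>E. E \<in> sets borel \<Longrightarrow> \<Lambda>' E = (LINT t|unit_time. \<Lambda>t t E)"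
proof -
  have \<Lambda>: "mat_measure (restrict_space borel strip) \<Lambda>" and dis: "mat_time_disintegration \<Lambda> \<Lambda>t"
    using fp by (auto simp: fokker_planck_def)
  show "mat_measure borel \<Lambda>'"
    unfolding mat_measure_def
  proof (intro conjI ballI allI impI)
    show "\<Lambda>' E \<in> nonneg_mats" if "E \<in> sets borel" for E
      using \<Lambda> slab_in_sets_strip[OF that] by (simp add: mat_measure_def \<Lambda>'_def)
    fix A :: "nat \<Rightarrow> (real^'d) set"
    assume A: "range A \<subseteq> sets borel" "disjoint_family A"
    have "range (\<lambda>n. {0<..<1} \<times> A n) \<subseteq> sets (restrict_space borel strip)"
      using A(1) slab_in_sets_strip by blast
    moreover have "disjoint_family (\<lambda>n. {0<..<1::real} \<times> A n)"
      using A(2) by (auto simp: disjoint_family_on_def)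
    ultimately have "(\<lambda>n. \<Lambda> ({0<..<1} \<times> A n)) sums \<Lambda> (\<Union>n. {0<..<1} \<times> A n)"
      using \<Lambda> unfolding mat_measure_def by blast
    moreover have "(\<Union>n. {0<..<1::real} \<times> A n) = {0<..<1} \<times> (\<Union>n. A n)"
      by auto
    ultimately show "(\<lambda>n. \<Lambda>' (A n)) sums \<Lambda>' (\<Union>n. A n)"
      by (simp add: \<Lambda>'_def)
  qed
  show "mat_measure borel (\<Lambda>t t)" if "t \<in> space unit_time" for t
    using dis that by (simp add: mat_time_disintegration_def space_unit_time)
  have slice: "\<Lambda>t t (Pair t -` ({0<..<1} \<times> E)) = \<Lambda>t t E" if "t \<in> space unit_time" for t E
    using that by (intro arg_cong[where f = "\<Lambda>t t"]) (auto simp: space_unit_time)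
  fix E :: "(real^'d) set" assume "E \<in> sets borel"
  note D = dis[unfolded mat_time_disintegration_def, THEN conjunct2, rule_format,
      OF slab_in_sets_strip[OF this], unfolded unit_time_integral]
  have "integrable unit_time (\<lambda>t. \<Lambda>t t (Pair t -` ({0<..<1} \<times> E))) \<longleftrightarrow> integrable unit_time (\<lambda>t. \<Lambda>t t E)"
    by (intro Bochner_Integration.integrable_cong refl slice)
  then show "integrable unit_time (\<lambda>t. \<Lambda>t t E)"
    using D by simp
  have "(LINT t|unit_time. \<Lambda>t t (Pair t -` ({0<..<1} \<times> E))) = (LINT t|unit_time. \<Lambda>t t E)"
    by (intro Bochner_Integration.integral_cong refl slice)
  then show "\<Lambda>' E = (LINT t|unit_time. \<Lambda>t t E)"
    unfolding \<Lambda>'_def using D by simp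
qed

lemma time_cutoff_test_function:
  fixes \<phi> :: "real^'d \<Rightarrow> real"
  assumes C: "C2b \<phi> G H" and bdd: "\<And>x. \<bar>\<phi> x\<bar> \<le> b" and n: "4 \<le> n"
  shows "C12b_supp (\<lambda>t x. time_cutoff n t * \<phi> x) (\<lambda>t x. time_cutoff_deriv n t * \<phi> x)
    (\<lambda>t x. time_cutoff n t *\<^sub>R G x) (\<lambda>t x. time_cutoff n t *\<^sub>R H x)"
  unfolding C12b_supp_def
proof (intro conjI ballI allI)
  fix t :: real and x
  show "((\<lambda>s. time_cutoff n s * \<phi> x) has_real_derivative time_cutoff_deriv n t * \<phi> x) (at t)"
    using DERIV_cmult_right[OF has_real_derivative_time_cutoff] .
  show "((\<lambda>x. time_cutoff n t * \<phi> x) has_derivative (\<lambda>h. (time_cutoff n t *\<^sub>R G x) \<bullet> h)) (at x)"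
    using has_derivative_mult_right[OF C2b_D(1)[OF C]] by simp
  show "((\<lambda>x. time_cutoff n t *\<^sub>R G x) has_derivative (\<lambda>h. (time_cutoff n t *\<^sub>R H x) *v h)) (at x)"
    using has_derivative_scaleR_right[OF C2b_D(2)[OF C]] by (simp add: scaleR_matrix_vector_assoc)
next
  have snd: "continuous_on strip (\<lambda>z. g (snd z))" if "continuous_on UNIV g" for g :: "_ \<Rightarrow> 'z::topological_space"
    by (rule continuous_on_compose2[OF that continuous_on_snd[OF continuous_on_id]]) auto
  have fst: "continuous_on strip (\<lambda>z. g (fst z))" if "continuous_on UNIV g" for g :: "_ \<Rightarrow> 'z::topological_space"
    by (rule continuous_on_compose2[OF that continuous_on_fst[OF continuous_on_id]]) auto
  show "continuous_on strip (\<lambda>(t, x). time_cutoff_deriv n t * \<phi> x)"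
    unfolding split_beta by (intro continuous_intros fst snd C2b_D(3)[OF C] continuous_time_cutoff_deriv)
  show "continuous_on strip (\<lambda>(t, x). time_cutoff n t *\<^sub>R G x)"
    unfolding split_beta by (intro continuous_intros fst snd C2b_D(4)[OF C] continuous_time_cutoff)
  show "continuous_on strip (\<lambda>(t, x). time_cutoff n t *\<^sub>R H x)"
    unfolding split_beta by (intro continuous_intros fst snd C2b_D(5)[OF C] continuous_time_cutoff)
  have "bounded (time_cutoff_deriv n ` {0..1})"
    by (intro compact_imp_bounded compact_continuous_image continuous_time_cutoff_deriv) simp
  then obtain a where a: "\<forall>t\<in>{0..1}. \<bar>time_cutoff_deriv n t\<bar> \<le> a"
    by (auto simp: bounded_iff)
  have "0 \<le> a"
    using a[rule_format, of 0] by (auto intro: order_trans[OF abs_ge_zero])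
  with a have "\<bar>time_cutoff_deriv n t * \<phi> x\<bar> \<le> a * b" if "t \<in> {0<..<1}" for t x
    unfolding abs_mult using that bdd[of x] by (intro mult_mono) auto
  then show "bounded ((\<lambda>(t, x). time_cutoff_deriv n t * \<phi> x) ` strip)"
    by (auto simp: bounded_iff strip_def intro!: exI[of _ "a * b"])
  obtain B where B: "\<And>x. norm (H x) \<le> B"
    using C2b_D(6)[OF C] by blast
  have "norm (time_cutoff n t *\<^sub>R H x) \<le> 5 * B" for t x
    unfolding norm_scaleR using abs_time_cutoff_le[of n t] B[of x] by (intro mult_mono) auto
  then show "bounded ((\<lambda>(t, x). time_cutoff n t *\<^sub>R H x) ` strip)"
    by (auto simp: bounded_iff simp del: norm_scaleR intro!: exI[of _ "5 * B"])
  have "closed ({1 / n .. 1 - 1 / n} \<times> (UNIV :: (real^'d) set))"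
    by (intro closed_Times) auto
  moreover have "{(t, x). (t, x) \<in> strip \<and> time_cutoff n t * \<phi> x \<noteq> 0} \<subseteq> {1 / n .. 1 - 1 / n} \<times> UNIV"
    using time_cutoff_support[OF n] by (auto simp: strip_def)
  ultimately have "closure {(t, x). (t, x) \<in> strip \<and> time_cutoff n t * \<phi> x \<noteq> 0}
      \<subseteq> {1 / n .. 1 - 1 / n} \<times> UNIV"
    by (intro closure_minimal)
  also have "\<dots> \<subseteq> strip"
  proof -
    have "0 < 1 / real n" using n by simp
    then have "{1 / n .. 1 - 1 / n} \<subseteq> {0<..<1}"
      unfolding subset_iff atLeastAtMost_iff greaterThanLessThan_iff by (intro allI impI conjI) linarith+
    then show ?thesis unfolding strip_def by (intro Sigma_mono) auto
  qed
  finally show "closure {(t, x). (t, x) \<in> strip \<and> time_cutoff n t * \<phi> x \<noteq> 0} \<subseteq> strip" .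
qed

text \<open>With the test function \<open>\<eta>\<^sub>n(t) \<phi>(x)\<close>, the left side of the equation concentrates at the endpoint values of
  \<open>t \<mapsto> \<integral> \<phi> d\<rho>\<^sub>t\<close>, while the right side converges by domination because \<open>\<eta>\<^sub>n\<close> is bounded.\<close>

lemma time_average_bounded_identity:
  fixes \<Lambda> :: "(real \<times> (real^'d)) set \<Rightarrow> real^'d^'d"
  assumes fp: "fokker_planck \<rho> \<Lambda> \<rho>t \<Lambda>t" and rep: "narrow_representative \<rho>t r"
    and C: "C2b \<phi> G H" and bdd: "bounded (range \<phi>)"
  shows "mat_integral (\<lambda>x. (1/2) *\<^sub>R H x) (\<lambda>E. \<Lambda> ({0<..<1} \<times> E))
    = (\<integral>x. \<phi> x \<partial>r 1) - (\<integral>x. \<phi> x \<partial>r 0)"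
proof -
  define \<Lambda>' where "\<Lambda>' E = \<Lambda> ({0<..<1} \<times> E)" for E
  note avg = time_average[OF fp, folded \<Lambda>'_def]
  obtain b where b: "\<And>x. \<bar>\<phi> x\<bar> \<le> b"
    using bdd by (auto simp: bounded_iff)
  obtain B where B: "\<And>x. norm (H x) \<le> B"
    using C2b_D(6)[OF C] by blast
  define p where "p t = (\<integral>x. \<phi> x \<partial>r t)" for t
  define a where "a t = mat_integral (\<lambda>x. (1/2) *\<^sub>R H x) (\<Lambda>t t)" for t
  have p: "continuous_on {0..1} p"
    using rep C2b_D(3)[OF C] bdd unfolding narrow_representative_def p_def by blast
  have dis: "time_disintegration \<rho> \<rho>t"
    using fp by (simp add: fokker_planck_def)
  have HB: "norm ((1/2) *\<^sub>R H x) \<le> B" for x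
    by (rule order_trans[OF _ B[of x]]) simp
  have "(\<lambda>x. (1/2) *\<^sub>R H x) \<in> borel_measurable borel"
    by (intro borel_measurable_continuous_onI continuous_intros C2b_D(5)[OF C])
  note a = mat_integral_time_average[OF this HB avg(2,1,3,4), folded a_def]
  have lhs: "(LBINT t:{0<..<1}. (\<integral>x. time_cutoff_deriv n t * \<phi> x \<partial>\<rho>t t))
      = (LBINT t:{0<..<1}. time_cutoff_deriv n t * p t)" for n
    unfolding unit_time_integral
  proof (rule integral_cong_AE)
    have deriv: "time_cutoff_deriv n \<in> borel_measurable unit_time"
      by (rule measurable_restrict_space1, simp, rule borel_measurable_continuous_onI,
          rule continuous_time_cutoff_deriv)
    have "(\<lambda>t. \<integral>x. \<phi> x \<partial>\<rho>t t) \<in> borel_measurable unit_time"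
    proof (rule integral_kernel_measurable[OF _ b])
      show "\<phi> \<in> borel_measurable borel"
        by (intro borel_measurable_continuous_onI C2b_D(3)[OF C])
      fix E :: "(real^'d) set" assume "E \<in> sets borel"
      then have "(\<lambda>t. emeasure (\<rho>t t) E) \<in> borel_measurable (restrict_space borel {0<..<1})"
        using dis by (simp add: time_disintegration_def)
      then show "(\<lambda>t. emeasure (\<rho>t t) E) \<in> borel_measurable unit_time"
        by (rule unit_time_borel_measurable)
    next
      fix t assume "t \<in> space unit_time"
      then have "t \<in> {0<..<1}" by (simp only: space_unit_time)
      with dis show "sets (\<rho>t t) = sets borel" "finite_measure (\<rho>t t)"
        unfolding time_disintegration_def by blast+
    qed
    with deriv show "(\<lambda>t. \<integral>x. time_cutoff_deriv n t * \<phi> x \<partial>\<rho>t t) \<in> borel_measurable unit_time"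
      unfolding integral_mult_right_zero by (rule borel_measurable_times)
    have "p \<in> borel_measurable (restrict_space borel {0<..<1})"
      by (rule borel_measurable_continuous_on_restrict, rule continuous_on_subset[OF p]) auto
    then have "p \<in> borel_measurable unit_time"
      by (rule unit_time_borel_measurable)
    with deriv show "(\<lambda>t. time_cutoff_deriv n t * p t) \<in> borel_measurable unit_time"
      by (rule borel_measurable_times)
    have "AE t in lborel. t \<in> {0<..<1} \<longrightarrow> \<rho>t t = r t"
      using rep by (simp add: narrow_representative_def)
    then have "AE t in unit_time. \<rho>t t = r t"
      using AE_restrict_space_iff[of "{0<..<1::real}" lborel "\<lambda>t. \<rho>t t = r t"] by simp
    then show "AE t in unit_time. (\<integral>x. time_cutoff_deriv n t * \<phi> x \<partial>\<rho>t t) = time_cutoff_deriv n t * p t"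
      by eventually_elim (simp add: p_def)
  qed
  have rhs: "(LBINT t:{0<..<1}. mat_integral (\<lambda>x. (1/2) *\<^sub>R (time_cutoff n t *\<^sub>R H x)) (\<Lambda>t t))
      = (LINT t|unit_time. time_cutoff n t * a t)" for n
  proof -
    have "(\<lambda>x. (1/2) *\<^sub>R (time_cutoff n t *\<^sub>R H x)) = (\<lambda>x. time_cutoff n t *\<^sub>R ((1/2) *\<^sub>R H x))" for t
      by (rule ext) (rule scaleR_left_commute)
    then show ?thesis
      unfolding unit_time_integral a_def by (simp only: mat_integral_scaleR)
  qed
  have "(LBINT t:{0<..<1}. time_cutoff_deriv n t * p t) = - (LINT t|unit_time. time_cutoff n t * a t)"
    if "4 \<le> n" for n
  proof -
    have "\<forall>\<phi> D G H. C12b_supp \<phi> D G H \<longrightarrow> (LBINT t:{0<..<1}. (\<integral>x. D t x \<partial>\<rho>t t)) =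
        - (LBINT t:{0<..<1}. mat_integral (\<lambda>x. (1/2) *\<^sub>R H t x) (\<Lambda>t t))"
      using fp unfolding fokker_planck_def by (elim conjE)
    from this[rule_format, OF time_cutoff_test_function[OF C b that]] show ?thesis
      by (simp only: lhs rhs)
  qed
  then have ev: "\<forall>\<^sub>F n in sequentially. (LBINT t:{0<..<1}. time_cutoff_deriv n t * p t)
      = - (LINT t|unit_time. time_cutoff n t * a t)"
    by (intro eventually_sequentiallyI[of 4])
  have "(\<lambda>n. LINT t|unit_time. time_cutoff n t * a t) \<longlonglongrightarrow> (LINT t|unit_time. 1 * a t)"
  proof (rule integral_dominated_convergence)
    show "integrable unit_time (\<lambda>t. 5 * \<bar>a t\<bar>)"
      by (intro integrable_mult_right integrable_abs a(1))
    have meas_a: "a \<in> borel_measurable unit_time"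
      by (rule borel_measurable_integrable[OF a(1)])
    then show "(\<lambda>t. 1 * a t) \<in> borel_measurable unit_time"
      by (simp only: mult_1_left)
    have "time_cutoff n \<in> borel_measurable unit_time" for n
      by (rule measurable_restrict_space1, simp, rule borel_measurable_continuous_onI,
          rule continuous_time_cutoff)
    then show "(\<lambda>t. time_cutoff n t * a t) \<in> borel_measurable unit_time" for n
      using meas_a by (rule borel_measurable_times)
    show "AE t in unit_time. (\<lambda>n. time_cutoff n t * a t) \<longlonglongrightarrow> 1 * a t"
    proof (rule AE_I2)
      fix t assume "t \<in> space unit_time"
      then have "0 < t" "t < 1" by (simp_all only: space_unit_time greaterThanLessThan_iff)
      then show "(\<lambda>n. time_cutoff n t * a t) \<longlonglongrightarrow> 1 * a t"
        by (intro tendsto_mult tendsto_const tendsto_time_cutoff)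
    qed
    show "AE t in unit_time. norm (time_cutoff n t * a t) \<le> 5 * \<bar>a t\<bar>" for n
      by (rule AE_I2, simp only: real_norm_def abs_mult, rule mult_right_mono[OF abs_time_cutoff_le abs_ge_zero])
  qed
  then have "(\<lambda>n. - (LINT t|unit_time. time_cutoff n t * a t)) \<longlonglongrightarrow> - mat_integral (\<lambda>x. (1/2) *\<^sub>R H x) \<Lambda>'"
    using a(2) by (simp only: mult_1_left tendsto_minus)
  moreover have "(\<lambda>n. - (LINT t|unit_time. time_cutoff n t * a t)) \<longlonglongrightarrow> p 0 - p 1"
    by (rule Lim_transform_eventually[OF time_cutoff_deriv_concentrates[OF p] ev])
  ultimately have "- mat_integral (\<lambda>x. (1/2) *\<^sub>R H x) \<Lambda>' = p 0 - p 1"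
    by (rule LIMSEQ_unique)
  then have "mat_integral (\<lambda>x. (1/2) *\<^sub>R H x) \<Lambda>' = p 1 - p 0"
    by linarith
  then show ?thesis
    unfolding p_def \<Lambda>'_def[abs_def] .
qed

proposition time_average_static_equation:
  fixes \<Lambda> :: "(real \<times> (real^'d)) set \<Rightarrow> real^'d^'d"
  assumes "fokker_planck \<rho> \<Lambda> \<rho>t \<Lambda>t" "narrow_representative \<rho>t r"
  shows "static_equation (\<lambda>E. \<Lambda> ({0<..<1} \<times> E)) (r 0) (r 1)"
proof (rule static_equation_from_bounded_tests)
  show "r 0 \<in> P2" "r 1 \<in> P2"
    using assms(2) by (auto simp: narrow_representative_def)
  show "mat_measure borel (\<lambda>E. \<Lambda> ({0<..<1} \<times> E))"
    by (rule time_average(1)[OF assms(1)])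
qed (rule time_average_bounded_identity[OF assms])

lemma time_average_cost:
  fixes \<Lambda> :: "(real \<times> (real^'d)) set \<Rightarrow> real^'d^'d"
  assumes "convex_on_sym f" "pos_homogeneous f" "lsc_on_sym f" and fp: "fokker_planck \<rho> \<Lambda> \<rho>t \<Lambda>t"
  shows "mat_cost f (\<lambda>E. \<Lambda> ({0<..<1} \<times> E)) \<le> (\<integral>\<^sup>+t\<in>{0<..<1}. mat_cost f (\<Lambda>t t) \<partial>lborel)"
  unfolding unit_time_nn_integral
  by (rule mat_cost_time_average_le[OF assms(1-3) time_average(2,1,3,4)[OF fp]])

section \<open>Mixtures of the endpoint measures\<close>

text \<open>The interpolation \<open>(1 - t) \<mu> + t \<nu>\<close>, as the law of a sample from \<open>\<nu>\<close> with probability \<open>t\<close> and from \<open>\<mu>\<close>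
  otherwise.\<close>

definition mixture :: "'a measure \<Rightarrow> 'a measure \<Rightarrow> real \<Rightarrow> 'a measure" where
  "mixture \<mu> \<nu> t = measure_pmf (bernoulli_pmf t) \<bind> (\<lambda>b. if b then \<nu> else \<mu>)"

lemma mixture_kernel:
  assumes "\<mu> \<in> P2" "\<nu> \<in> P2"
  shows "(\<lambda>b. if b then \<nu> else \<mu>) \<in> measurable (measure_pmf (bernoulli_pmf t)) (subprob_algebra borel)"
proof -
  have "\<nu> \<in> space (subprob_algebra borel)" "\<mu> \<in> space (subprob_algebra borel)"
    using P2_D(1,2)[OF assms(1)] P2_D(1,2)[OF assms(2)]
    by (auto simp: space_subprob_algebra intro: prob_space_imp_subprob_space)
  then show ?thesis
    by (auto simp: measurable_pmf_measure1)
qed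

lemma sets_mixture:
  assumes "\<mu> \<in> P2" "\<nu> \<in> P2"
  shows "sets (mixture \<mu> \<nu> t) = sets borel"
  unfolding mixture_def using P2_D(2)[OF assms(1)] P2_D(2)[OF assms(2)]
  by (intro sets_bind) auto

lemma nn_integral_mixture:
  assumes "\<mu> \<in> P2" "\<nu> \<in> P2" "t \<in> {0..1}" "h \<in> borel_measurable borel"
  shows "(\<integral>\<^sup>+x. h x \<partial>mixture \<mu> \<nu> t) = ennreal t * (\<integral>\<^sup>+x. h x \<partial>\<nu>) + ennreal (1 - t) * (\<integral>\<^sup>+x. h x \<partial>\<mu>)"
  unfolding mixture_def nn_integral_bind[OF assms(4) mixture_kernel[OF assms(1,2)]]
  using assms(3) by (subst nn_integral_bernoulli_pmf) (auto simp: mult.commute)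

lemma emeasure_mixture:
  assumes "\<mu> \<in> P2" "\<nu> \<in> P2" "t \<in> {0..1}" "E \<in> sets borel"
  shows "emeasure (mixture \<mu> \<nu> t) E = ennreal t * emeasure \<nu> E + ennreal (1 - t) * emeasure \<mu> E"
  using nn_integral_mixture[OF assms(1-3), of "indicator E"] assms(4)
  by (simp add: sets_mixture[OF assms(1,2)] P2_D(2)[OF assms(1)] P2_D(2)[OF assms(2)])

lemma prob_space_mixture:
  assumes "\<mu> \<in> P2" "\<nu> \<in> P2" "t \<in> {0..1}"
  shows "prob_space (mixture \<mu> \<nu> t)"
proof (rule prob_spaceI)
  have space: "space (mixture \<mu> \<nu> t) = UNIV"
    using sets_eq_imp_space_eq[OF sets_mixture[OF assms(1,2)]] by simp
  have "emeasure \<rho> UNIV = 1" if "\<rho> \<in> P2" for \<rho> :: "(real^'a) measure"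
    using prob_space.emeasure_space_1[OF P2_D(1)[OF that]] by (simp add: P2_D(3)[OF that])
  then show "emeasure (mixture \<mu> \<nu> t) (space (mixture \<mu> \<nu> t)) = 1"
    using assms unfolding space emeasure_mixture[OF assms, of UNIV, simplified]
    by (simp add: ennreal_plus[symmetric] del: ennreal_plus)
qed

lemma integral_mixture:
  fixes h :: "real^'d \<Rightarrow> real"
  assumes "\<mu> \<in> P2" "\<nu> \<in> P2" "t \<in> {0..1}" "h \<in> borel_measurable borel"
    and int: "integrable \<mu> h" "integrable \<nu> h"
  shows "integrable (mixture \<mu> \<nu> t) h"
    and "(\<integral>x. h x \<partial>mixture \<mu> \<nu> t) = t * (\<integral>x. h x \<partial>\<nu>) + (1 - t) * (\<integral>x. h x \<partial>\<mu>)"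
proof -
  have t: "0 \<le> t" "0 \<le> 1 - t" using assms(3) by auto
  have meas: "h \<in> borel_measurable (mixture \<mu> \<nu> t)"
    using assms(4) measurable_cong_sets[OF sets_mixture[OF assms(1,2)] refl] by blast
  have nn: "(\<integral>\<^sup>+x. ennreal (k x) \<partial>mixture \<mu> \<nu> t) = ennreal (t * (\<integral>x. k x \<partial>\<nu>) + (1 - t) * (\<integral>x. k x \<partial>\<mu>))"
    if "k \<in> borel_measurable borel" "integrable \<mu> k" "integrable \<nu> k" "\<And>x. 0 \<le> k x" for k
  proof -
    have "(\<integral>\<^sup>+x. ennreal (k x) \<partial>mixture \<mu> \<nu> t)
        = ennreal t * (\<integral>\<^sup>+x. ennreal (k x) \<partial>\<nu>) + ennreal (1 - t) * (\<integral>\<^sup>+x. ennreal (k x) \<partial>\<mu>)"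
      using that(1) by (intro nn_integral_mixture assms measurable_compose[OF _ measurable_ennreal])
    also have "\<dots> = ennreal t * ennreal (\<integral>x. k x \<partial>\<nu>) + ennreal (1 - t) * ennreal (\<integral>x. k x \<partial>\<mu>)"
      using that by (simp add: nn_integral_eq_integral)
    also have "\<dots> = ennreal (t * (\<integral>x. k x \<partial>\<nu>) + (1 - t) * (\<integral>x. k x \<partial>\<mu>))"
      using t that(4) by (simp add: ennreal_mult)
    finally show ?thesis .
  qed
  have "(\<integral>\<^sup>+x. ennreal (norm (h x)) \<partial>mixture \<mu> \<nu> t) < \<infinity>"
    using assms(4) int by (subst nn) (auto simp: less_top[symmetric])
  then show int_mix: "integrable (mixture \<mu> \<nu> t) h"
    using meas by (intro integrableI_bounded)
  have part: "enn2real (\<integral>\<^sup>+x. ennreal (k x) \<partial>mixture \<mu> \<nu> t) = t * (\<integral>x. max 0 (k x) \<partial>\<nu>) + (1 - t) * (\<integral>x. max 0 (k x) \<partial>\<mu>)"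
    if "k \<in> borel_measurable borel" "integrable \<mu> k" "integrable \<nu> k" for k
  proof -
    have "(\<integral>\<^sup>+x. ennreal (k x) \<partial>mixture \<mu> \<nu> t) = (\<integral>\<^sup>+x. ennreal (max 0 (k x)) \<partial>mixture \<mu> \<nu> t)"
      by (intro nn_integral_cong) (auto simp: max_def ennreal_neg)
    also have "\<dots> = ennreal (t * (\<integral>x. max 0 (k x) \<partial>\<nu>) + (1 - t) * (\<integral>x. max 0 (k x) \<partial>\<mu>))"
      using that by (intro nn) auto
    finally show ?thesis
      using t by (simp del: ennreal_plus add: integral_nonneg_AE)
  qed
  have split: "(\<integral>x. h x \<partial>\<rho>) = (\<integral>x. max 0 (h x) \<partial>\<rho>) - (\<integral>x. max 0 (- h x) \<partial>\<rho>)"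
    if "integrable \<rho> h" for \<rho>
  proof -
    have "(\<integral>x. h x \<partial>\<rho>) = (\<integral>x. max 0 (h x) - max 0 (- h x) \<partial>\<rho>)"
      by (intro Bochner_Integration.integral_cong) auto
    also have "\<dots> = (\<integral>x. max 0 (h x) \<partial>\<rho>) - (\<integral>x. max 0 (- h x) \<partial>\<rho>)"
      using that by (intro Bochner_Integration.integral_diff integrable_max) auto
    finally show ?thesis .
  qed
  show "(\<integral>x. h x \<partial>mixture \<mu> \<nu> t) = t * (\<integral>x. h x \<partial>\<nu>) + (1 - t) * (\<integral>x. h x \<partial>\<mu>)"
    unfolding real_lebesgue_integral_def[OF int_mix] split[OF int(1)] split[OF int(2)]
    using assms(4) int by (simp add: part algebra_simps)
qed

lemma mixture_P2:
  assumes "\<mu> \<in> P2" "\<nu> \<in> P2" "t \<in> {0..1}"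
  shows "mixture \<mu> \<nu> t \<in> P2"
  using sets_mixture[OF assms(1,2)] prob_space_mixture[OF assms]
    integral_mixture(1)[OF assms _ P2_D(4)[OF assms(1)] P2_D(4)[OF assms(2)]]
  by (auto simp: P2_def)

lemma mixture_endpoints:
  assumes "\<mu> \<in> P2" "\<nu> \<in> P2"
  shows "mixture \<mu> \<nu> 0 = \<mu>" "mixture \<mu> \<nu> 1 = \<nu>"
  by (rule measure_eqI;
      simp add: sets_mixture[OF assms] emeasure_mixture[OF assms] P2_D(2)[OF assms(1)] P2_D(2)[OF assms(2)])+

lemma narrow_representative_mixture:
  assumes "\<mu> \<in> P2" "\<nu> \<in> P2"
  shows "narrow_representative (mixture \<mu> \<nu>) (mixture \<mu> \<nu>)"
  unfolding narrow_representative_def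
proof (intro conjI ballI allI impI)
  show "mixture \<mu> \<nu> t \<in> P2" if "t \<in> {0..1}" for t
    by (rule mixture_P2[OF assms that])
  fix h :: "real^'a \<Rightarrow> real" assume h: "continuous_on UNIV h" "bounded (range h)"
  then obtain b where b: "\<And>x. norm (h x) \<le> b"
    by (auto simp: bounded_iff)
  have meas: "h \<in> borel_measurable borel"
    by (rule borel_measurable_continuous_onI[OF h(1)])
  have int: "integrable \<rho> h" if "\<rho> \<in> P2" for \<rho>
  proof -
    interpret prob_space \<rho> by (rule P2_D(1)[OF that])
    show ?thesis
      by (rule integrable_const_bound[OF AE_I2[OF b] P2_D(5)[OF that meas]])
  qed
  have "continuous_on {0..1} (\<lambda>t. t * (\<integral>x. h x \<partial>\<nu>) + (1 - t) * (\<integral>x. h x \<partial>\<mu>))"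
    by (intro continuous_intros)
  then show "continuous_on {0..1} (\<lambda>t. \<integral>x. h x \<partial>mixture \<mu> \<nu> t)"
    by (subst continuous_on_cong[OF refl integral_mixture(2)[OF assms _ meas int int]]) (auto simp: assms)
qed auto

definition mixture_path :: "(real^'d) measure \<Rightarrow> (real^'d) measure \<Rightarrow> (real \<times> (real^'d)) measure" where
  "mixture_path \<mu> \<nu> = unit_time \<bind> (\<lambda>t. distr (mixture \<mu> \<nu> t) (restrict_space borel strip) (Pair t))"

lemma borel_measurable_emeasure_slice:
  fixes \<mu> :: "(real^'d) measure" and E :: "(real \<times> (real^'d)) set"
  assumes "\<mu> \<in> P2" "E \<in> sets borel"
  shows "(\<lambda>t. emeasure \<mu> (Pair t -` E)) \<in> borel_measurable borel"
proof -
  interpret prob_space \<mu> by (rule P2_D(1)[OF assms(1)])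
  have "sets (borel \<Otimes>\<^sub>M \<mu>) = sets (borel :: (real \<times> (real^'d)) measure)"
    unfolding borel_prod[symmetric] by (rule sets_pair_measure_cong[OF refl P2_D(2)[OF assms(1)]])
  then show ?thesis
    using assms(2) by (intro measurable_emeasure_Pair) simp
qed

lemma slice_in_borel:
  fixes E :: "(real \<times> (real^'d)) set"
  assumes "E \<in> sets borel"
  shows "Pair t -` E \<in> sets borel"
proof -
  have "E \<in> sets (borel \<Otimes>\<^sub>M borel)"
    using assms unfolding borel_prod .
  then show ?thesis by (rule sets_Pair1)
qed

lemma measurable_Pair_strip:
  assumes "t \<in> space unit_time" "sets \<mu> = sets (borel :: (real^'d) measure)"
  shows "Pair t \<in> measurable \<mu> (restrict_space borel (strip :: (real \<times> (real^'d)) set))"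
proof (rule measurable_restrict_space2)
  show "Pair t \<in> space \<mu> \<rightarrow> strip"
    using assms by (auto simp: strip_def space_unit_time)
  have "Pair t \<in> measurable borel (borel \<Otimes>\<^sub>M (borel :: (real^'d) measure))"
    by measurable
  then have "Pair t \<in> measurable borel (borel :: (real \<times> (real^'d)) measure)"
    unfolding borel_prod .
  then show "Pair t \<in> borel_measurable \<mu>"
    using measurable_cong_sets[OF assms(2) refl] by blast
qed

lemma mixture_path_kernel:
  fixes \<mu> \<nu> :: "(real^'d) measure"
  assumes "\<mu> \<in> P2" "\<nu> \<in> P2"
  shows "(\<lambda>t. distr (mixture \<mu> \<nu> t) (restrict_space borel strip) (Pair t))
    \<in> measurable unit_time (subprob_algebra (restrict_space borel strip))"
    and "\<And>t E. t \<in> space unit_time \<Longrightarrow> E \<in> sets (restrict_space borel strip) \<Longrightarrow>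
      emeasure (distr (mixture \<mu> \<nu> t) (restrict_space borel strip) (Pair t)) E
        = emeasure (mixture \<mu> \<nu> t) (Pair t -` E)"
proof -
  have meas: "Pair t \<in> measurable (mixture \<mu> \<nu> t) (restrict_space borel strip)"
    if "t \<in> space unit_time" for t
    by (rule measurable_Pair_strip[OF that sets_mixture[OF assms]])
  have space: "space (mixture \<mu> \<nu> t) = UNIV" for t
    using sets_eq_imp_space_eq[OF sets_mixture[OF assms]] by simp
  show em: "emeasure (distr (mixture \<mu> \<nu> t) (restrict_space borel strip) (Pair t)) E
        = emeasure (mixture \<mu> \<nu> t) (Pair t -` E)"
    if "t \<in> space unit_time" "E \<in> sets (restrict_space borel strip)" for t E
    using emeasure_distr[OF meas[OF that(1)] that(2)] by (simp add: space)
  show "(\<lambda>t. distr (mixture \<mu> \<nu> t) (restrict_space borel strip) (Pair t))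
    \<in> measurable unit_time (subprob_algebra (restrict_space borel strip))"
  proof (rule measurable_subprob_algebra)
    fix t assume t: "t \<in> space unit_time"
    then have "t \<in> {0..1}" by (simp add: space_unit_time)
    interpret prob_space "mixture \<mu> \<nu> t"
      by (rule prob_space_mixture[OF assms \<open>t \<in> {0..1}\<close>])
    show "subprob_space (distr (mixture \<mu> \<nu> t) (restrict_space borel strip) (Pair t))"
      by (intro prob_space_imp_subprob_space prob_space_distr meas t)
  next
    fix E :: "(real \<times> (real^'d)) set" assume E: "E \<in> sets (restrict_space borel strip)"
    then have E': "E \<in> sets borel" by (simp add: sets_strip_iff)
    have "(\<lambda>t. ennreal t * emeasure \<nu> (Pair t -` E) + ennreal (1 - t) * emeasure \<mu> (Pair t -` E))
        \<in> borel_measurable borel"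
      using borel_measurable_emeasure_slice[OF assms(1) E'] borel_measurable_emeasure_slice[OF assms(2) E']
      by measurable
    then have "(\<lambda>t. ennreal t * emeasure \<nu> (Pair t -` E) + ennreal (1 - t) * emeasure \<mu> (Pair t -` E))
        \<in> borel_measurable unit_time"
      by (intro unit_time_borel_measurable measurable_restrict_space1)
    moreover have "emeasure (distr (mixture \<mu> \<nu> t) (restrict_space borel strip) (Pair t)) E
        = ennreal t * emeasure \<nu> (Pair t -` E) + ennreal (1 - t) * emeasure \<mu> (Pair t -` E)"
      if "t \<in> space unit_time" for t
      using that unfolding em[OF that E]
      by (intro emeasure_mixture[OF assms] slice_in_borel E') (simp add: space_unit_time)
    ultimately show "(\<lambda>t. emeasure (distr (mixture \<mu> \<nu> t) (restrict_space borel strip) (Pair t)) E)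
        \<in> borel_measurable unit_time"
      by (subst measurable_cong)
  qed simp
qed

lemma mixture_path_disintegration:
  fixes \<mu> \<nu> :: "(real^'d) measure"
  assumes "\<mu> \<in> P2" "\<nu> \<in> P2"
  shows "time_disintegration (mixture_path \<mu> \<nu>) (mixture \<mu> \<nu>)"
  unfolding time_disintegration_def
proof (intro conjI ballI)
  fix t :: real assume "t \<in> {0<..<1}"
  then have t: "t \<in> {0..1}" by simp
  show "sets (mixture \<mu> \<nu> t) = sets borel"
    by (rule sets_mixture[OF assms])
  show "finite_measure (mixture \<mu> \<nu> t)"
    by (rule prob_space.finite_measure[OF prob_space_mixture[OF assms t]])
next
  fix E :: "(real^'d) set" assume E: "E \<in> sets borel"
  have "(\<lambda>t. ennreal t * emeasure \<nu> E + ennreal (1 - t) * emeasure \<mu> E) \<in> borel_measurable borel"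
    by measurable
  then have "(\<lambda>t. ennreal t * emeasure \<nu> E + ennreal (1 - t) * emeasure \<mu> E)
      \<in> borel_measurable (restrict_space borel {0<..<1})"
    by (rule measurable_restrict_space1)
  then show "(\<lambda>t. emeasure (mixture \<mu> \<nu> t) E) \<in> borel_measurable (restrict_space borel {0<..<1})"
    by (subst measurable_cong[OF emeasure_mixture[OF assms _ E]]) (auto simp: space_restrict_space)
next
  fix E :: "(real \<times> (real^'d)) set" assume E: "E \<in> sets (restrict_space borel strip)"
  have "emeasure (mixture_path \<mu> \<nu>) E
      = (\<integral>\<^sup>+t. emeasure (distr (mixture \<mu> \<nu> t) (restrict_space borel strip) (Pair t)) E \<partial>unit_time)"
    unfolding mixture_path_def
    by (rule emeasure_bind[OF _ mixture_path_kernel(1)[OF assms] E]) (simp add: space_unit_time)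
  also have "\<dots> = (\<integral>\<^sup>+t. emeasure (mixture \<mu> \<nu> t) (Pair t -` E) \<partial>unit_time)"
    by (intro nn_integral_cong mixture_path_kernel(2)[OF assms _ E])
  finally show "emeasure (mixture_path \<mu> \<nu>) E = (\<integral>\<^sup>+t\<in>{0<..<1}. emeasure (mixture \<mu> \<nu> t) (Pair t -` E) \<partial>lborel)"
    unfolding unit_time_nn_integral .
qed

lemma mixture_path_P2_strip:
  fixes \<mu> \<nu> :: "(real^'d) measure"
  assumes "\<mu> \<in> P2" "\<nu> \<in> P2"
  shows "mixture_path \<mu> \<nu> \<in> P2_strip"
proof -
  let ?S = "restrict_space borel (strip :: (real \<times> (real^'d)) set)"
  interpret T: prob_space unit_time by (rule prob_space_unit_time)
  have sets: "sets (mixture_path \<mu> \<nu>) = sets ?S"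
    unfolding mixture_path_def by (rule sets_bind) (auto simp: space_unit_time)
  have prob: "prob_space (mixture_path \<mu> \<nu>)"
    unfolding mixture_path_def
  proof (rule T.prob_space_bind[OF _ mixture_path_kernel(1)[OF assms]], rule AE_I2)
    fix t assume t: "t \<in> space unit_time"
    then have "t \<in> {0..1}" by (simp add: space_unit_time)
    interpret prob_space "mixture \<mu> \<nu> t"
      by (rule prob_space_mixture[OF assms \<open>t \<in> {0..1}\<close>])
    show "prob_space (distr (mixture \<mu> \<nu> t) ?S (Pair t))"
      by (intro prob_space_distr measurable_Pair_strip t sets_mixture assms)
  qed
  define h :: "real \<times> (real^'d) \<Rightarrow> real" where "h = (\<lambda>(t, x). (norm x)\<^sup>2)"
  have h: "h \<in> borel_measurable borel"
    unfolding h_def split_beta by (intro borel_measurable_continuous_onI continuous_intros)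
  then have h_S: "h \<in> borel_measurable ?S"
    by (rule measurable_restrict_space1)
  have "(\<integral>\<^sup>+z. ennreal (h z) \<partial>mixture_path \<mu> \<nu>)
      = (\<integral>\<^sup>+t. \<integral>\<^sup>+z. ennreal (h z) \<partial>distr (mixture \<mu> \<nu> t) ?S (Pair t) \<partial>unit_time)"
    unfolding mixture_path_def
    by (rule nn_integral_bind[OF measurable_compose[OF h_S measurable_ennreal] mixture_path_kernel(1)[OF assms]])
  also have "\<dots> \<le> (\<integral>\<^sup>+t. (\<integral>\<^sup>+x. ennreal ((norm x)\<^sup>2) \<partial>\<nu>) + (\<integral>\<^sup>+x. ennreal ((norm x)\<^sup>2) \<partial>\<mu>) \<partial>unit_time)"
  proof (rule nn_integral_mono)
    fix t assume t: "t \<in> space unit_time"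
    then have t': "t \<in> {0..1}" by (simp add: space_unit_time)
    have "(\<integral>\<^sup>+z. ennreal (h z) \<partial>distr (mixture \<mu> \<nu> t) ?S (Pair t)) = (\<integral>\<^sup>+x. ennreal ((norm x)\<^sup>2) \<partial>mixture \<mu> \<nu> t)"
      using h_S by (subst nn_integral_distr[OF measurable_Pair_strip[OF t sets_mixture[OF assms]]])
        (auto simp: h_def intro: measurable_compose[OF _ measurable_ennreal])
    also have "\<dots> = ennreal t * (\<integral>\<^sup>+x. ennreal ((norm x)\<^sup>2) \<partial>\<nu>) + ennreal (1 - t) * (\<integral>\<^sup>+x. ennreal ((norm x)\<^sup>2) \<partial>\<mu>)"
      by (rule nn_integral_mixture[OF assms t']) measurable
    also have "\<dots> \<le> 1 * (\<integral>\<^sup>+x. ennreal ((norm x)\<^sup>2) \<partial>\<nu>) + 1 * (\<integral>\<^sup>+x. ennreal ((norm x)\<^sup>2) \<partial>\<mu>)"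
      using t' by (intro add_mono mult_right_mono) (auto simp: ennreal_le_1)
    finally show "(\<integral>\<^sup>+z. ennreal (h z) \<partial>distr (mixture \<mu> \<nu> t) ?S (Pair t))
        \<le> (\<integral>\<^sup>+x. ennreal ((norm x)\<^sup>2) \<partial>\<nu>) + (\<integral>\<^sup>+x. ennreal ((norm x)\<^sup>2) \<partial>\<mu>)"
      by simp
  qed
  also have "\<dots> = (\<integral>\<^sup>+x. ennreal ((norm x)\<^sup>2) \<partial>\<nu>) + (\<integral>\<^sup>+x. ennreal ((norm x)\<^sup>2) \<partial>\<mu>)"
    using T.emeasure_space_1 by simp
  also have "\<dots> < \<infinity>"
    using P2_D(4)[OF assms(1)] P2_D(4)[OF assms(2)]
    by (simp add: nn_integral_eq_integral)
  finally have "(\<integral>\<^sup>+z. ennreal (norm (h z)) \<partial>mixture_path \<mu> \<nu>) < \<infinity>"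
    by (simp add: h_def split_beta)
  moreover have "h \<in> borel_measurable (mixture_path \<mu> \<nu>)"
    using h_S measurable_cong_sets[OF sets refl] by blast
  ultimately have "integrable (mixture_path \<mu> \<nu>) h"
    by (intro integrableI_bounded)
  then show ?thesis
    using sets prob by (simp add: P2_strip_def h_def)
qed

section \<open>A matrix measure that is constant in time\<close>

text \<open>Symmetry and nonnegativity of \<open>v \<bullet> A v\<close> are conditions on linear images of the matrix, which commute
  with the integral.\<close>

lemma integral_in_nonneg_mats:
  fixes X :: "'t \<Rightarrow> real^'d^'d"
  assumes int: "integrable M X" and X: "\<And>t. t \<in> space M \<Longrightarrow> X t \<in> nonneg_mats"
  shows "(LINT t|M. X t) \<in> nonneg_mats"
proof -
  have "bounded_linear (transpose :: real^'d^'d \<Rightarrow> real^'d^'d)"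
    by (intro linear_linear[THEN iffD2] linearI) (simp_all add: transpose_def vec_eq_iff)
  from integral_bounded_linear[OF this int]
  have "transpose (LINT t|M. X t) = (LINT t|M. transpose (X t))" by simp
  also have "\<dots> = (LINT t|M. X t)"
    using X by (intro Bochner_Integration.integral_cong) (auto simp: nonneg_mats_def sym_mats_def)
  finally have "(LINT t|M. X t) \<in> sym_mats"
    by (simp add: sym_mats_def)
  moreover have "0 \<le> v \<bullet> ((LINT t|M. X t) *v v)" for v
  proof -
    have "bounded_linear (\<lambda>A :: real^'d^'d. v \<bullet> (A *v v))"
      by (intro linear_linear[THEN iffD2] linearI)
        (simp_all add: matrix_vector_mult_add_rdistrib inner_add_right scaleR_matrix_vector_assoc[symmetric])
    from integral_bounded_linear[OF this int]
    have "v \<bullet> ((LINT t|M. X t) *v v) = (LINT t|M. v \<bullet> (X t *v v))" by simp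
    also have "0 \<le> \<dots>"
      using X by (intro integral_nonneg_AE AE_I2) (auto simp: nonneg_mats_def)
    finally show ?thesis .
  qed
  ultimately show ?thesis
    by (simp add: nonneg_mats_def)
qed

lemma nn_integral_const_unit_interval: "(\<integral>\<^sup>+t\<in>{0<..<1::real}. c \<partial>lborel) = c"
  by (simp add: nn_integral_cmult_indicator)

lemma integrable_slice_mat_measure:
  fixes \<Lambda> :: "(real^'d) set \<Rightarrow> real^'d^'d" and E :: "(real \<times> (real^'d)) set"
  assumes \<Lambda>: "mat_measure borel \<Lambda>" and E: "E \<in> sets borel"
  shows "integrable unit_time (\<lambda>t. \<Lambda> (Pair t -` E))"
proof -
  let ?V = "variation borel \<Lambda>" and ?g = "polar_density borel \<Lambda>"
  interpret T: prob_space unit_time by (rule prob_space_unit_time)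
  interpret V: finite_measure ?V by (rule finite_variation[OF \<Lambda>])
  have g: "?g \<in> borel_measurable ?V"
    using integrable_polar_density[OF \<Lambda>] by auto
  have slice: "\<Lambda> (Pair t -` E) = (LINT x|?V. indicator E (t, x) *\<^sub>R ?g x)" for t
    unfolding polar_density_eq[OF \<Lambda> slice_in_borel[OF E]] set_lebesgue_integral_def
    by (intro Bochner_Integration.integral_cong) (auto simp: indicator_def)
  have "sets ((borel :: real measure) \<Otimes>\<^sub>M ?V) = sets (borel :: (real \<times> (real^'d)) measure)"
    unfolding borel_prod[symmetric] by (rule sets_pair_measure_cong[OF refl sets_variation[OF \<Lambda>]])
  with E have "E \<in> sets ((borel :: real measure) \<Otimes>\<^sub>M ?V)" by blast
  then have "(\<lambda>(t, x). indicator E (t, x) *\<^sub>R ?g x) \<in> borel_measurable ((borel :: real measure) \<Otimes>\<^sub>M ?V)"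
    unfolding split_beta
    by (intro borel_measurable_scaleR) (auto intro: measurable_compose[OF measurable_snd g])
  then have "(\<lambda>t. \<Lambda> (Pair t -` E)) \<in> borel_measurable (borel :: real measure)"
    unfolding slice by (rule V.borel_measurable_lebesgue_integral)
  then have "(\<lambda>t. \<Lambda> (Pair t -` E)) \<in> borel_measurable unit_time"
    by (intro unit_time_borel_measurable measurable_restrict_space1)
  moreover have "norm (\<Lambda> (Pair t -` E)) \<le> (LINT x|?V. norm (?g x))" for t
  proof -
    have int: "integrable ?V (\<lambda>x. indicator (Pair t -` E) x *\<^sub>R ?g x)"
      by (rule set_integrable_polar_density[OF \<Lambda> slice_in_borel[OF E]])
    have "norm (\<Lambda> (Pair t -` E)) \<le> (LINT x|?V. norm (indicator (Pair t -` E) x *\<^sub>R ?g x))"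
      unfolding polar_density_eq[OF \<Lambda> slice_in_borel[OF E]] set_lebesgue_integral_def
      by (rule integral_norm_bound)
    also have "\<dots> \<le> (LINT x|?V. norm (?g x))"
      by (intro integral_mono integrable_norm int integrable_polar_density[OF \<Lambda>]) (auto simp: indicator_def)
    finally show ?thesis .
  qed
  ultimately show ?thesis
    by (intro T.integrable_const_bound[OF AE_I2])
qed

text \<open>Countable additivity is inherited slice by slice. The partial sums are dominated by the trace of the
  slice of the union, since the traces of the pieces are nonnegative.\<close>

lemma mat_measure_constant_in_time:
  fixes \<Lambda> :: "(real^'d) set \<Rightarrow> real^'d^'d"
  assumes \<Lambda>: "mat_measure borel \<Lambda>"
  shows "mat_measure (restrict_space borel (strip :: (real \<times> (real^'d)) set))
    (\<lambda>E. LINT t|unit_time. \<Lambda> (Pair t -` E))"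
  unfolding mat_measure_def
proof (intro conjI ballI allI impI)
  have nonneg: "\<Lambda> E \<in> nonneg_mats" if "E \<in> sets borel" for E
    using \<Lambda> that by (simp add: mat_measure_def)
  show "(LINT t|unit_time. \<Lambda> (Pair t -` E)) \<in> nonneg_mats" if "E \<in> sets (restrict_space borel strip)"
    for E :: "(real \<times> (real^'d)) set"
  proof -
    have "E \<in> sets borel" using that by (simp add: sets_strip_iff)
    then show ?thesis
      by (intro integral_in_nonneg_mats integrable_slice_mat_measure \<Lambda> nonneg slice_in_borel)
  qed
  fix A :: "nat \<Rightarrow> (real \<times> (real^'d)) set"
  assume A: "range A \<subseteq> sets (restrict_space borel strip)" "disjoint_family A"
  then have A_sets: "A n \<in> sets borel" for n
    using sets_strip_iff by blast
  then have U: "(\<Union>n. A n) \<in> sets borel" by auto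
  have sums: "(\<lambda>n. \<Lambda> (Pair t -` A n)) sums \<Lambda> (Pair t -` (\<Union>n. A n))" for t
  proof -
    have "(\<lambda>n. \<Lambda> (Pair t -` A n)) sums \<Lambda> (\<Union>n. Pair t -` A n)"
    proof -
      have "range (\<lambda>n. Pair t -` A n) \<subseteq> sets borel"
        using slice_in_borel[OF A_sets] by auto
      moreover have "disjoint_family (\<lambda>n. Pair t -` A n)"
        using A(2) by (auto simp: disjoint_family_on_def)
      ultimately show ?thesis
        using \<Lambda> unfolding mat_measure_def by blast
    qed
    then show ?thesis by (simp only: vimage_UN)
  qed
  let ?K = "(real CARD('d))\<^sup>2"
  have "(\<lambda>n. LINT t|unit_time. (\<Sum>i<n. \<Lambda> (Pair t -` A i))) \<longlonglongrightarrow> (LINT t|unit_time. \<Lambda> (Pair t -` (\<Union>n. A n)))"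
  proof (rule integral_dominated_convergence)
    show "(\<lambda>t. \<Lambda> (Pair t -` (\<Union>n. A n))) \<in> borel_measurable unit_time"
      by (rule borel_measurable_integrable[OF integrable_slice_mat_measure[OF \<Lambda> U]])
    show "(\<lambda>t. \<Sum>i<n. \<Lambda> (Pair t -` A i)) \<in> borel_measurable unit_time" for n
      by (intro borel_measurable_sum borel_measurable_integrable[OF integrable_slice_mat_measure[OF \<Lambda> A_sets]])
    show "integrable unit_time (\<lambda>t. ?K * trace (\<Lambda> (Pair t -` (\<Union>n. A n))))"
      by (intro integrable_mult_right integrable_bounded_linear[OF bounded_linear_trace]
          integrable_slice_mat_measure[OF \<Lambda> U])
    show "AE t in unit_time. (\<lambda>n. \<Sum>i<n. \<Lambda> (Pair t -` A i)) \<longlonglongrightarrow> \<Lambda> (Pair t -` (\<Union>n. A n))"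
      using sums by (intro AE_I2) (simp add: sums_def)
    show "AE t in unit_time. norm (\<Sum>i<n. \<Lambda> (Pair t -` A i)) \<le> ?K * trace (\<Lambda> (Pair t -` (\<Union>n. A n)))" for n
    proof (rule AE_I2)
      fix t
      have tr: "(\<lambda>n. trace (\<Lambda> (Pair t -` A n))) sums trace (\<Lambda> (Pair t -` (\<Union>n. A n)))"
        by (rule bounded_linear.sums[OF bounded_linear_trace sums])
      have "norm (\<Sum>i<n. \<Lambda> (Pair t -` A i)) \<le> (\<Sum>i<n. ?K * trace (\<Lambda> (Pair t -` A i)))"
        by (intro order_trans[OF norm_sum] sum_mono norm_nonneg_mats_le_trace nonneg slice_in_borel A_sets)
      also have "\<dots> = ?K * (\<Sum>i<n. trace (\<Lambda> (Pair t -` A i)))"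
        by (simp add: sum_distrib_left)
      also have "\<dots> \<le> ?K * trace (\<Lambda> (Pair t -` (\<Union>n. A n)))"
        using sum_le_suminf[OF sums_summable[OF tr], of "{..<n}"]
          trace_nonneg[OF nonneg[OF slice_in_borel[OF A_sets]]] sums_unique[OF tr]
        by (intro mult_left_mono) auto
      finally show "norm (\<Sum>i<n. \<Lambda> (Pair t -` A i)) \<le> ?K * trace (\<Lambda> (Pair t -` (\<Union>n. A n)))" .
    qed
  qed
  then show "(\<lambda>n. LINT t|unit_time. \<Lambda> (Pair t -` A n)) sums (LINT t|unit_time. \<Lambda> (Pair t -` (\<Union>n. A n)))"
    unfolding sums_def
    by (subst (asm) Bochner_Integration.integral_sum) (rule integrable_slice_mat_measure[OF \<Lambda> A_sets])
qed

section \<open>Testing the linear interpolation\<close>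

lemma tendsto_integral_at_within:
  fixes h :: "real \<Rightarrow> 'a \<Rightarrow> real"
  assumes "finite_measure M"
    and meas: "\<And>s. s \<in> S \<Longrightarrow> s \<noteq> t \<Longrightarrow> h s \<in> borel_measurable M" "l \<in> borel_measurable M"
    and bound: "\<And>s x. s \<in> S \<Longrightarrow> s \<noteq> t \<Longrightarrow> \<bar>h s x\<bar> \<le> C"
    and lim: "\<And>x. ((\<lambda>s. h s x) \<longlongrightarrow> l x) (at t within S)"
  shows "((\<lambda>s. \<integral>x. h s x \<partial>M) \<longlongrightarrow> (\<integral>x. l x \<partial>M)) (at t within S)"
  unfolding tendsto_at_iff_sequentially comp_def
proof (intro allI impI)
  interpret finite_measure M by fact
  fix X :: "nat \<Rightarrow> real" assume X: "\<forall>i. X i \<in> S - {t}" "X \<longlonglongrightarrow> t"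
  show "(\<lambda>i. \<integral>x. h (X i) x \<partial>M) \<longlonglongrightarrow> (\<integral>x. l x \<partial>M)"
  proof (rule integral_dominated_convergence)
    show "integrable M (\<lambda>_. C)" by simp
    show "AE x in M. (\<lambda>i. h (X i) x) \<longlonglongrightarrow> l x"
    proof (rule AE_I2)
      fix x
      show "(\<lambda>i. h (X i) x) \<longlonglongrightarrow> l x"
        using lim[of x] X unfolding tendsto_at_iff_sequentially comp_def by blast
    qed
  qed (use meas bound X in auto)
qed

lemma at_within_Ioo:
  "at 0 within {0<..<1} = at_right (0::real)" "at 1 within {0<..<1} = at_left (1::real)"
  by (rule at_within_nhd[of _ "{..<1}"]; auto) (rule at_within_nhd[of _ "{0<..}"]; auto)

lemma C12b_supp_slice:
  assumes "C12b_supp \<phi> D G H" "t \<in> {0<..<1}"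
  shows "C2b (\<phi> t) (G t) (H t)" "continuous_on UNIV (D t)"
proof -
  have slice: "continuous_on UNIV (h t)" if "continuous_on strip (\<lambda>(t, x). h t x)"
    for h :: "real \<Rightarrow> real^'a \<Rightarrow> 'b::topological_space"
  proof -
    have "continuous_on UNIV (\<lambda>x. (\<lambda>(t, x). h t x) (t, x))"
      by (rule continuous_on_compose2[OF that]) (use assms(2) in \<open>auto simp: strip_def intro!: continuous_intros\<close>)
    then show ?thesis by simp
  qed
  show "continuous_on UNIV (D t)"
    using assms(1) by (intro slice) (simp add: C12b_supp_def)
  have "bounded (range (H t))"
    by (rule bounded_subset[of "(\<lambda>(t, x). H t x) ` strip"])
      (use assms in \<open>auto simp: C12b_supp_def strip_def image_iff\<close>)
  moreover have "continuous_on UNIV (H t)"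
    using assms(1) by (intro slice) (simp add: C12b_supp_def)
  ultimately show "C2b (\<phi> t) (G t) (H t)"
    using assms by (simp add: C12b_supp_def C2b_def)
qed

text \<open>The width \<open>\<delta>\<close> depends on \<open>x\<close>, so that boundary values of spatial integrals have to be taken by
  dominated convergence.\<close>

lemma C12b_supp_vanishes_near_endpoints:
  fixes \<phi> :: "real \<Rightarrow> real^'d \<Rightarrow> real"
  assumes "C12b_supp \<phi> D G H"
  shows "\<exists>\<delta>>0. \<forall>t\<in>{0<..<1}. t < \<delta> \<or> 1 - \<delta> < t \<longrightarrow> \<phi> t x = 0"
proof -
  let ?S = "{(t, x). (t, x) \<in> strip \<and> \<phi> t x \<noteq> 0}"
  have near: "\<exists>\<delta>>0. \<forall>t\<in>{0<..<1}. \<bar>t - a\<bar> < \<delta> \<longrightarrow> \<phi> t x = 0" if "a \<notin> {0<..<1}" for a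
  proof -
    have "closure ?S \<subseteq> strip"
      using assms by (simp add: C12b_supp_def)
    then have "(a, x) \<notin> closure ?S"
      using that by (auto simp: strip_def)
    then obtain \<delta> where \<delta>: "0 < \<delta>" "\<And>z. z \<in> ?S \<Longrightarrow> \<delta> \<le> dist z (a, x)"
      unfolding closure_approachable by (meson not_le)
    have "\<phi> t x = 0" if "t \<in> {0<..<1}" "\<bar>t - a\<bar> < \<delta>" for t
    proof (rule ccontr)
      assume "\<phi> t x \<noteq> 0"
      then have "(t, x) \<in> ?S" using that by (simp add: strip_def)
      then have "\<delta> \<le> dist (t, x) (a, x)" by (rule \<delta>(2))
      then show False using that(2) by (simp add: dist_Pair_Pair dist_real_def)
    qed
    then show ?thesis using \<delta>(1) by blast
  qed
  obtain \<delta>0 \<delta>1 where \<delta>: "0 < \<delta>0" "\<And>t. t \<in> {0<..<1} \<Longrightarrow> \<bar>t - 0\<bar> < \<delta>0 \<Longrightarrow> \<phi> t x = 0"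
    "0 < \<delta>1" "\<And>t. t \<in> {0<..<1} \<Longrightarrow> \<bar>t - 1\<bar> < \<delta>1 \<Longrightarrow> \<phi> t x = 0"
    using near[of 0] near[of 1] by auto
  show ?thesis
  proof (intro exI[of _ "min \<delta>0 \<delta>1"] conjI ballI impI)
    show "0 < min \<delta>0 \<delta>1" using \<delta> by simp
    fix t assume t: "t \<in> {0<..<1}" "t < min \<delta>0 \<delta>1 \<or> 1 - min \<delta>0 \<delta>1 < t"
    then show "\<phi> t x = 0"
      using \<delta>(2)[of t] \<delta>(4)[of t] by (auto simp: abs_if)
  qed
qed

text \<open>Since \<open>\<phi>\<close> vanishes near the endpoints of every time line, the bound on \<open>\<partial>\<^sub>t\<phi>\<close> also bounds \<open>\<phi>\<close>, although no
  bound on \<open>\<phi>\<close> is part of the class.\<close>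

lemma C12b_supp_bounds:
  fixes \<phi> :: "real \<Rightarrow> real^'d \<Rightarrow> real"
  assumes C: "C12b_supp \<phi> D G H"
  obtains M where "\<And>t x. t \<in> {0<..<1} \<Longrightarrow> \<bar>D t x\<bar> \<le> M"
    "\<And>s t x. s \<in> {0<..<1} \<Longrightarrow> t \<in> {0<..<1} \<Longrightarrow> \<bar>\<phi> s x - \<phi> t x\<bar> \<le> M * \<bar>s - t\<bar>"
    "\<And>t x. t \<in> {0<..<1} \<Longrightarrow> \<bar>\<phi> t x\<bar> \<le> M"
proof -
  have "bounded ((\<lambda>(t, x). D t x) ` strip)"
    using C by (simp add: C12b_supp_def)
  then obtain M where "\<forall>z\<in>strip. norm ((\<lambda>(t, x). D t x) z) \<le> M"
    by (auto simp: bounded_iff)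
  then have M: "\<bar>D t x\<bar> \<le> M" if "t \<in> {0<..<1}" for t x
    using that by (force simp: strip_def)
  have lip: "\<bar>\<phi> s x - \<phi> t x\<bar> \<le> M * \<bar>s - t\<bar>" if "s \<in> {0<..<1}" "t \<in> {0<..<1}" for s t x
  proof -
    have "norm (\<phi> s x - \<phi> t x) \<le> M * norm (s - t)"
    proof (rule field_differentiable_bound[of "{0<..<1}" "\<lambda>s. \<phi> s x" "\<lambda>s. D s x"])
      show "((\<lambda>s. \<phi> s x) has_field_derivative D u x) (at u within {0<..<1})" if "u \<in> {0<..<1}" for u
        using C that by (auto simp: C12b_supp_def intro: has_field_derivative_at_within)
    qed (use that M in auto)
    then show ?thesis by simp
  qed
  have "0 \<le> M" using M[of "1/2" 0] by auto
  have "\<bar>\<phi> t x\<bar> \<le> M" if t: "t \<in> {0<..<1}" for t x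
  proof -
    obtain \<delta> where \<delta>: "0 < \<delta>" "\<forall>t\<in>{0<..<1}. t < \<delta> \<or> 1 - \<delta> < t \<longrightarrow> \<phi> t x = 0"
      using C12b_supp_vanishes_near_endpoints[OF C, of x] by blast
    define s where "s = min (\<delta> / 2) (1 / 2)"
    have s: "s \<in> {0<..<1}" "s < \<delta>" using \<delta>(1) by (auto simp: s_def min_def)
    then have "\<phi> s x = 0" using \<delta>(2) by blast
    then have "\<bar>\<phi> t x\<bar> \<le> M * \<bar>t - s\<bar>" using lip[OF t s(1), of x] by simp
    also have "\<dots> \<le> M * 1"
      using t s \<open>0 \<le> M\<close> by (intro mult_left_mono) auto
    finally show ?thesis by simp
  qed
  with M lip show ?thesis by (rule that)
qed

lemma C12b_supp_integral:
  fixes \<phi> :: "real \<Rightarrow> real^'d \<Rightarrow> real"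
  assumes C: "C12b_supp \<phi> D G H" and \<rho>: "\<rho> \<in> P2"
  defines "a \<equiv> \<lambda>t. \<integral>x. \<phi> t x \<partial>\<rho>" and "d \<equiv> \<lambda>t. \<integral>x. D t x \<partial>\<rho>"
  shows "\<And>t. t \<in> {0<..<1} \<Longrightarrow> (a has_real_derivative d t) (at t)"
    and "\<And>t. t \<in> {0<..<1} \<Longrightarrow> isCont d t"
    and "(a \<longlongrightarrow> 0) (at_right 0)" and "(a \<longlongrightarrow> 0) (at_left 1)"
    and "\<exists>M. \<forall>t\<in>{0<..<1}. \<bar>d t\<bar> \<le> M \<and> \<bar>a t\<bar> \<le> M"
    and "\<And>t. t \<in> {0<..<1} \<Longrightarrow> integrable \<rho> (D t)"
proof -
  interpret prob_space \<rho> by (rule P2_D(1)[OF \<rho>])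
  obtain M where M: "\<And>t x. t \<in> {0<..<1} \<Longrightarrow> \<bar>D t x\<bar> \<le> M"
    "\<And>s t x. s \<in> {0<..<1} \<Longrightarrow> t \<in> {0<..<1} \<Longrightarrow> \<bar>\<phi> s x - \<phi> t x\<bar> \<le> M * \<bar>s - t\<bar>"
    "\<And>t x. t \<in> {0<..<1} \<Longrightarrow> \<bar>\<phi> t x\<bar> \<le> M"
    using C12b_supp_bounds[OF C] by blast
  have meas_\<phi>: "\<phi> t \<in> borel_measurable \<rho>" if "t \<in> {0<..<1}" for t
    by (intro P2_D(5)[OF \<rho>] borel_measurable_continuous_onI C2b_D(3)[OF C12b_supp_slice(1)[OF C that]])
  have meas_D: "D t \<in> borel_measurable \<rho>" if "t \<in> {0<..<1}" for t
    by (intro P2_D(5)[OF \<rho>] borel_measurable_continuous_onI C12b_supp_slice(2)[OF C that])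
  have int_\<phi>: "integrable \<rho> (\<phi> t)" if "t \<in> {0<..<1}" for t
    using M(3)[OF that] by (intro integrable_const_bound[OF _ meas_\<phi>[OF that]] AE_I2) auto
  show int_D: "integrable \<rho> (D t)" if "t \<in> {0<..<1}" for t
    using M(1)[OF that] by (intro integrable_const_bound[OF _ meas_D[OF that]] AE_I2) auto
  have within: "at t within {0<..<1} = at t" if "t \<in> {0<..<1}" for t :: real
    using that by (intro at_within_open) auto
  show "(a has_real_derivative d t) (at t)" if t: "t \<in> {0<..<1}" for t
  proof -
    have "((\<lambda>s. \<integral>x. (\<phi> s x - \<phi> t x) / (s - t) \<partial>\<rho>) \<longlongrightarrow> d t) (at t within {0<..<1})"
      unfolding d_def
    proof (rule tendsto_integral_at_within[where C = M])
      show "finite_measure \<rho>" by (rule finite_measure_axioms)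
      show "(\<lambda>x. (\<phi> s x - \<phi> t x) / (s - t)) \<in> borel_measurable \<rho>" if "s \<in> {0<..<1}" for s
        using meas_\<phi>[OF that] meas_\<phi>[OF t] by measurable
      show "\<bar>(\<phi> s x - \<phi> t x) / (s - t)\<bar> \<le> M" if "s \<in> {0<..<1}" "s \<noteq> t" for s x
        using M(2)[OF that(1) t, of x] that(2) by (simp add: abs_divide divide_le_eq)
      show "((\<lambda>s. (\<phi> s x - \<phi> t x) / (s - t)) \<longlongrightarrow> D t x) (at t within {0<..<1})" for x
      proof -
        have "((\<lambda>s. \<phi> s x) has_real_derivative D t x) (at t)"
          using C t unfolding C12b_supp_def by blast
        then show ?thesis
          unfolding within[OF t] has_field_derivative_iff .
      qed
    qed (rule meas_D[OF t])
    moreover have "(\<integral>x. (\<phi> s x - \<phi> t x) / (s - t) \<partial>\<rho>) = (a s - a t) / (s - t)" if "s \<in> {0<..<1}" for s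
      using int_\<phi>[OF that] int_\<phi>[OF t] by (simp add: a_def)
    then have "\<forall>\<^sub>F s in at t within {0<..<1}. (\<integral>x. (\<phi> s x - \<phi> t x) / (s - t) \<partial>\<rho>) = (a s - a t) / (s - t)"
      unfolding eventually_at_filter by (intro always_eventually) blast
    ultimately have "((\<lambda>s. (a s - a t) / (s - t)) \<longlongrightarrow> d t) (at t within {0<..<1})"
      by (rule Lim_transform_eventually)
    then show ?thesis
      unfolding within[OF t] has_field_derivative_iff .
  qed
  show "isCont d t" if t: "t \<in> {0<..<1}" for t
  proof -
    have cont: "continuous_on strip (\<lambda>(t, x). D t x)"
      using C by (simp add: C12b_supp_def)
    have "(d \<longlongrightarrow> d t) (at t within {0<..<1})"
      unfolding d_def
    proof (rule tendsto_integral_at_within[where C = M])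
      show "finite_measure \<rho>" by (rule finite_measure_axioms)
      show "((\<lambda>s. D s x) \<longlongrightarrow> D t x) (at t within {0<..<1})" for x
      proof -
        have "continuous_on {0<..<1} (\<lambda>s. (\<lambda>(t, x). D t x) (s, x))"
          by (rule continuous_on_compose2[OF cont]) (auto simp: strip_def intro!: continuous_intros)
        then show ?thesis
          using t by (simp add: continuous_on_def)
      qed
      show "D s \<in> borel_measurable \<rho>" "\<bar>D s x\<bar> \<le> M" if "s \<in> {0<..<1}" for s x
        using that by (rule meas_D M(1))+
    qed (rule meas_D[OF t])
    then show ?thesis
      unfolding within[OF t] isCont_def .
  qed
  have lim0: "((\<lambda>s. \<phi> s x) \<longlongrightarrow> 0) (at 0 within {0<..<1})" "((\<lambda>s. \<phi> s x) \<longlongrightarrow> 0) (at 1 within {0<..<1})" for x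
  proof -
    obtain \<delta> where \<delta>: "0 < \<delta>" "\<forall>t\<in>{0<..<1}. t < \<delta> \<or> 1 - \<delta> < t \<longrightarrow> \<phi> t x = 0"
      using C12b_supp_vanishes_near_endpoints[OF C, of x] by blast
    have "\<forall>\<^sub>F s in at 0 within {0<..<1}. \<phi> s x = 0"
      unfolding eventually_at using \<delta> by (intro exI[of _ \<delta>]) (auto simp: dist_real_def)
    then show "((\<lambda>s. \<phi> s x) \<longlongrightarrow> 0) (at 0 within {0<..<1})"
      by (rule tendsto_eventually)
    have "\<forall>\<^sub>F s in at 1 within {0<..<1}. \<phi> s x = 0"
      unfolding eventually_at using \<delta> by (intro exI[of _ \<delta>]) (auto simp: dist_real_def)
    then show "((\<lambda>s. \<phi> s x) \<longlongrightarrow> 0) (at 1 within {0<..<1})"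
      by (rule tendsto_eventually)
  qed
  have lim: "(a \<longlongrightarrow> 0) (at e within {0<..<1})"
    if "\<And>x. ((\<lambda>s. \<phi> s x) \<longlongrightarrow> 0) (at e within {0<..<1})" for e
  proof -
    have "(a \<longlongrightarrow> (\<integral>x. 0 \<partial>\<rho>)) (at e within {0<..<1})"
      unfolding a_def
      by (rule tendsto_integral_at_within[where C = M, OF finite_measure_axioms _ _ _ that])
        (erule meas_\<phi>, rule borel_measurable_const, erule M(3))
    then show ?thesis by simp
  qed
  show "(a \<longlongrightarrow> 0) (at_right 0)"
    using lim[OF lim0(1)] at_within_Ioo(1) by simp
  show "(a \<longlongrightarrow> 0) (at_left 1)"
    using lim[OF lim0(2)] at_within_Ioo(2) by simp
  have "\<bar>\<integral>x. h x \<partial>\<rho>\<bar> \<le> M" if "integrable \<rho> h" "\<And>x. \<bar>h x\<bar> \<le> M" for h :: "real^'d \<Rightarrow> real"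
  proof -
    have "\<bar>\<integral>x. h x \<partial>\<rho>\<bar> \<le> (\<integral>x. \<bar>h x\<bar> \<partial>\<rho>)"
      using integral_norm_bound[of \<rho> h] by simp
    also have "\<dots> \<le> (\<integral>x. M \<partial>\<rho>)"
      using that by (intro integral_mono) auto
    finally show ?thesis by (simp add: prob_space)
  qed
  then show "\<exists>M. \<forall>t\<in>{0<..<1}. \<bar>d t\<bar> \<le> M \<and> \<bar>a t\<bar> \<le> M"
    unfolding a_def d_def by (intro exI[of _ M] ballI conjI) (simp_all add: int_D int_\<phi> M(1,3))
qed

text \<open>This is \<open>\<partial>\<^sub>t \<rho>\<^sub>t = \<nu> - \<mu>\<close> in weak form: the function \<open>F(t) = \<integral> \<phi> t d\<rho>\<^sub>t\<close> vanishes at both ends, and its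
  derivative is \<open>\<integral> \<partial>\<^sub>t\<phi> d\<rho>\<^sub>t + \<integral> \<phi> t d\<nu> - \<integral> \<phi> t d\<mu>\<close>.\<close>

lemma interpolation_test_identity:
  fixes \<phi> :: "real \<Rightarrow> real^'d \<Rightarrow> real"
  assumes C: "C12b_supp \<phi> D G H" and \<mu>\<nu>: "\<mu> \<in> P2" "\<nu> \<in> P2"
  shows "(LBINT t:{0<..<1}. (\<integral>x. D t x \<partial>mixture \<mu> \<nu> t))
    = - (LBINT t:{0<..<1}. (\<integral>x. \<phi> t x \<partial>\<nu>) - (\<integral>x. \<phi> t x \<partial>\<mu>))"
proof -
  define a where "a t = (\<integral>x. \<phi> t x \<partial>\<mu>)" for t
  define b where "b t = (\<integral>x. \<phi> t x \<partial>\<nu>)" for t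
  define p where "p t = (\<integral>x. D t x \<partial>\<mu>)" for t
  define q where "q t = (\<integral>x. D t x \<partial>\<nu>)" for t
  note A = C12b_supp_integral[OF C \<mu>\<nu>(1), folded a_def p_def]
  note B = C12b_supp_integral[OF C \<mu>\<nu>(2), folded b_def q_def]
  define F where "F t = (1 - t) * a t + t * b t" for t
  define F' where "F' t = (t * q t + (1 - t) * p t) + (b t - a t)" for t
  have int: "set_integrable lborel {0<..<1} h"
    if cont: "\<And>t. t \<in> {0<..<1} \<Longrightarrow> isCont h t" and bdd: "\<And>t. t \<in> {0<..<1} \<Longrightarrow> \<bar>h t\<bar> \<le> M" for h :: "real \<Rightarrow> real" and M
  proof -
    interpret T: prob_space unit_time by (rule prob_space_unit_time)
    have "h \<in> borel_measurable unit_time"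
      by (intro unit_time_borel_measurable borel_measurable_continuous_on_restrict
          continuous_at_imp_continuous_on ballI cont)
    then show ?thesis
      unfolding unit_time_integral(2) using bdd
      by (intro T.integrable_const_bound[of _ M] AE_I2) (auto simp: space_unit_time)
  qed
  obtain M where M: "\<And>t. t \<in> {0<..<1} \<Longrightarrow> \<bar>p t\<bar> \<le> M" "\<And>t. t \<in> {0<..<1} \<Longrightarrow> \<bar>a t\<bar> \<le> M"
    "\<And>t. t \<in> {0<..<1} \<Longrightarrow> \<bar>q t\<bar> \<le> M" "\<And>t. t \<in> {0<..<1} \<Longrightarrow> \<bar>b t\<bar> \<le> M"
  proof -
    obtain M1 M2 where "\<forall>t\<in>{0<..<1}. \<bar>p t\<bar> \<le> M1 \<and> \<bar>a t\<bar> \<le> M1" "\<forall>t\<in>{0<..<1}. \<bar>q t\<bar> \<le> M2 \<and> \<bar>b t\<bar> \<le> M2"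
      using A(5) B(5) by blast
    then show ?thesis
      by (intro that[of "max M1 M2"]) (auto simp: le_max_iff_disj)
  qed
  have cont_ab: "isCont a t" "isCont b t" if "t \<in> {0<..<1}" for t
    using A(1)[OF that] B(1)[OF that] by (auto intro: DERIV_isCont)
  have int1: "set_integrable lborel {0<..<1} (\<lambda>t. t * q t + (1 - t) * p t)"
  proof (rule int)
    show "isCont (\<lambda>t. t * q t + (1 - t) * p t) t" if "t \<in> {0<..<1}" for t
      using A(2)[OF that] B(2)[OF that] by (intro continuous_intros)
    show "\<bar>t * q t + (1 - t) * p t\<bar> \<le> M" if t: "t \<in> {0<..<1}" for t
    proof -
      have "\<bar>t * q t + (1 - t) * p t\<bar> \<le> t * \<bar>q t\<bar> + (1 - t) * \<bar>p t\<bar>"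
        using t abs_triangle_ineq[of "t * q t" "(1 - t) * p t"] by (simp add: abs_mult)
      also have "\<dots> \<le> t * M + (1 - t) * M"
        using t M by (intro add_mono mult_left_mono) auto
      finally show ?thesis by (simp add: algebra_simps)
    qed
  qed
  have int2: "set_integrable lborel {0<..<1} (\<lambda>t. b t - a t)"
  proof (rule int)
    show "isCont (\<lambda>t. b t - a t) t" if "t \<in> {0<..<1}" for t
      using cont_ab[OF that] by (intro continuous_intros)
    show "\<bar>b t - a t\<bar> \<le> 2 * M" if "t \<in> {0<..<1}" for t
      using M(2,4)[OF that] by linarith
  qed
  have "(LBINT t=ereal 0..ereal 1. F' t) = 0 - 0"
  proof (rule interval_integral_FTC_integrable[where F = F])
    have mem: "t \<in> {0<..<1}" if "ereal 0 < ereal t" "ereal t < ereal 1" for t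
      using that by simp
    show "(F has_vector_derivative F' t) (at t)" if "ereal 0 < ereal t" "ereal t < ereal 1" for t
    proof -
      note t = mem[OF that]
      have "(F has_real_derivative F' t) (at t)"
        unfolding F_def F'_def
        by (rule derivative_eq_intros A(1)[OF t] B(1)[OF t] refl)+ (simp add: algebra_simps)
      then show ?thesis
        by (simp add: has_real_derivative_iff_has_vector_derivative)
    qed
    show "isCont F' t" if "ereal 0 < ereal t" "ereal t < ereal 1" for t
      unfolding F'_def
      using A(2)[OF mem[OF that]] B(2)[OF mem[OF that]] cont_ab[OF mem[OF that]]
      by (intro continuous_intros)
    show "set_integrable lborel (einterval (ereal 0) (ereal 1)) F'"
      unfolding F'_def using set_integral_add(1)[OF int1 int2] by simp
    have "(F \<longlongrightarrow> (1 - 0) * 0 + 0 * 0) (at_right 0)"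
      unfolding F_def by (intro tendsto_intros A(3) B(3))
    then show "((F \<circ> real_of_ereal) \<longlongrightarrow> 0) (at_right (ereal 0))"
      by (simp only: ereal_tendsto_simps) simp
    have "(F \<longlongrightarrow> (1 - 1) * 0 + 1 * 0) (at_left 1)"
      unfolding F_def by (intro tendsto_intros A(4) B(4))
    then show "((F \<circ> real_of_ereal) \<longlongrightarrow> 0) (at_left (ereal 1))"
      by (simp only: ereal_tendsto_simps) simp
  qed simp
  then have "(LBINT t:{0<..<1}. F' t) = 0"
    by (simp add: interval_lebesgue_integral_def)
  then have "(LBINT t:{0<..<1}. t * q t + (1 - t) * p t) + (LBINT t:{0<..<1}. b t - a t) = 0"
    unfolding F'_def set_integral_add(2)[OF int1 int2] .
  moreover have "(LBINT t:{0<..<1}. (\<integral>x. D t x \<partial>mixture \<mu> \<nu> t)) = (LBINT t:{0<..<1}. t * q t + (1 - t) * p t)"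
  proof (rule set_lebesgue_integral_cong; (intro allI impI)?)
    fix t :: real assume t: "t \<in> {0<..<1}"
    then have "t \<in> {0..1}" by simp
    then show "(\<integral>x. D t x \<partial>mixture \<mu> \<nu> t) = t * q t + (1 - t) * p t"
      unfolding p_def q_def
      by (intro integral_mixture(2) \<mu>\<nu> borel_measurable_continuous_onI C12b_supp_slice(2)[OF C t] A(6) B(6) t)
  qed simp
  ultimately show ?thesis
    by (simp add: a_def b_def)
qed

proposition constant_solution_fokker_planck:
  fixes \<Lambda> :: "(real^'d) set \<Rightarrow> real^'d^'d"
  assumes st: "static_equation \<Lambda> \<mu> \<nu>" and \<mu>\<nu>: "\<mu> \<in> P2" "\<nu> \<in> P2"
  shows "fokker_planck (mixture_path \<mu> \<nu>) (\<lambda>E. LINT t|unit_time. \<Lambda> (Pair t -` E))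
    (mixture \<mu> \<nu>) (\<lambda>_. \<Lambda>)"
  unfolding fokker_planck_def
proof (intro conjI allI impI)
  have \<Lambda>: "mat_measure borel \<Lambda>"
    using st by (simp add: static_equation_def)
  show "mixture_path \<mu> \<nu> \<in> P2_strip" "time_disintegration (mixture_path \<mu> \<nu>) (mixture \<mu> \<nu>)"
    using \<mu>\<nu> by (rule mixture_path_P2_strip mixture_path_disintegration)+
  show "mat_measure (restrict_space borel strip) (\<lambda>E. LINT t|unit_time. \<Lambda> (Pair t -` E))"
    by (rule mat_measure_constant_in_time[OF \<Lambda>])
  show "mat_time_disintegration (\<lambda>E. LINT t|unit_time. \<Lambda> (Pair t -` E)) (\<lambda>_. \<Lambda>)"
    unfolding mat_time_disintegration_def unit_time_integral
    using \<Lambda> integrable_slice_mat_measure[OF \<Lambda>] by (auto simp: sets_strip_iff)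
  show "(\<integral>\<^sup>+t\<in>{0<..<1::real}. emeasure (variation borel \<Lambda>) UNIV \<partial>lborel) < \<infinity>"
    unfolding nn_integral_const_unit_interval using st by (simp add: static_equation_def)
  fix \<phi> :: "real \<Rightarrow> real^'d \<Rightarrow> real" and D G H assume C: "C12b_supp \<phi> D G H"
  have "(LBINT t:{0<..<1}. mat_integral (\<lambda>x. (1/2) *\<^sub>R H t x) \<Lambda>)
      = (LBINT t:{0<..<1}. (\<integral>x. \<phi> t x \<partial>\<nu>) - (\<integral>x. \<phi> t x \<partial>\<mu>))"
  proof (rule set_lebesgue_integral_cong; (intro allI impI)?)
    fix t :: real assume "t \<in> {0<..<1}"
    then show "mat_integral (\<lambda>x. (1/2) *\<^sub>R H t x) \<Lambda> = (\<integral>x. \<phi> t x \<partial>\<nu>) - (\<integral>x. \<phi> t x \<partial>\<mu>)"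
      using st C12b_supp_slice(1)[OF C] unfolding static_equation_def by blast
  qed simp
  then show "(LBINT t:{0<..<1}. (\<integral>x. D t x \<partial>mixture \<mu> \<nu> t))
      = - (LBINT t:{0<..<1}. mat_integral (\<lambda>x. (1/2) *\<^sub>R H t x) \<Lambda>)"
    by (simp only: interpolation_test_identity[OF C \<mu>\<nu>])
qed

section \<open>Equality of the dynamic and the static cost\<close>

theorem proposition3p2:
  fixes f :: "real^'d^'d \<Rightarrow> ennreal" and \<mu> \<nu> :: "(real^'d) measure"
  assumes "convex_on_sym f" and "pos_homogeneous f" and "lsc_on_sym f"
    and "edom f \<subseteq> nonneg_mats" and "edom f \<noteq> {}"
    and "edom f \<subseteq> closure (edom f \<inter> pos_mats)"
    and "\<mu> \<in> P2" and "\<nu> \<in> P2"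
  shows "dynamic_cost f \<mu> \<nu> = Inf {mat_cost f \<Lambda> | \<Lambda>. static_equation \<Lambda> \<mu> \<nu>}"
proof (rule antisym)
  show "dynamic_cost f \<mu> \<nu> \<le> Inf {mat_cost f \<Lambda> | \<Lambda>. static_equation \<Lambda> \<mu> \<nu>}"
  proof (rule Inf_greatest)
    fix c assume "c \<in> {mat_cost f \<Lambda> | \<Lambda>. static_equation \<Lambda> \<mu> \<nu>}"
    then obtain \<Lambda> where \<Lambda>: "static_equation \<Lambda> \<mu> \<nu>" "c = mat_cost f \<Lambda>" by blast
    have c: "c = (\<integral>\<^sup>+t\<in>{0<..<1::real}. mat_cost f \<Lambda> \<partial>lborel)"
      unfolding nn_integral_const_unit_interval by (rule \<Lambda>(2))
    show "dynamic_cost f \<mu> \<nu> \<le> c"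
      unfolding dynamic_cost_def
    proof (rule Inf_lower, rule CollectI, intro exI conjI)
      show "c = (\<integral>\<^sup>+t\<in>{0<..<1::real}. mat_cost f ((\<lambda>_. \<Lambda>) t) \<partial>lborel)"
        using c by simp
      show "fokker_planck (mixture_path \<mu> \<nu>) (\<lambda>E. LINT t|unit_time. \<Lambda> (Pair t -` E))
          (mixture \<mu> \<nu>) (\<lambda>_. \<Lambda>)"
        by (rule constant_solution_fokker_planck[OF \<Lambda>(1) assms(7,8)])
      show "narrow_representative (mixture \<mu> \<nu>) (mixture \<mu> \<nu>)"
        by (rule narrow_representative_mixture[OF assms(7,8)])
    qed (rule mixture_endpoints[OF assms(7,8)])+
  qed
  show "Inf {mat_cost f \<Lambda> | \<Lambda>. static_equation \<Lambda> \<mu> \<nu>} \<le> dynamic_cost f \<mu> \<nu>"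
    unfolding dynamic_cost_def
  proof (rule Inf_greatest, elim CollectE exE conjE)
    fix c \<rho> \<Lambda> \<rho>t \<Lambda>t r
    assume c: "c = (\<integral>\<^sup>+t\<in>{0<..<1}. mat_cost f (\<Lambda>t t) \<partial>lborel)"
      and fp: "fokker_planck \<rho> \<Lambda> \<rho>t \<Lambda>t" and r: "narrow_representative \<rho>t r" "r 0 = \<mu>" "r 1 = \<nu>"
    have "static_equation (\<lambda>E. \<Lambda> ({0<..<1} \<times> E)) \<mu> \<nu>"
      using time_average_static_equation[OF fp r(1)] r(2,3) by simp
    then have "Inf {mat_cost f \<Lambda> | \<Lambda>. static_equation \<Lambda> \<mu> \<nu>} \<le> mat_cost f (\<lambda>E. \<Lambda> ({0<..<1} \<times> E))"
      by (intro Inf_lower) blast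
    also have "\<dots> \<le> c"
      unfolding c by (rule time_average_cost[OF assms(1-3) fp])
    finally show "Inf {mat_cost f \<Lambda> | \<Lambda>. static_equation \<Lambda> \<mu> \<nu>} \<le> c" .
  qed
qed

end
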